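(* Let $M\ge a>0$, $T>0$, $\rho\ge0$, and let $\gamma\in C^2([0,M])$ satisfy $\gamma(x)>0$ for all $x\in[0,M]$. Let $u=u(x,t)$ be an arbitrary solution (in the sense given in the context) of $$u_t=(\gamma u_x)_x\ \text{ in } ]0,a[\,\times\,]0,T[,\qquad \gamma(a)u_x(a,t)+\rho\,u(a,t)=0\ \text{ for } t\in\,]0,T[,\qquad u(x,0)=0\ \text{ in } ]0,a[ ,$$ and let $I(z)$, $\operatorname{Re}z\le0$, be the indicator function defined in the context. (1) Let $c$ be an arbitrary positive number satisfying $$T>2c\int_0^M\frac{dx}{\sqrt{\gamma(x)}} ,$$ and for $\tau>c^{-2}$ let $z=-c\tau\bigl(1+i\sqrt{1-\tfrac1{c^2\tau}}\bigr)$. Assume that there exist a positive constant $C$, a positive number $\tau_0$ ($>c^{-2}$) and a real number $\mu$ such that, for all $\tau>\tau_0$, $$C\,\tau^{\mu}\le\left|\int_0^Te^{-z^2t}u_x(0,t)\,dt\right| .$$ Then $$\lim_{\tau\to\infty}\frac{\log|I(z)|}{\tau}=-2c\int_0^a\frac{dx}{\sqrt{\gamma(x)}} .$$ (2) Assume that there exist a positive constant $C$, a positive number $\tau_0$ and a real number $\mu$ such that, for all $\tau>\tau_0$, $$C\,\tau^{\mu}\le\left|\int_0^Te^{-\tau^2t}u_x(0,t)\,dt\right| .$$ Then $$\lim_{\tau\to\infty}\frac{\log|I(-\tau)|}{\tau}=-2\int_0^a\frac{dx}{\sqrt{\gamma(x)}} .$$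
   Context: Solutions are understood in a variational sense: $u\in L^2(0,T;H^1(]0,a[))$, $u_t\in L^2(0,T;(H^1(]0,a[))')$, $u_x(0,t),u_x(a,t)\in L^2(0,T)$, and for all $\varphi\in H^1(]0,a[)$ and a.e. $t$, $\langle u_t,\varphi\rangle+\int_0^a\gamma u_x\varphi'\,dx+\rho u(a,t)\varphi(a)=-\gamma(0)u_x(0,t)\varphi(0)$, with $u(\cdot,0)=0$. The function $\Psi$: it is a known fact that for each complex $z$ with $\operatorname{Re}z\le0$ there is a solution $\Psi=\Psi(\cdot;z,M)$ of $(\gamma y')'-z^2y=0$ on $0<x<M$ such that, as $|z|\to\infty$ (with $\operatorname{Re}z\le0$), uniformly in $x\in[0,M]$, $$\Psi(x;z,M)=\gamma(x)^{-1/4}\exp\left(z\int_0^x\frac{ds}{\sqrt{\gamma(s)}}\right)\{1+O(1/|z|)\},$$ $$\Psi'(x;z,M)=z\,\gamma(x)^{-3/4}\exp\left(z\int_0^x\frac{ds}{\sqrt{\gamma(s)}}\right)\{1+O(1/|z|)\}.$$ Fix such a family $\Psi(\cdot;z,M)$. Indicator function: with $v(x,t)=e^{-z^2t}\Psi(x;z,M)$, for $\operatorname{Re}z\le0$, $$I(z)=\int_0^T\bigl(-\gamma(0)v_x(0,t)u(0,t)+\gamma(0)u_x(0,t)v(0,t)\bigr)\,dt .$$ *)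

theory Defs
  imports "HOL-Analysis.Analysis" "HOL-Library.Function_Algebras"
begin

subsection \<open>Function spaces on an interval\<close>

text \<open>
  Elements of $L^2$, $H^1$ and $(H^1)'$ are represented by plain functions; nothing below depends
  on the chosen representative. Sums, differences and the zero of functions are the pointwise ones
  of \<^theory>\<open>HOL-Library.Function_Algebras\<close>.
\<close>

definition L2 :: "real set \<Rightarrow> (real \<Rightarrow> real) set" where
  "L2 S = {f \<in> borel_measurable (lebesgue_on S). integrable (lebesgue_on S) (\<lambda>x. (f x)\<^sup>2)}"

definition L2_norm :: "real set \<Rightarrow> (real \<Rightarrow> real) \<Rightarrow> real" where
  "L2_norm S f = sqrt (LINT x|lebesgue_on S. (f x)\<^sup>2)"

text \<open>The test functions are those of class $C^1_c(]0,b[)$, as in Brezis' treatment of Sobolev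
  spaces in one dimension; using $C^\infty_c$ instead leads to the same weak derivatives.\<close>

definition test_functions :: "real \<Rightarrow> (real \<Rightarrow> real) set" where
  "test_functions b =
     {\<eta>. \<eta> C1_differentiable_on UNIV \<and>
         (\<exists>K. compact K \<and> K \<subseteq> {0<..<b} \<and> (\<forall>x. x \<notin> K \<longrightarrow> \<eta> x = 0))}"

definition is_weak_deriv :: "real \<Rightarrow> (real \<Rightarrow> real) \<Rightarrow> (real \<Rightarrow> real) \<Rightarrow> bool" where
  "is_weak_deriv b f g \<longleftrightarrow>
     (\<forall>\<eta>\<in>test_functions b.
        (LINT x|lebesgue_on {0<..<b}. f x * deriv \<eta> x) =
        - (LINT x|lebesgue_on {0<..<b}. g x * \<eta> x))"

definition H1 :: "real \<Rightarrow> (real \<Rightarrow> real) set" where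
  "H1 a = {f \<in> L2 {0<..<a}. \<exists>g\<in>L2 {0<..<a}. is_weak_deriv a f g}"

text \<open>The weak derivative is unique only up to null sets; some representative is chosen.\<close>

definition weak_deriv :: "real \<Rightarrow> (real \<Rightarrow> real) \<Rightarrow> (real \<Rightarrow> real)" where
  "weak_deriv a f = (SOME g. g \<in> L2 {0<..<a} \<and> is_weak_deriv a f g)"

definition H1_norm :: "real \<Rightarrow> (real \<Rightarrow> real) \<Rightarrow> real" where
  "H1_norm a f = sqrt ((L2_norm {0<..<a} f)\<^sup>2 + (L2_norm {0<..<a} (weak_deriv a f))\<^sup>2)"

text \<open>Point values of elements of $H^1(]0,a[)$ on $[0,a]$, end points included, are those of the
  continuous representative.\<close>

definition point_value :: "real \<Rightarrow> (real \<Rightarrow> real) \<Rightarrow> real \<Rightarrow> real" where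
  "point_value a f x =
     (THE y. \<exists>h. continuous_on {0..a} h \<and> (AE s in lebesgue_on {0<..<a}. h s = f s) \<and> h x = y)"

text \<open>Boundedness with respect to the $H^1$ norm forces a functional to respect equality almost
  everywhere. Its values outside \<^term>\<open>H1 a\<close> are irrelevant.\<close>

definition H1_dual :: "real \<Rightarrow> ((real \<Rightarrow> real) \<Rightarrow> real) set" where
  "H1_dual a =
     {F. (\<forall>f\<in>H1 a. \<forall>g\<in>H1 a. F (f + g) = F f + F g) \<and>
         (\<forall>f\<in>H1 a. \<forall>k. F (\<lambda>x. k * f x) = k * F f) \<and>
         (\<exists>K. \<forall>f\<in>H1 a. \<bar>F f\<bar> \<le> K * H1_norm a f)}"

definition H1_dual_norm :: "real \<Rightarrow> ((real \<Rightarrow> real) \<Rightarrow> real) \<Rightarrow> real" where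
  "H1_dual_norm a F = (SUP f\<in>{f \<in> H1 a. H1_norm a f \<le> 1}. \<bar>F f\<bar>)"


subsection \<open>Functions of time with values in a function space\<close>

text \<open>$L^2(0,T;X)$ for the space $X$ with norm $N$: strongly measurable (almost everywhere the
  $N$-limit of simple functions with values in $X$) with square integrable norm. The library's
  Bochner integral is not applicable, because \<^term>\<open>H1 a\<close> depends on a parameter and so is
  not a type.\<close>

definition bochner_L2 ::
    "real \<Rightarrow> 'v set \<Rightarrow> ('v \<Rightarrow> real) \<Rightarrow> (real \<Rightarrow> 'v::ab_group_add) \<Rightarrow> bool" where
  "bochner_L2 T X N w \<longleftrightarrow>
     (AE t in lebesgue_on {0<..<T}. w t \<in> X) \<and>
     (\<exists>s. (\<forall>n::nat. simple_function (lebesgue_on {0<..<T}) (s n) \<and> s n ` {0<..<T} \<subseteq> X) \<and>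
          (AE t in lebesgue_on {0<..<T}. (\<lambda>n. N (s n t - w t)) \<longlonglongrightarrow> 0)) \<and>
     integrable (lebesgue_on {0<..<T}) (\<lambda>t. (N (w t))\<^sup>2)"

text \<open>$F = u_t$ in the sense of distributions on $]0,T[$ with values in $(H^1(]0,a[))'$, where
  $L^2(]0,a[)$ is embedded in $(H^1(]0,a[))'$ by its inner product.\<close>

definition is_time_deriv ::
    "real \<Rightarrow> real \<Rightarrow> (real \<Rightarrow> real \<Rightarrow> real) \<Rightarrow> (real \<Rightarrow> (real \<Rightarrow> real) \<Rightarrow> real) \<Rightarrow> bool" where
  "is_time_deriv a T u F \<longleftrightarrow>
     (\<forall>\<phi>\<in>H1 a. is_weak_deriv T (\<lambda>t. LINT x|lebesgue_on {0<..<a}. u t x * \<phi> x) (\<lambda>t. F t \<phi>))"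

text \<open>$u(\cdot,0) = 0$ refers to the representative of $u$ in $C([0,T];L^2(]0,a[))$, which
  exists whenever $u \in L^2(0,T;H^1)$ and $u_t \in L^2(0,T;(H^1)')$.\<close>

definition zero_initial_value :: "real \<Rightarrow> real \<Rightarrow> (real \<Rightarrow> real \<Rightarrow> real) \<Rightarrow> bool" where
  "zero_initial_value a T u \<longleftrightarrow>
     (\<exists>U. (\<forall>t\<in>{0..T}. U t \<in> L2 {0<..<a}) \<and>
          (\<forall>s\<in>{0..T}. ((\<lambda>t. L2_norm {0<..<a} (U t - U s)) \<longlongrightarrow> 0) (at s within {0..T})) \<and>
          (AE t in lebesgue_on {0<..<T}. AE x in lebesgue_on {0<..<a}. U t x = u t x) \<and>
          (AE x in lebesgue_on {0<..<a}. U 0 x = 0))"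


subsection \<open>The initial boundary value problem\<close>

definition C2_on :: "real set \<Rightarrow> (real \<Rightarrow> real) \<Rightarrow> bool" where
  "C2_on S f \<longleftrightarrow>
     (\<exists>f1 f2. (\<forall>x\<in>S. (f has_real_derivative f1 x) (at x within S)) \<and>
              (\<forall>x\<in>S. (f1 has_real_derivative f2 x) (at x within S)) \<and>
              continuous_on S f2)"

text \<open>
  Here \<open>u t x\<close> stands for $u(x,t)$, and \<open>ux0 t\<close>, \<open>uxa t\<close> for $u_x(0,t)$, $u_x(a,t)$. For $u(\cdot,t)$ merely
  in $H^1$ the latter are no traces of $u_x$: they are the boundary fluxes occurring
  in the variational equation and in the boundary condition, which determine them almost everywhere.
\<close>

definition heat_solution ::
    "(real \<Rightarrow> real) \<Rightarrow> real \<Rightarrow> real \<Rightarrow> real \<Rightarrow>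
     (real \<Rightarrow> real \<Rightarrow> real) \<Rightarrow> (real \<Rightarrow> real) \<Rightarrow> (real \<Rightarrow> real) \<Rightarrow> bool" where
  "heat_solution \<gamma> \<rho> a T u ux0 uxa \<longleftrightarrow>
     bochner_L2 T (H1 a) (H1_norm a) u \<and>
     ux0 \<in> L2 {0<..<T} \<and> uxa \<in> L2 {0<..<T} \<and>
     (\<exists>F. bochner_L2 T (H1_dual a) (H1_dual_norm a) F \<and> is_time_deriv a T u F \<and>
          (\<forall>\<phi>\<in>H1 a. AE t in lebesgue_on {0<..<T}.
             F t \<phi>
             + (LINT x|lebesgue_on {0<..<a}. \<gamma> x * weak_deriv a (u t) x * weak_deriv a \<phi> x)
             + \<rho> * point_value a (u t) a * point_value a \<phi> a
             = - \<gamma> 0 * ux0 t * point_value a \<phi> 0)) \<and>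
     (AE t in lebesgue_on {0<..<T}. \<gamma> a * uxa t + \<rho> * point_value a (u t) a = 0) \<and>
     zero_initial_value a T u"


subsection \<open>The special solutions and the indicator function\<close>

abbreviation deriv_on :: "real \<Rightarrow> (real \<Rightarrow> complex) \<Rightarrow> real \<Rightarrow> complex" where
  "deriv_on M y x \<equiv> vector_derivative y (at x within {0..M})"

abbreviation travel_time :: "(real \<Rightarrow> real) \<Rightarrow> real \<Rightarrow> real" where
  "travel_time \<gamma> x \<equiv> integral {0..x} (\<lambda>s. 1 / sqrt (\<gamma> s))"

definition special_family ::
    "(real \<Rightarrow> real) \<Rightarrow> real \<Rightarrow> (complex \<Rightarrow> real \<Rightarrow> complex) \<Rightarrow> bool" where
  "special_family \<gamma> M \<Psi> \<longleftrightarrow>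
     (\<forall>z. Re z \<le> 0 \<longrightarrow>
        (\<forall>x\<in>{0..M}. \<Psi> z differentiable (at x within {0..M})) \<and>
        (\<forall>x\<in>{0<..<M}.
           ((\<lambda>y. complex_of_real (\<gamma> y) * deriv_on M (\<Psi> z) y) has_vector_derivative z\<^sup>2 * \<Psi> z x)
             (at x))) \<and>
     (\<exists>K. \<exists>R>0. \<forall>z. Re z \<le> 0 \<and> norm z \<ge> R \<longrightarrow>
        (\<forall>x\<in>{0..M}. \<exists>e e'. norm e \<le> K / norm z \<and> norm e' \<le> K / norm z \<and>
           \<Psi> z x = complex_of_real (\<gamma> x powr (- 1 / 4))
             * exp (z * complex_of_real (travel_time \<gamma> x)) * (1 + e) \<and>
           deriv_on M (\<Psi> z) x = z * complex_of_real (\<gamma> x powr (- 3 / 4))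
             * exp (z * complex_of_real (travel_time \<gamma> x)) * (1 + e')))"

definition heat_indicator ::
    "(real \<Rightarrow> real) \<Rightarrow> real \<Rightarrow> real \<Rightarrow> real \<Rightarrow> (complex \<Rightarrow> real \<Rightarrow> complex) \<Rightarrow>
     (real \<Rightarrow> real \<Rightarrow> real) \<Rightarrow> (real \<Rightarrow> real) \<Rightarrow> complex \<Rightarrow> complex" where
  "heat_indicator \<gamma> M a T \<Psi> u ux0 z =
     (let v = (\<lambda>x t. exp (- z\<^sup>2 * complex_of_real t) * \<Psi> z x) in
      LINT t|lebesgue_on {0<..<T}.
        - complex_of_real (\<gamma> 0) * deriv_on M (\<lambda>x. v x t) 0 * complex_of_real (point_value a (u t) 0)
        + complex_of_real (\<gamma> 0) * complex_of_real (ux0 t) * v 0 t)"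

definition ray :: "real \<Rightarrow> real \<Rightarrow> complex" where
  "ray c \<tau> = - complex_of_real (c * \<tau>) * (1 + \<i> * complex_of_real (sqrt (1 - 1 / (c\<^sup>2 * \<tau>))))"

end

theory Submission
  imports Defs "HOL-Real_Asymp.Real_Asymp"
begin

text \<open>
  Put $\theta(x) = \int_0^x \gamma^{-1/2}$ and $\zeta = z^2$, and denote by $\hat f = \int_0^T e^{-\zeta t} f(t)\,dt$ the Laplace
  transform over the time interval. If $\varphi$ solves $(\gamma\varphi')' = \zeta\varphi$ on $[0,a]$, testing the heat equation with
  $\varphi$, multiplying by $e^{-\zeta t}$ and integrating in time gives, because $u(\cdot,0) = 0$,
  \[ \gamma(0)\varphi'(0)\,\hat u(0) - B\varphi\,\hat u(a) - \gamma(0)\varphi(0)\,\hat u_x(0)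
      = e^{-\zeta T}\int_0^a u(x,T)\varphi(x)\,dx, \qquad B\varphi = \gamma(a)\varphi'(a) + \rho\varphi(a) \]
  (lemma \<open>laplace_equation\<close>). With $\varphi = \Psi$ the left side is $-I(z) - B\Psi\,\hat u(a)$. To compute $\hat u(a)$ a second
  solution $\Phi$ with $\Phi'(0) = 0$ is inserted, for which the unknown $\hat u(0)$ drops out. Eliminating
  $\hat u(a)$ gives
  \[ I(z) = \gamma(0)\Phi(0)\,\frac{B\Psi}{B\Phi}\,\hat u_x(0)
      + e^{-z^2T}\int_0^a u(x,T)\Bigl(\frac{B\Psi}{B\Phi}\Phi(x) - \Psi(x)\Bigr)dx \]
  (lemma \<open>indicator_representation\<close>).

  The solution $\Phi = \Psi w$ is obtained from $\Psi$ by reduction of order, $w' = 1/(\gamma\Psi^2)$, so that the known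
  asymptotics of $\Psi$ determine those of $\Phi$. As $z$ tends to infinity in a sector around the negative
  real axis, the coefficient of $\hat u_x(0)$ is asymptotic to $-2\gamma(0)^{3/4}e^{2z\theta(a)}$
  (lemma \<open>tendsto_boundary_ratio\<close>), while the integral in the second term stays bounded,
  by lemma \<open>bounded_\<Psi>_\<Phi>\<close> and the asymptotics of the quotient $B\Psi/B\Phi$. In both parts of the theorem the factor $e^{-z^2T}$ is exponentially smaller than
  $e^{2z\theta(a)}$, and $\hat u_x(0)$ is bounded above by a constant and below by a power of $\tau$; taking logarithms
  and dividing by $\tau$ leaves $2\,\mathrm{Re}(z)\,\theta(a)/\tau$ in the limit (lemma \<open>log_indicator_limit\<close>).

  The functional analytic part consists in justifying the first identity for variational solutions. It
  rests on the lemma of du Bois-Reymond (\<open>weak_deriv_imp_primitive\<close>), applied in space to functions in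
  $H^1$ and in time to $t \mapsto \int_0^a u(x,t)\varphi(x)\,dx$.
\<close>

section \<open>Integration over a bounded interval\<close>

lemma finite_measure_interval: "finite_measure (lebesgue_on {0<..<b::real})"
  by (rule finite_measure_lebesgue_on) auto

lemma integrable_lebesgue_on_Ioo_iff:
  fixes f :: "real \<Rightarrow> 'b::euclidean_space"
  shows "integrable (lebesgue_on {0<..<b}) f \<longleftrightarrow> f absolutely_integrable_on {0..b}"
proof -
  have "integrable (lebesgue_on {0<..<b}) f \<longleftrightarrow> f absolutely_integrable_on {0<..<b}"
    by (simp add: integrable_restrict_space set_integrable_def)
  also have "\<dots> \<longleftrightarrow> f absolutely_integrable_on {0..b}"
  proof (rule absolutely_integrable_spike_set_eq)
    have "{x \<in> {0<..<b} - {0..b}. f x \<noteq> 0} = {}" by auto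
    then show "negligible {x \<in> {0<..<b} - {0..b}. f x \<noteq> 0}" by (simp only: negligible_empty)
    have "{x \<in> {0..b} - {0<..<b}. f x \<noteq> 0} \<subseteq> {0,b}" by auto
    then show "negligible {x \<in> {0..b} - {0<..<b}. f x \<noteq> 0}"
      by (rule negligible_subset[rotated]) auto
  qed
  finally show ?thesis .
qed

lemma LINT_Ioo_eq_integral:
  fixes f :: "real \<Rightarrow> 'b::euclidean_space"
  assumes "integrable (lebesgue_on {0<..<b}) f"
  shows "(LINT x|lebesgue_on {0<..<b}. f x) = integral {0..b} f"
  using lebesgue_integral_eq_integral[OF assms] integral_open_interval_real[of 0 b f] by simp

lemma integrable_continuous_Ioo:
  fixes f :: "real \<Rightarrow> 'b::euclidean_space"
  assumes "continuous_on {0..b} f"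
  shows "integrable (lebesgue_on {0<..<b}) f"
  using assms integrable_lebesgue_on_Ioo_iff absolutely_integrable_continuous_real by blast

lemma measurable_continuous_Ioo:
  fixes f :: "real \<Rightarrow> 'b::euclidean_space"
  assumes "continuous_on {0..b} f"
  shows "f \<in> borel_measurable (lebesgue_on {0<..<b})"
  using integrable_continuous_Ioo[OF assms] by auto

lemma integrable_mult_continuous_Ioo:
  fixes f :: "real \<Rightarrow> real" and k :: "real \<Rightarrow> 'b::euclidean_space"
  assumes "integrable (lebesgue_on {0<..<b}) f" "continuous_on {0..b} k"
  shows "integrable (lebesgue_on {0<..<b}) (\<lambda>x. f x *\<^sub>R k x)"
proof -
  have "bounded (k ` {0..b})"
    using assms(2) compact_continuous_image compact_imp_bounded by blast
  then obtain K where K: "\<And>x. x \<in> {0..b} \<Longrightarrow> norm (k x) \<le> K"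
    unfolding bounded_iff by (metis imageI)
  have [measurable]: "k \<in> borel_measurable (lebesgue_on {0<..<b})"
    "f \<in> borel_measurable (lebesgue_on {0<..<b})"
    using measurable_continuous_Ioo assms by auto
  show ?thesis
  proof (rule Bochner_Integration.integrable_bound)
    show "integrable (lebesgue_on {0<..<b}) (\<lambda>x. K * f x)" using assms(1) by auto
    have "norm (f x *\<^sub>R k x) \<le> norm (K * f x)" if "x \<in> {0<..<b}" for x
    proof -
      have "norm (f x *\<^sub>R k x) = \<bar>f x\<bar> * norm (k x)" by simp
      also have "\<dots> \<le> \<bar>f x\<bar> * \<bar>K\<bar>" using K[of x] that by (intro mult_left_mono) auto
      finally show ?thesis by (simp add: abs_mult mult.commute)
    qed
    then show "AE x in lebesgue_on {0<..<b}. norm (f x *\<^sub>R k x) \<le> norm (K * f x)"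
      by (intro AE_I2) auto
  qed measurable
qed

text \<open>The absolutely continuous primitive of \<open>g\<close> on $[0,b]$ that vanishes at $0$. The integral extends
  over the whole interval, with a cut-off integrand, so that Fubini's theorem applies directly.\<close>

definition primitive :: "real \<Rightarrow> (real \<Rightarrow> real) \<Rightarrow> real \<Rightarrow> real" where
  "primitive b g x = (LINT s|lebesgue_on {0<..<b}. (if s < x then g s else 0))"

lemma primitive_eq_integral:
  assumes "integrable (lebesgue_on {0<..<b}) g" "x \<in> {0..b}"
  shows "primitive b g x = integral {0..x} g"
proof -
  have [measurable]: "(\<lambda>x. x) \<in> borel_measurable (lebesgue_on {0<..<b})" "g \<in> borel_measurable (lebesgue_on {0<..<b})"
    using assms(1) by (auto intro: measurable_continuous_Ioo)
  have m: "(\<lambda>s. if s < x then g s else 0) \<in> borel_measurable (lebesgue_on {0<..<b})"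
    by measurable
  have i: "integrable (lebesgue_on {0<..<b}) (\<lambda>s. if s < x then g s else 0)"
    by (rule Bochner_Integration.integrable_bound[OF assms(1) m]) auto
  have "primitive b g x = integral {0..b} (\<lambda>s. if s < x then g s else 0)"
    unfolding primitive_def by (rule LINT_Ioo_eq_integral[OF i])
  also have "\<dots> = integral {0..b} (\<lambda>s. if s \<in> {0..x} then g s else 0)"
    by (rule integral_spike[of "{x}"]) auto
  also have "\<dots> = integral {0..x} g"
    using assms by (simp only: integral_restrict_Int) (simp add: Int_absorb2)
  finally show ?thesis .
qed

lemma primitive_ends:
  shows "primitive b g 0 = 0" "primitive b g b = (LINT s|lebesgue_on {0<..<b}. g s)"
proof -
  have "primitive b g 0 = (LINT s|lebesgue_on {0<..<b}. 0)" unfolding primitive_def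
    by (rule Bochner_Integration.integral_cong) auto
  then show "primitive b g 0 = 0" by simp
  show "primitive b g b = (LINT s|lebesgue_on {0<..<b}. g s)" unfolding primitive_def
    by (rule Bochner_Integration.integral_cong) auto
qed

lemma continuous_on_primitive:
  assumes "integrable (lebesgue_on {0<..<b}) g"
  shows "continuous_on {0..b} (primitive b g)"
proof -
  have "g integrable_on {0..b}"
    using assms integrable_lebesgue_on_Ioo_iff set_lebesgue_integral_eq_integral(1) by blast
  then have "continuous_on {0..b} (\<lambda>x. integral {0..x} g)"
    by (rule indefinite_integral_continuous_1)
  then show ?thesis
    by (rule continuous_on_eq) (use primitive_eq_integral[OF assms] in auto)
qed

text \<open>Integration by parts with only one factor continuously differentiable and the other one
  absolutely continuous. It is Fubini's theorem on the triangle \<open>s < x\<close>.\<close>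

lemma primitive_integration_by_parts:
  fixes k :: "real \<Rightarrow> 'b::euclidean_space"
  assumes g: "integrable (lebesgue_on {0<..<b}) g" and b: "0 \<le> b"
    and k: "\<And>x. x \<in> {0..b} \<Longrightarrow> (k has_vector_derivative k' x) (at x within {0..b})"
    and k': "continuous_on {0..b} k'"
  shows "(LINT x|lebesgue_on {0<..<b}. primitive b g x *\<^sub>R k' x)
       = primitive b g b *\<^sub>R k b - (LINT x|lebesgue_on {0<..<b}. g x *\<^sub>R k x)"
proof -
  let ?M = "lebesgue_on {0<..<b}"
  interpret F: finite_measure ?M by (rule finite_measure_interval)
  interpret P: pair_sigma_finite ?M ?M ..
  have [measurable]: "k' \<in> borel_measurable ?M" "g \<in> borel_measurable ?M"
    using measurable_continuous_Ioo[OF k'] g by auto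
  have idm[measurable]: "(\<lambda>x. x) \<in> borel_measurable ?M"
    by (intro measurable_continuous_Ioo continuous_intros)
  have contk: "continuous_on {0..b} k"
    using k has_vector_derivative_continuous by (metis continuous_on_eq_continuous_within)
  have ik': "integrable ?M k'" by (rule integrable_continuous_Ioo[OF k'])
  let ?f = "\<lambda>(s,x). (if s < x then g s else 0) *\<^sub>R k' x"
  have mf[measurable]: "?f \<in> borel_measurable (?M \<Otimes>\<^sub>M ?M)" by measurable
  have int: "integrable (?M \<Otimes>\<^sub>M ?M) ?f"
  proof (rule Bochner_Integration.integrable_bound)
    show "integrable (?M \<Otimes>\<^sub>M ?M) (\<lambda>(s,x). g s * norm (k' x))"
    proof (rule P.Fubini_integrable)
      show "integrable ?M (\<lambda>s. \<integral>x. norm (case (s,x) of (s,x) \<Rightarrow> g s * norm (k' x)) \<partial>?M)"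
        using g by (simp add: abs_mult)
      show "AE s in ?M. integrable ?M (\<lambda>x. case (s,x) of (s,x) \<Rightarrow> g s * norm (k' x))"
        using ik' by simp
    qed measurable
  qed (auto intro!: AE_I2 simp: abs_mult)
  have inner: "(LINT x|?M. ?f (s,x)) = g s *\<^sub>R (k b - k s)" if s: "s \<in> {0<..<b}" for s
  proof -
    have fm: "(\<lambda>x. if s < x then k' x else 0) \<in> borel_measurable ?M" by measurable
    have fi: "integrable ?M (\<lambda>x. if s < x then k' x else 0)"
      by (rule Bochner_Integration.integrable_bound[OF ik' fm]) auto
    have "(LINT x|?M. ?f (s,x)) = (LINT x|?M. g s *\<^sub>R (if s < x then k' x else 0))"
      by (intro Bochner_Integration.integral_cong) auto
    also have "\<dots> = g s *\<^sub>R (LINT x|?M. (if s < x then k' x else 0))"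
      by simp
    also have "(LINT x|?M. (if s < x then k' x else 0)) = integral {0..b} (\<lambda>x. if s < x then k' x else 0)"
      by (rule LINT_Ioo_eq_integral[OF fi])
    also have "\<dots> = integral {0..b} (\<lambda>x. if x \<in> {s..b} then k' x else 0)"
      by (rule integral_spike[of "{s}"]) auto
    also have "\<dots> = integral {s..b} k'"
      using s by (simp only: integral_restrict_Int) (simp add: Int_absorb2)
    also have "\<dots> = k b - k s"
    proof (rule integral_unique, rule fundamental_theorem_of_calculus)
      show "s \<le> b" using s by auto
      show "(k has_vector_derivative k' x) (at x within {s..b})" if "x \<in> {s..b}" for x
        using k[of x] that s by (auto intro: has_vector_derivative_within_subset)
    qed
    finally show ?thesis .
  qed
  have "(LINT x|?M. primitive b g x *\<^sub>R k' x) = (LINT x|?M. LINT s|?M. ?f (s,x))"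
  proof (intro Bochner_Integration.integral_cong refl)
    fix x assume "x \<in> space ?M"
    have "integrable ?M (\<lambda>s. if s < x then g s else 0)"
      by (rule Bochner_Integration.integrable_bound[OF g]) auto
    then show "primitive b g x *\<^sub>R k' x = (LINT s|?M. ?f (s,x))"
      by (simp add: primitive_def)
  qed
  also have "\<dots> = (LINT s|?M. LINT x|?M. ?f (s,x))"
    using P.Fubini_integral[of "\<lambda>s x. ?f (s,x)"] int by simp
  also have "\<dots> = (LINT s|?M. g s *\<^sub>R k b - g s *\<^sub>R k s)"
    by (intro Bochner_Integration.integral_cong refl) (use inner in \<open>auto simp: scaleR_diff_right\<close>)
  also have "\<dots> = (LINT s|?M. g s *\<^sub>R k b) - (LINT s|?M. g s *\<^sub>R k s)"
    by (intro Bochner_Integration.integral_diff integrable_mult_continuous_Ioo g contk) auto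
  also have "(LINT s|?M. g s *\<^sub>R k b) = primitive b g b *\<^sub>R k b"
    using g by (simp add: primitive_ends)
  finally show ?thesis .
qed


section \<open>Weak derivatives and primitives\<close>

text \<open>A function orthogonal to all compactly supported continuous functions vanishes almost everywhere.
  A Lebesgue measurable \<open>k\<close> is an almost everywhere limit of continuous functions \<open>g n\<close>; testing with
  \<open>h (g n)\<close>, where \<open>h y = y / (1 + \<bar>y\<bar>)\<close> is bounded and has the sign of \<open>y\<close>, yields in the limit that
  $\int k\,h(k) = 0$.\<close>

lemma AE_zero_if_orthogonal_continuous:
  fixes k :: "real \<Rightarrow> real"
  assumes k: "integrable (lebesgue_on {0<..<b}) k"
    and orth: "\<And>\<psi> p q. continuous_on UNIV \<psi> \<Longrightarrow> 0 < p \<Longrightarrow> q < b \<Longrightarrow> (\<And>x. x \<notin> {p..q} \<Longrightarrow> \<psi> x = 0)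
        \<Longrightarrow> (LINT x|lebesgue_on {0<..<b}. k x * \<psi> x) = 0"
  shows "AE x in lebesgue_on {0<..<b}. k x = 0"
proof -
  let ?M = "lebesgue_on {0<..<b}"
  let ?kt = "\<lambda>x. if x \<in> {0<..<b} then k x else 0"
  have [measurable]: "k \<in> borel_measurable ?M" using k by auto
  have "?kt \<in> borel_measurable lebesgue"
    using k by (intro borel_measurable_if_I) auto
  then have "?kt measurable_on UNIV" by (rule lebesgue_measurable_imp_measurable_on) simp
  then obtain N g where N: "negligible N" and cg: "\<And>n::nat. continuous_on UNIV (g n)"
    and lim: "\<And>x. x \<notin> N \<Longrightarrow> (\<lambda>n. g n x) \<longlonglongrightarrow> ?kt x"
    unfolding measurable_on_def by auto
  \<comment> \<open>vanishes outside $[1/(n+1), b-1/(n+1)]$ and increases to one on the open interval\<close>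
  define cut where "cut n x = max 0 (min 1 (real (Suc n) * min x (b - x) - 1))" for n x
  define h where "h y = y / (1 + \<bar>y\<bar>)" for y :: real
  have h1: "\<bar>h y\<bar> \<le> 1" for y by (auto simp: h_def)
  have cut1: "\<bar>cut n x\<bar> \<le> 1" for n x by (auto simp: cut_def)
  have ch: "continuous_on UNIV h" unfolding h_def by (intro continuous_intros) (auto simp: add_nonneg_eq_0_iff)
  have contpsi: "continuous_on UNIV (\<lambda>x. cut n x * h (g n x))" for n
    unfolding cut_def by (intro continuous_intros continuous_on_compose2[OF ch cg]) auto
  have zero: "(LINT x|?M. k x * (cut n x * h (g n x))) = 0" for n
  proof (rule orth[OF contpsi, of "1 / real (Suc n)" "b - 1 / real (Suc n)"])
    fix x assume "x \<notin> {1 / real (Suc n)..b - 1 / real (Suc n)}"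
    then have "min x (b - x) < 1 / real (Suc n)" by auto
    then have "real (Suc n) * min x (b - x) < 1" by (simp add: field_simps)
    then show "cut n x * h (g n x) = 0" by (simp add: cut_def)
  qed auto
  have cutlim: "(\<lambda>n. cut n x) \<longlonglongrightarrow> 1" if "x \<in> {0<..<b}" for x
  proof (rule tendsto_eventually)
    obtain m where m: "2 / min x (b - x) < real m" using reals_Archimedean2 by blast
    have pos: "0 < min x (b - x)" using that by auto
    have "cut n x = 1" if "n \<ge> m" for n
    proof -
      have "2 < real m * min x (b - x)" using m pos by (simp only: pos_divide_less_eq)
      also have "\<dots> \<le> real (Suc n) * min x (b - x)" using that pos by (intro mult_right_mono) auto
      finally show ?thesis unfolding cut_def by linarith
    qed
    then show "\<forall>\<^sub>F n in sequentially. cut n x = 1" unfolding eventually_sequentially by blast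
  qed
  have AEN: "AE x in ?M. x \<notin> N"
  proof -
    have "AE x in lebesgue. x \<notin> N" using N by (simp add: negligible_iff_null_sets AE_not_in)
    then have "AE x in lebesgue. x \<in> {0<..<b} \<longrightarrow> x \<notin> N" by eventually_elim auto
    then show ?thesis by (simp add: AE_restrict_space_iff)
  qed
  have m: "(\<lambda>x. k x * (cut n x * h (g n x))) \<in> borel_measurable ?M" for n
  proof -
    have "(\<lambda>x. cut n x * h (g n x)) \<in> borel_measurable ?M"
      by (rule measurable_continuous_Ioo) (rule continuous_on_subset[OF contpsi], simp)
    then show ?thesis by measurable
  qed
  have mh: "h \<in> borel_measurable borel" by (rule borel_measurable_continuous_onI[OF ch])
  have lim2: "AE x in ?M. (\<lambda>n. k x * (cut n x * h (g n x))) \<longlonglongrightarrow> k x * h (k x)"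
    using AEN AE_space
  proof eventually_elim
    case (elim x)
    then have "(\<lambda>n. g n x) \<longlonglongrightarrow> k x" using lim[of x] by auto
    then have "(\<lambda>n. h (g n x)) \<longlonglongrightarrow> h (k x)"
      using ch continuous_on_tendsto_compose[of UNIV h] by auto
    then have "(\<lambda>n. k x * (cut n x * h (g n x))) \<longlonglongrightarrow> k x * (1 * h (k x))"
      using cutlim[of x] elim by (intro tendsto_intros) auto
    then show ?case by simp
  qed
  have bnd: "AE x in ?M. norm (k x * (cut n x * h (g n x))) \<le> \<bar>k x\<bar>" for n
  proof (intro AE_I2)
    fix x
    have "\<bar>cut n x * h (g n x)\<bar> \<le> 1"
      using mult_mono[OF cut1[of n x] h1[of "g n x"]] by (simp add: abs_mult)
    then have "\<bar>k x\<bar> * \<bar>cut n x * h (g n x)\<bar> \<le> \<bar>k x\<bar> * 1" by (intro mult_left_mono) auto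
    then show "norm (k x * (cut n x * h (g n x))) \<le> \<bar>k x\<bar>" by (simp add: abs_mult)
  qed
  have mk: "(\<lambda>x. k x * h (k x)) \<in> borel_measurable ?M" using mh by measurable
  have ik: "integrable ?M (\<lambda>x. \<bar>k x\<bar>)" using k by auto
  have "(\<lambda>n. LINT x|?M. k x * (cut n x * h (g n x))) \<longlonglongrightarrow> (LINT x|?M. k x * h (k x))"
    by (rule integral_dominated_convergence[OF mk m ik lim2 bnd])
  then have I0: "(LINT x|?M. k x * h (k x)) = 0" by (simp add: zero LIMSEQ_const_iff)
  have int: "integrable ?M (\<lambda>x. k x * h (k x))"
    by (rule integrable_dominated_convergence[OF mk m ik lim2 bnd])
  have "AE x in ?M. k x * h (k x) = 0"
    using integral_nonneg_eq_0_iff_AE[OF int] I0 by (auto simp: h_def)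
  then show ?thesis
    by eventually_elim (auto simp: h_def add_nonneg_eq_0_iff)
qed

lemma bump_primitive_test_function:
  assumes w: "continuous_on UNIV w" and supp: "\<And>x. x \<notin> {p..q} \<Longrightarrow> w x = 0" and pq: "0 < p" "q < b"
    and mean: "integral {0..b} w = 0"
  shows "(\<lambda>x. integral {0..x} w) \<in> test_functions b"
    and "deriv (\<lambda>x. integral {0..x} w) = w"
proof -
  let ?e = "\<lambda>x. integral {0..x} w"
  have lo: "?e x = 0" if "x < p" for x
  proof -
    have "integral {0..x} w = integral {0..x} (\<lambda>_. 0)"
      using that by (intro Henstock_Kurzweil_Integration.integral_cong supp) auto
    then show ?thesis by simp
  qed
  have hi: "?e x = 0" if "x > q" for x
  proof (cases "x < p")
    case False
    have z: "integral {c..d} w = 0" if "q < c" for c d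
    proof -
      have "integral {c..d} w = integral {c..d} (\<lambda>_. 0)"
        using that by (intro Henstock_Kurzweil_Integration.integral_cong supp) auto
      then show ?thesis by simp
    qed
    have io: "w integrable_on {c..d}" for c d
      by (rule integrable_continuous_real) (rule continuous_on_subset[OF w], simp)
    show ?thesis
    proof (cases "x \<le> b")
      case True
      have "integral {0..x} w + integral {x..b} w = integral {0..b} w"
        using True False pq io by (intro Henstock_Kurzweil_Integration.integral_combine) auto
      then show ?thesis using z[OF that] mean by simp
    next
      case F2: False
      then have "b < x" by simp
      show ?thesis
      proof (cases "0 \<le> b")
        case True
        have "integral {0..b} w + integral {b..x} w = integral {0..x} w"
          using True F2 io by (intro Henstock_Kurzweil_Integration.integral_combine) auto
        then show ?thesis using z[OF pq(2)] mean by simp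
      next
        case F3: False
        then have "q < 0" using pq by simp
        then show ?thesis using z by simp
      qed
    qed
  qed (use lo in auto)
  have der: "(?e has_vector_derivative w x) (at x)" for x
  proof (cases "x < p")
    case True
    have "((\<lambda>_. 0) has_vector_derivative w x) (at x)" using supp[of x] True by simp
    then show ?thesis
      by (rule has_vector_derivative_transform_within_open[of _ _ _ "{..<p}"]) (use True lo in auto)
  next
    case False
    have "(?e has_vector_derivative w x) (at x within {0..x+1})"
      using False pq by (intro integral_has_vector_derivative continuous_on_subset[OF w]) auto
    then have "(?e has_vector_derivative w x) (at x within {0<..<x+1})"
      by (rule has_vector_derivative_within_subset) auto
    then show ?thesis using False pq by (subst (asm) at_within_open) auto
  qed
  show d: "deriv ?e = w"
    using der by (auto intro!: ext DERIV_imp_deriv simp: has_real_derivative_iff_has_vector_derivative)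
  have "?e C1_differentiable_on UNIV"
    unfolding C1_differentiable_on_def using der w by blast
  moreover have "compact {p..q} \<and> {p..q} \<subseteq> {0<..<b} \<and> (\<forall>x. x \<notin> {p..q} \<longrightarrow> ?e x = 0)"
    using lo hi pq by (auto simp: not_le)
  ultimately show "?e \<in> test_functions b" unfolding test_functions_def by blast
qed

lemma test_function_props:
  assumes "\<eta> \<in> test_functions b" "0 \<le> b"
  shows "(\<eta> has_vector_derivative deriv \<eta> x) (at x within S)" "continuous_on S (deriv \<eta>)"
    "\<eta> 0 = 0" "\<eta> b = 0" "continuous_on S \<eta>"
proof -
  obtain D where D: "\<And>x. (\<eta> has_vector_derivative D x) (at x)" "continuous_on UNIV D"
    using assms unfolding test_functions_def C1_differentiable_on_def by auto
  have "deriv \<eta> = D"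
    using D(1) by (auto intro!: ext DERIV_imp_deriv simp: has_real_derivative_iff_has_vector_derivative)
  then have d: "(\<eta> has_vector_derivative deriv \<eta> x) (at x within S)" for x S
    using D by (auto intro: has_vector_derivative_at_within)
  then show "(\<eta> has_vector_derivative deriv \<eta> x) (at x within S)" .
  show "continuous_on S (deriv \<eta>)"
    using D \<open>deriv \<eta> = D\<close> by (auto intro: continuous_on_subset)
  show "continuous_on S \<eta>" using d has_vector_derivative_continuous
    by (metis continuous_on_eq_continuous_within)
  obtain K where "K \<subseteq> {0<..<b}" "\<forall>x. x \<notin> K \<longrightarrow> \<eta> x = 0"
    using assms unfolding test_functions_def by auto
  then show "\<eta> 0 = 0" "\<eta> b = 0" by (meson greaterThanLessThan_iff less_irrefl subsetD)+
qed

text \<open>The lemma of du Bois-Reymond: an integrable function with an integrable weak derivative is, up to a constant and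
  a null set, the primitive of that derivative. It serves both for the space variable, where it
  identifies the continuous representative, and for the time variable.\<close>

proposition weak_deriv_imp_primitive:
  assumes f: "integrable (lebesgue_on {0<..<b}) f" and g: "integrable (lebesgue_on {0<..<b}) g"
    and w: "is_weak_deriv b f g" and b: "0 < b"
  shows "\<exists>c. AE x in lebesgue_on {0<..<b}. f x = c + primitive b g x"
proof -
  let ?M = "lebesgue_on {0<..<b}"
  interpret F: finite_measure ?M by (rule finite_measure_interval)
  let ?G = "primitive b g"
  have iG: "integrable ?M ?G" by (rule integrable_continuous_Ioo[OF continuous_on_primitive[OF g]])
  define k0 where "k0 x = f x - ?G x" for x
  have ik0: "integrable ?M k0" unfolding k0_def using f iG by auto
  have test0: "(LINT x|?M. k0 x * deriv \<eta> x) = 0" if "\<eta> \<in> test_functions b" for \<eta>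
  proof -
    note p = test_function_props[OF that less_imp_le[OF b]]
    have "(LINT x|?M. ?G x *\<^sub>R deriv \<eta> x) = ?G b *\<^sub>R \<eta> b - (LINT x|?M. g x *\<^sub>R \<eta> x)"
      by (rule primitive_integration_by_parts[OF g]) (use p b in auto)
    moreover have "(LINT x|?M. f x * deriv \<eta> x) = - (LINT x|?M. g x * \<eta> x)"
      using w that unfolding is_weak_deriv_def by blast
    moreover have "(LINT x|?M. k0 x * deriv \<eta> x) = (LINT x|?M. f x * deriv \<eta> x) - (LINT x|?M. ?G x * deriv \<eta> x)"
      using integrable_mult_continuous_Ioo[OF f p(2)] integrable_mult_continuous_Ioo[OF iG p(2)]
      by (simp add: k0_def left_diff_distrib)
    ultimately show ?thesis using p(4) by simp
  qed
  \<comment> \<open>After normalization, a bump of integral one: subtracting a multiple of it from a trial function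
      gives a function of mean zero, whose primitive is a test function.\<close>
  define B where "B x = max 0 ((x - b/4) * (3*b/4 - x))" for x
  have cB: "continuous_on S B" for S unfolding B_def by (intro continuous_intros)
  have sB: "B x = 0" if "x \<notin> {b/4..3*b/4}" for x
    using that b unfolding B_def by (auto simp: max_def mult_le_0_iff zero_le_mult_iff not_le)
  have "integral {0..b} B \<noteq> 0"
  proof
    assume "integral {0..b} B = 0"
    then have "\<forall>x\<in>{0..b}. B x = 0"
      using integral_eq_0_iff[OF cB b] by (auto simp: B_def)
    then have "B (b/2) = 0" using b by auto
    then show False using b by (auto simp: B_def max_def mult_le_0_iff split: if_splits)
  qed
  define \<beta> where "\<beta> x = B x / integral {0..b} B" for x
  have c\<beta>: "continuous_on S \<beta>" for S unfolding \<beta>_def using cB by (auto intro!: continuous_intros simp: \<open>integral {0..b} B \<noteq> 0\<close>)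
  have i\<beta>: "integral {0..b} \<beta> = 1" unfolding \<beta>_def using \<open>integral {0..b} B \<noteq> 0\<close> by simp
  define c where "c = (LINT x|?M. k0 x * \<beta> x)"
  have "AE x in ?M. k0 x - c = 0"
  proof (rule AE_zero_if_orthogonal_continuous)
    show "integrable ?M (\<lambda>x. k0 x - c)" using ik0 by auto
    fix \<psi> :: "real \<Rightarrow> real" and p q assume \<psi>: "continuous_on UNIV \<psi>" and pq: "0 < p" "q < b" and s: "\<And>x. x \<notin> {p..q} \<Longrightarrow> \<psi> x = 0"
    define m where "m = integral {0..b} \<psi>"
    have c\<psi>: "continuous_on S \<psi>" for S using continuous_on_subset[OF \<psi>] by auto
    have i1: "(LINT x|?M. \<psi> x) = m" unfolding m_def
      by (intro LINT_Ioo_eq_integral integrable_continuous_Ioo c\<psi>)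
    define w where "w x = \<psi> x - m * \<beta> x" for x
    have cw: "continuous_on S w" for S unfolding w_def by (intro continuous_intros c\<psi> c\<beta>)
    have "integral {0..b} w = 0"
      unfolding w_def using i\<beta> c\<psi> c\<beta>
      by (subst Henstock_Kurzweil_Integration.integral_diff) (auto intro!: integrable_continuous_real continuous_intros simp: m_def)
    moreover have "w x = 0" if "x \<notin> {min p (b/4)..max q (3*b/4)}" for x
    proof -
      have "x \<notin> {p..q}" "x \<notin> {b/4..3*b/4}" using that by auto
      then show ?thesis using s sB by (simp add: w_def \<beta>_def)
    qed
    ultimately have "(\<lambda>x. integral {0..x} w) \<in> test_functions b" "deriv (\<lambda>x. integral {0..x} w) = w"
      using bump_primitive_test_function[OF cw, of "min p (b/4)" "max q (3*b/4)" b] pq b by auto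
    then have "(LINT x|?M. k0 x * w x) = 0" using test0 by metis
    moreover have "(LINT x|?M. k0 x * w x) = (LINT x|?M. k0 x * \<psi> x) - (LINT x|?M. m * (k0 x * \<beta> x))"
      using integrable_mult_continuous_Ioo[OF ik0 c\<psi>] integrable_mult_continuous_Ioo[OF ik0 c\<beta>]
      by (subst Bochner_Integration.integral_diff[symmetric]) (auto simp: w_def algebra_simps)
    ultimately have "(LINT x|?M. k0 x * \<psi> x) = m * c" by (simp add: c_def)
    moreover have "(LINT x|?M. (k0 x - c) * \<psi> x) = (LINT x|?M. k0 x * \<psi> x) - (LINT x|?M. c * \<psi> x)"
      using integrable_mult_continuous_Ioo[OF ik0 c\<psi>] integrable_continuous_Ioo[OF c\<psi>]
      by (subst Bochner_Integration.integral_diff[symmetric]) (auto simp: algebra_simps)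
    ultimately show "(LINT x|?M. (k0 x - c) * \<psi> x) = 0" by (simp add: i1)
  qed
  then have "AE x in ?M. f x = c + ?G x" by eventually_elim (auto simp: k0_def)
  then show ?thesis by blast
qed

section \<open>The space $H^1$ and its dual\<close>

lemma measurable_AE_eq_Ioo:
  fixes f g :: "real \<Rightarrow> real"
  assumes f: "f \<in> borel_measurable (lebesgue_on {0<..<b})"
    and ae: "AE x in lebesgue_on {0<..<b}. f x = g x"
  shows "g \<in> borel_measurable (lebesgue_on {0<..<b})"
proof -
  have "(\<lambda>x. if x \<in> {0<..<b} then f x else 0) \<in> borel_measurable lebesgue"
    using f by (intro borel_measurable_if_I) auto
  moreover have "AE x in lebesgue. (if x \<in> {0<..<b} then f x else 0) = (if x \<in> {0<..<b} then g x else 0)"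
  proof -
    have "AE x in lebesgue. x \<in> {0<..<b} \<longrightarrow> f x = g x"
      using ae by (simp add: AE_restrict_space_iff)
    then show ?thesis by eventually_elim auto
  qed
  ultimately have "(\<lambda>x. if x \<in> {0<..<b} then g x else 0) \<in> borel_measurable lebesgue"
    by (rule borel_measurable_AE)
  then show ?thesis by (rule borel_measurable_if_D)
qed

lemma integrable_AE_eq_Ioo:
  fixes f g :: "real \<Rightarrow> real"
  assumes "integrable (lebesgue_on {0<..<b}) f" "AE x in lebesgue_on {0<..<b}. f x = g x"
  shows "integrable (lebesgue_on {0<..<b}) g"
proof -
  have "g \<in> borel_measurable (lebesgue_on {0<..<b})"
    using measurable_AE_eq_Ioo[of f b g] assms by auto
  then show ?thesis using assms integrable_cong_AE[of f "lebesgue_on {0<..<b}" g] by auto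
qed

lemma AE_Ioo_continuous_eq:
  fixes f g :: "real \<Rightarrow> real"
  assumes c: "continuous_on {0..b} f" "continuous_on {0..b} g" and b: "0 < b"
    and ae: "AE x in lebesgue_on {0<..<b}. f x = g x" and x: "x \<in> {0..b}"
  shows "f x = g x"
proof -
  let ?d = "\<lambda>x. \<bar>f x - g x\<bar>"
  have cd: "continuous_on {0..b} ?d" by (intro continuous_intros c)
  have "integral {0..b} ?d = (LINT x|lebesgue_on {0<..<b}. ?d x)"
    by (rule LINT_Ioo_eq_integral[symmetric]) (rule integrable_continuous_Ioo[OF cd])
  also have "\<dots> = (LINT x|lebesgue_on {0<..<b}. 0)"
    by (rule integral_cong_AE) (use ae measurable_continuous_Ioo[OF cd] in \<open>auto\<close>)
  finally have "integral {0..b} ?d = 0" by simp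
  then have "\<forall>x\<in>{0..b}. ?d x = 0" using integral_eq_0_iff[OF cd b] by auto
  then show ?thesis using x by auto
qed

lemma L2_integrable:
  assumes "f \<in> L2 {0<..<b}" shows "integrable (lebesgue_on {0<..<b}) f"
proof -
  interpret finite_measure "lebesgue_on {0<..<b}" by (rule finite_measure_interval)
  show ?thesis using assms square_integrable_imp_integrable unfolding L2_def by blast
qed

lemma continuous_in_L2:
  assumes "continuous_on {0..b} f" shows "f \<in> L2 {0<..<b}"
  unfolding L2_def using measurable_continuous_Ioo[OF assms]
    integrable_continuous_Ioo[of b "\<lambda>x. (f x)\<^sup>2"] assms by (auto intro!: continuous_intros)

lemma L2_scale:
  assumes "f \<in> L2 S" shows "(\<lambda>x. c * f x) \<in> L2 S"
  using assms unfolding L2_def by (auto simp: power_mult_distrib)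

lemma L2_diff:
  assumes "f \<in> L2 S" "g \<in> L2 S" shows "f - g \<in> L2 S"
proof -
  have [measurable]: "f \<in> borel_measurable (lebesgue_on S)" "g \<in> borel_measurable (lebesgue_on S)"
    using assms unfolding L2_def by auto
  have "integrable (lebesgue_on S) (\<lambda>x. 2 * ((f x)\<^sup>2 + (g x)\<^sup>2))"
    using assms unfolding L2_def by auto
  moreover have "(\<lambda>x. (f x - g x)\<^sup>2) \<in> borel_measurable (lebesgue_on S)" by measurable
  moreover have "(f x - g x)\<^sup>2 \<le> \<bar>2 * ((f x)\<^sup>2 + (g x)\<^sup>2)\<bar>" for x
    using zero_le_power2[of "f x + g x"] by (simp add: power2_eq_square algebra_simps)
  ultimately have "integrable (lebesgue_on S) (\<lambda>x. (f x - g x)\<^sup>2)"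
    by (elim Bochner_Integration.integrable_bound) auto
  then show ?thesis unfolding L2_def by (auto simp: fun_diff_def)
qed

lemma L1_le_L2_norm:
  assumes f: "f \<in> L2 {0<..<b}" and b: "0 < b"
  shows "(LINT x|lebesgue_on {0<..<b}. \<bar>f x\<bar>) \<le> sqrt b * L2_norm {0<..<b} f"
proof -
  let ?M = "lebesgue_on {0<..<b}"
  interpret finite_measure ?M by (rule finite_measure_interval)
  define m where "m = (LINT x|?M. \<bar>f x\<bar>)"
  have meas: "measure ?M (space ?M) = b"
    using b by (simp add: measure_restrict_space)
  have i1: "integrable ?M f" by (rule L2_integrable[OF f])
  have i2: "integrable ?M (\<lambda>x. (f x)\<^sup>2)" using f unfolding L2_def by auto
  \<comment> \<open>\<open>m / b\<close> is the mean of \<open>\<bar>f\<bar>\<close>: the claim is that its variance is nonnegative.\<close>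
  have "0 \<le> (LINT x|?M. (\<bar>f x\<bar> - m / b)\<^sup>2)" by simp
  also have "\<dots> = (LINT x|?M. (f x)\<^sup>2 - 2 * (m/b) * \<bar>f x\<bar> + (m/b)\<^sup>2)"
    by (intro Bochner_Integration.integral_cong) (auto simp: power2_diff algebra_simps)
  also have "\<dots> = (LINT x|?M. (f x)\<^sup>2) - 2 * (m/b) * m + (m/b)\<^sup>2 * b"
    using i1 i2 meas by (simp add: m_def)
  also have "\<dots> = (LINT x|?M. (f x)\<^sup>2) - m\<^sup>2 / b"
    using b by (simp add: power2_eq_square)
  finally have "m\<^sup>2 \<le> b * (LINT x|?M. (f x)\<^sup>2)" using b by (simp add: field_simps)
  then have "sqrt (m\<^sup>2) \<le> sqrt (b * (LINT x|?M. (f x)\<^sup>2))" by (rule real_sqrt_le_mono)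
  then show ?thesis unfolding L2_norm_def m_def[symmetric] by (simp add: real_sqrt_mult)
qed

text \<open>The vanishing primitive gives orthogonality to polynomials, by integration by parts, and these are
  uniformly dense in the continuous functions.\<close>

lemma AE_zero_if_primitive_zero:
  assumes g: "integrable (lebesgue_on {0<..<b}) g" and b: "0 < b"
    and z: "\<And>x. x \<in> {0..b} \<Longrightarrow> primitive b g x = 0"
  shows "AE x in lebesgue_on {0<..<b}. g x = 0"
proof (rule AE_zero_if_orthogonal_continuous[OF g])
  let ?M = "lebesgue_on {0<..<b}"
  fix \<psi> :: "real \<Rightarrow> real" assume \<psi>: "continuous_on UNIV \<psi>"
  have c: "continuous_on {0..b} \<psi>" using \<psi> continuous_on_subset by blast
  have small: "\<bar>LINT x|?M. g x * \<psi> x\<bar> \<le> e * (LINT x|?M. \<bar>g x\<bar>)" if "e > 0" for e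
  proof -
    obtain P where P: "real_polynomial_function P" "\<And>x. x \<in> {0..b} \<Longrightarrow> \<bar>\<psi> x - P x\<bar> < e"
      using Stone_Weierstrass_real_polynomial_function[OF compact_Icc c \<open>e > 0\<close>] by blast
    obtain P' where P': "real_polynomial_function P'" "\<And>x. (P has_real_derivative P' x) (at x)"
      using has_real_derivative_polynomial_function[OF P(1)] by blast
    have cP: "continuous_on {0..b} P" "continuous_on {0..b} P'"
      using P(1) P'(1) by (auto simp: real_polynomial_function_eq intro: continuous_on_polymonial_function)
    have "(LINT x|?M. primitive b g x *\<^sub>R P' x) = primitive b g b *\<^sub>R P b - (LINT x|?M. g x *\<^sub>R P x)"
      by (rule primitive_integration_by_parts[OF g])
        (use P' b cP in \<open>auto simp: has_real_derivative_iff_has_vector_derivative intro: has_vector_derivative_at_within\<close>)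
    moreover have "(LINT x|?M. primitive b g x *\<^sub>R P' x) = (LINT x|?M. 0)"
      by (intro Bochner_Integration.integral_cong) (use z in auto)
    ultimately have "(LINT x|?M. g x * P x) = 0" using z b by simp
    then have "(LINT x|?M. g x * \<psi> x) = (LINT x|?M. g x * \<psi> x) - (LINT x|?M. g x * P x)" by simp
    also have "\<dots> = (LINT x|?M. g x * (\<psi> x - P x))"
      using integrable_mult_continuous_Ioo[OF g c] integrable_mult_continuous_Ioo[OF g cP(1)]
      by (subst Bochner_Integration.integral_diff[symmetric]) (auto simp: algebra_simps)
    also have "\<bar>\<dots>\<bar> \<le> (LINT x|?M. \<bar>g x * (\<psi> x - P x)\<bar>)" by (rule integral_abs_bound)
    also have "\<dots> \<le> (LINT x|?M. e * \<bar>g x\<bar>)"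
    proof (rule integral_mono)
      have "continuous_on {0..b} (\<lambda>x. \<psi> x - P x)" by (intro continuous_intros c cP)
      from integrable_mult_continuous_Ioo[OF g this]
      show "integrable ?M (\<lambda>x. \<bar>g x * (\<psi> x - P x)\<bar>)" by simp
      show "integrable ?M (\<lambda>x. e * \<bar>g x\<bar>)" using g by simp
      fix x assume "x \<in> space ?M"
      then have "\<bar>\<psi> x - P x\<bar> \<le> e" using P(2)[of x] by auto
      then have "\<bar>g x\<bar> * \<bar>\<psi> x - P x\<bar> \<le> \<bar>g x\<bar> * e" by (intro mult_left_mono) auto
      then show "\<bar>g x * (\<psi> x - P x)\<bar> \<le> e * \<bar>g x\<bar>" by (simp add: abs_mult mult.commute)
    qed
    finally show ?thesis by simp
  qed
  have "\<bar>LINT x|?M. g x * \<psi> x\<bar> \<le> 0"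
  proof (rule field_le_epsilon)
    fix e :: real assume e: "e > 0"
    define I where "I = (LINT x|?M. \<bar>g x\<bar>)"
    have I: "I \<ge> 0" unfolding I_def by simp
    have "\<bar>LINT x|?M. g x * \<psi> x\<bar> \<le> e / (I + 1) * I"
      using small[of "e / (I + 1)"] e I unfolding I_def by (simp add: add_nonneg_pos)
    also have "\<dots> \<le> e" using e I by (simp add: field_simps)
    finally show "\<bar>LINT x|?M. g x * \<psi> x\<bar> \<le> 0 + e" by simp
  qed
  then show "(LINT x|?M. g x * \<psi> x) = 0" by simp
qed

lemma weak_deriv_unique:
  assumes g: "integrable (lebesgue_on {0<..<b}) g" "integrable (lebesgue_on {0<..<b}) h" and b: "0 < b"
    and w: "is_weak_deriv b f g" "is_weak_deriv b f h"
  shows "AE x in lebesgue_on {0<..<b}. g x = h x"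
proof -
  let ?M = "lebesgue_on {0<..<b}"
  let ?d = "\<lambda>x. g x - h x"
  have id: "integrable ?M ?d" using g by simp
  have "is_weak_deriv b (\<lambda>_. 0) ?d"
    unfolding is_weak_deriv_def
  proof
    fix \<eta> assume \<eta>: "\<eta> \<in> test_functions b"
    have c\<eta>: "continuous_on {0..b} \<eta>" using test_function_props(5)[OF \<eta>] b by simp
    have "(LINT x|?M. ?d x * \<eta> x) = (LINT x|?M. g x * \<eta> x) - (LINT x|?M. h x * \<eta> x)"
      using integrable_mult_continuous_Ioo[OF g(1) c\<eta>] integrable_mult_continuous_Ioo[OF g(2) c\<eta>]
      by (subst Bochner_Integration.integral_diff[symmetric]) (auto simp: algebra_simps)
    also have "\<dots> = 0" using w \<eta> unfolding is_weak_deriv_def by force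
    finally show "(LINT x|?M. 0 * deriv \<eta> x) = - (LINT x|?M. ?d x * \<eta> x)" by simp
  qed
  from weak_deriv_imp_primitive[OF _ id this b] obtain c where
    c: "AE x in ?M. 0 = c + primitive b ?d x" by auto
  have cp: "continuous_on {0..b} (\<lambda>x. c + primitive b ?d x)"
    by (intro continuous_intros continuous_on_primitive[OF id])
  have 0: "0 = c + primitive b ?d x" if "x \<in> {0..b}" for x
    using AE_Ioo_continuous_eq[OF _ cp b c that] by simp
  have "c = 0" using 0[of 0] b by (simp add: primitive_ends)
  then have "AE x in ?M. ?d x = 0"
    using 0 by (intro AE_zero_if_primitive_zero id b) auto
  then show ?thesis by eventually_elim auto
qed

lemma H1_weak_deriv:
  assumes "f \<in> H1 a"
  shows "f \<in> L2 {0<..<a}" "weak_deriv a f \<in> L2 {0<..<a}" "is_weak_deriv a f (weak_deriv a f)"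
proof -
  have "\<exists>g. g \<in> L2 {0<..<a} \<and> is_weak_deriv a f g" using assms unfolding H1_def by auto
  from someI_ex[OF this] show "weak_deriv a f \<in> L2 {0<..<a}" "is_weak_deriv a f (weak_deriv a f)"
    unfolding weak_deriv_def by auto
qed (use assms in \<open>auto simp: H1_def\<close>)

lemma point_value_eqI:
  assumes h: "continuous_on {0..a} h" "AE s in lebesgue_on {0<..<a}. h s = f s" and a: "0 < a" and x: "x \<in> {0..a}"
  shows "point_value a f x = h x"
  unfolding point_value_def
proof (rule the_equality)
  show "\<exists>k. continuous_on {0..a} k \<and> (AE s in lebesgue_on {0<..<a}. k s = f s) \<and> k x = h x"
    using h by blast
  fix y assume "\<exists>k. continuous_on {0..a} k \<and> (AE s in lebesgue_on {0<..<a}. k s = f s) \<and> k x = y"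
  then obtain k where k: "continuous_on {0..a} k" "AE s in lebesgue_on {0<..<a}. k s = f s" "k x = y" by blast
  have "AE s in lebesgue_on {0<..<a}. k s = h s" using k(2) h(2) by eventually_elim auto
  from AE_Ioo_continuous_eq[OF k(1) h(1) a this x] show "y = h x" using k(3) by simp
qed

lemma H1_point_value:
  assumes f: "f \<in> H1 a" and a: "0 < a"
  shows "AE x in lebesgue_on {0<..<a}. f x = point_value a f x"
    and "\<And>x. x \<in> {0..a} \<Longrightarrow> point_value a f x = point_value a f 0 + primitive a (weak_deriv a f) x"
proof -
  note w = H1_weak_deriv[OF f]
  note i = L2_integrable[OF w(1)] L2_integrable[OF w(2)]
  obtain c where c: "AE x in lebesgue_on {0<..<a}. f x = c + primitive a (weak_deriv a f) x"
    using weak_deriv_imp_primitive[OF i w(3) a] by blast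
  have pv: "point_value a f x = c + primitive a (weak_deriv a f) x" if "x \<in> {0..a}" for x
  proof (rule point_value_eqI[OF _ _ a that])
    show "continuous_on {0..a} (\<lambda>x. c + primitive a (weak_deriv a f) x)"
      by (intro continuous_intros continuous_on_primitive[OF i(2)])
    show "AE s in lebesgue_on {0<..<a}. c + primitive a (weak_deriv a f) s = f s"
      using c by eventually_elim auto
  qed
  show "AE x in lebesgue_on {0<..<a}. f x = point_value a f x"
    using c AE_space by eventually_elim (simp add: pv)
  show "point_value a f x = point_value a f 0 + primitive a (weak_deriv a f) x" if "x \<in> {0..a}" for x
    using pv[OF that] pv[of 0] a by (simp add: primitive_ends)
qed

lemma C1_in_H1:
  assumes d: "\<And>x. x \<in> {0..a} \<Longrightarrow> (\<phi> has_vector_derivative \<phi>' x) (at x within {0..a})"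
    and c': "continuous_on {0..a} \<phi>'" and a: "0 < a"
  shows "\<phi> \<in> H1 a" and "AE x in lebesgue_on {0<..<a}. weak_deriv a \<phi> x = \<phi>' x"
    and "x \<in> {0..a} \<Longrightarrow> point_value a \<phi> x = \<phi> x"
proof -
  let ?M = "lebesgue_on {0<..<a}"
  have c: "continuous_on {0..a} \<phi>" using d has_vector_derivative_continuous
    by (metis continuous_on_eq_continuous_within)
  have wd: "is_weak_deriv a \<phi> \<phi>'"
    unfolding is_weak_deriv_def
  proof
    fix \<eta> assume \<eta>: "\<eta> \<in> test_functions a"
    note p = test_function_props[OF \<eta> less_imp_le[OF a]]
    have c1: "continuous_on {0..a} (\<lambda>x. \<phi> x * deriv \<eta> x)" "continuous_on {0..a} (\<lambda>x. \<phi>' x * \<eta> x)"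
      by (intro continuous_intros c c' p)+
    have "((\<lambda>x. \<phi> x * deriv \<eta> x + \<phi>' x * \<eta> x) has_integral (\<phi> a * \<eta> a - \<phi> 0 * \<eta> 0)) {0..a}"
      by (rule fundamental_theorem_of_calculus) (use a d p(1) in \<open>auto intro!: has_vector_derivative_mult\<close>)
    then have "integral {0..a} (\<lambda>x. \<phi> x * deriv \<eta> x + \<phi>' x * \<eta> x) = 0"
      using p by (simp add: integral_unique)
    then have "integral {0..a} (\<lambda>x. \<phi> x * deriv \<eta> x) + integral {0..a} (\<lambda>x. \<phi>' x * \<eta> x) = 0"
      using c1 by (subst (asm) Henstock_Kurzweil_Integration.integral_add) (auto intro: integrable_continuous_real)
    then show "(LINT x|?M. \<phi> x * deriv \<eta> x) = - (LINT x|?M. \<phi>' x * \<eta> x)"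
      by (simp add: LINT_Ioo_eq_integral integrable_continuous_Ioo c1)
  qed
  show H: "\<phi> \<in> H1 a" unfolding H1_def using continuous_in_L2 c c' wd by auto
  note w = H1_weak_deriv[OF H]
  show "AE x in ?M. weak_deriv a \<phi> x = \<phi>' x"
    by (rule weak_deriv_unique[OF L2_integrable[OF w(2)] integrable_continuous_Ioo[OF c'] a w(3) wd])
  show "x \<in> {0..a} \<Longrightarrow> point_value a \<phi> x = \<phi> x"
    using point_value_eqI[OF c _ a] by auto
qed

lemma H1_norm_scale:
  assumes f: "f \<in> H1 a" and a: "0 < a"
  shows "(\<lambda>x. c * f x) \<in> H1 a" "H1_norm a (\<lambda>x. c * f x) = \<bar>c\<bar> * H1_norm a f"
proof -
  let ?M = "lebesgue_on {0<..<a}"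
  note w = H1_weak_deriv[OF f]
  have wd: "is_weak_deriv a (\<lambda>x. c * f x) (\<lambda>x. c * weak_deriv a f x)"
    using w(3) unfolding is_weak_deriv_def by (simp add: mult.assoc)
  show H: "(\<lambda>x. c * f x) \<in> H1 a"
    unfolding H1_def using wd L2_scale[OF w(1)] L2_scale[OF w(2)] by auto
  note w' = H1_weak_deriv[OF H]
  have "AE x in ?M. weak_deriv a (\<lambda>x. c * f x) x = c * weak_deriv a f x"
    by (rule weak_deriv_unique[OF L2_integrable[OF w'(2)] L2_integrable[OF L2_scale[OF w(2)]] a w'(3) wd])
  then have "(LINT x|?M. (weak_deriv a (\<lambda>x. c * f x) x)\<^sup>2) = (LINT x|?M. (c * weak_deriv a f x)\<^sup>2)"
    using w'(2) L2_scale[OF w(2), of c] by (intro integral_cong_AE) (auto simp: L2_def)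
  then have "H1_norm a (\<lambda>x. c * f x) = sqrt (c\<^sup>2 * ((LINT x|?M. (f x)\<^sup>2) + (LINT x|?M. (weak_deriv a f x)\<^sup>2)))"
    by (simp add: H1_norm_def L2_norm_def power_mult_distrib distrib_left)
  then show "H1_norm a (\<lambda>x. c * f x) = \<bar>c\<bar> * H1_norm a f"
    by (simp add: H1_norm_def L2_norm_def real_sqrt_mult)
qed

lemma H1_norm_nonneg: "0 \<le> H1_norm a f" by (simp add: H1_norm_def)

lemma H1_dual_bound:
  assumes F: "F \<in> H1_dual a" and f: "f \<in> H1 a" and a: "0 < a"
  shows "\<bar>F f\<bar> \<le> H1_dual_norm a F * H1_norm a f"
proof -
  obtain K where K: "\<And>f. f \<in> H1 a \<Longrightarrow> \<bar>F f\<bar> \<le> K * H1_norm a f"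
    using F unfolding H1_dual_def by blast
  have hom: "F (\<lambda>x. k * f x) = k * F f" for k using F f unfolding H1_dual_def by auto
  have bdd: "bdd_above ((\<lambda>f. \<bar>F f\<bar>) ` {f \<in> H1 a. H1_norm a f \<le> 1})"
  proof (rule bdd_aboveI2)
    fix f assume f: "f \<in> {f \<in> H1 a. H1_norm a f \<le> 1}"
    then have "\<bar>F f\<bar> \<le> K * H1_norm a f" using K by auto
    also have "\<dots> \<le> \<bar>K\<bar> * 1" using f H1_norm_nonneg[of a f] by (intro mult_mono) auto
    finally show "\<bar>F f\<bar> \<le> \<bar>K\<bar>" by simp
  qed
  show ?thesis
  proof (cases "H1_norm a f = 0")
    case True then show ?thesis using K[OF f] by simp
  next
    case False
    let ?n = "H1_norm a f"
    have n: "0 < ?n" using False H1_norm_nonneg[of a f] by simp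
    have "\<bar>F (\<lambda>x. (1 / ?n) * f x)\<bar> \<le> H1_dual_norm a F"
      unfolding H1_dual_norm_def
      by (rule cSUP_upper[OF _ bdd]) (use H1_norm_scale[OF f a, of "1 / ?n"] n in auto)
    then show ?thesis unfolding hom using n by (simp add: abs_mult field_simps)
  qed
qed

lemma H1_dual_diff:
  assumes F: "F \<in> H1_dual a" and G: "G \<in> H1_dual a"
  shows "F - G \<in> H1_dual a"
proof -
  obtain K where K: "\<And>f. f \<in> H1 a \<Longrightarrow> \<bar>F f\<bar> \<le> K * H1_norm a f"
    using F unfolding H1_dual_def by blast
  obtain K' where K': "\<And>f. f \<in> H1 a \<Longrightarrow> \<bar>G f\<bar> \<le> K' * H1_norm a f"
    using G unfolding H1_dual_def by blast
  have "\<bar>F f - G f\<bar> \<le> (K + K') * H1_norm a f" if "f \<in> H1 a" for f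
    using K[OF that] K'[OF that] by (simp add: distrib_right)
  then have "\<exists>K. \<forall>f\<in>H1 a. \<bar>(F - G) f\<bar> \<le> K * H1_norm a f" by auto
  then show ?thesis using F G unfolding H1_dual_def by (auto simp: algebra_simps)
qed

text \<open>Strong measurability and square integrability in the dual norm enter the argument through this
  scalar consequence.\<close>

lemma bochner_L2_dual_integrable:
  assumes F: "bochner_L2 T (H1_dual a) (H1_dual_norm a) F" and \<phi>: "\<phi> \<in> H1 a" and a: "0 < a"
  shows "integrable (lebesgue_on {0<..<T}) (\<lambda>t. F t \<phi>)"
proof -
  let ?M = "lebesgue_on {0<..<T}"
  interpret finite_measure ?M by (rule finite_measure_interval)
  have AF: "AE t in ?M. F t \<in> H1_dual a" and iN: "integrable ?M (\<lambda>t. (H1_dual_norm a (F t))\<^sup>2)"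
    using F unfolding bochner_L2_def by auto
  obtain s where s: "\<And>n::nat. simple_function ?M (s n)" "\<And>n. s n ` {0<..<T} \<subseteq> H1_dual a"
    and lim: "AE t in ?M. (\<lambda>n. H1_dual_norm a (s n t - F t)) \<longlonglongrightarrow> 0"
    using F unfolding bochner_L2_def by auto
  have ms: "(\<lambda>t. s n t \<phi>) \<in> borel_measurable ?M" for n
    using simple_function_compose1[OF s(1)[of n], of "\<lambda>F. F \<phi>"] by (rule borel_measurable_simple_function)
  have "(\<lambda>t. lim (\<lambda>n. s n t \<phi>)) \<in> borel_measurable ?M"
    by (rule borel_measurable_lim_metric[OF ms])
  moreover have "AE t in ?M. lim (\<lambda>n. s n t \<phi>) = F t \<phi>"
    using AF lim AE_space
  proof eventually_elim
    case (elim t)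
    have "(\<lambda>n. s n t \<phi> - F t \<phi>) \<longlonglongrightarrow> 0"
    proof (rule Lim_null_comparison)
      show "\<forall>\<^sub>F n in sequentially. norm (s n t \<phi> - F t \<phi>) \<le> H1_dual_norm a (s n t - F t) * H1_norm a \<phi>"
      proof (intro always_eventually allI)
        fix n
        have "s n t \<in> H1_dual a" using s(2)[of n] elim by auto
        from H1_dual_bound[OF H1_dual_diff[OF this elim(1)] \<phi> a]
        show "norm (s n t \<phi> - F t \<phi>) \<le> H1_dual_norm a (s n t - F t) * H1_norm a \<phi>" by simp
      qed
      show "(\<lambda>n. H1_dual_norm a (s n t - F t) * H1_norm a \<phi>) \<longlonglongrightarrow> 0"
        using tendsto_mult_left_zero[OF elim(2)] .
    qed
    then have "(\<lambda>n. s n t \<phi>) \<longlonglongrightarrow> F t \<phi>" by (simp add: LIM_zero_iff)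
    then show ?case by (rule limI)
  qed
  ultimately have m: "(\<lambda>t. F t \<phi>) \<in> borel_measurable ?M" by (rule measurable_AE_eq_Ioo)
  show ?thesis
  proof (rule Bochner_Integration.integrable_bound[OF _ m])
    show "integrable ?M (\<lambda>t. (1 + (H1_dual_norm a (F t))\<^sup>2) * H1_norm a \<phi>)" using iN by simp
    show "AE t in ?M. norm (F t \<phi>) \<le> norm ((1 + (H1_dual_norm a (F t))\<^sup>2) * H1_norm a \<phi>)"
      using AF
    proof eventually_elim
      case (elim t)
      let ?N = "H1_dual_norm a (F t)"
      have "?N \<le> 1 + ?N\<^sup>2" using zero_le_power2[of "?N - 1/2"] by (simp add: power2_eq_square algebra_simps)
      then have "?N * H1_norm a \<phi> \<le> (1 + ?N\<^sup>2) * H1_norm a \<phi>"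
        by (intro mult_right_mono H1_norm_nonneg)
      then show ?case using H1_dual_bound[OF elim \<phi> a] by simp
    qed
  qed
qed

section \<open>The evolution equation after Laplace transformation\<close>

text \<open>Here \<open>P\<close> is the flux $\gamma\varphi'$ of the smooth test function $\varphi$ and \<open>R\<close> the derivative of the
  flux. All derivatives are moved to $\varphi$, so that \<open>f\<close> enters only through its values.\<close>

lemma H1_Green_formula:
  assumes f: "f \<in> H1 a" and a: "0 < a"
    and \<gamma>: "continuous_on {0..a} \<gamma>" "\<And>x. x \<in> {0..a} \<Longrightarrow> 0 < \<gamma> x"
    and \<phi>: "\<And>x. x \<in> {0..a} \<Longrightarrow> (\<phi> has_vector_derivative P x / \<gamma> x) (at x within {0..a})"
    and P: "\<And>x. x \<in> {0..a} \<Longrightarrow> (P has_vector_derivative R x) (at x within {0..a})"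
    and R: "continuous_on {0..a} R"
  shows "(LINT x|lebesgue_on {0<..<a}. \<gamma> x * weak_deriv a f x * weak_deriv a \<phi> x)
       = P a * point_value a f a - P 0 * point_value a f 0 - (LINT x|lebesgue_on {0<..<a}. f x * R x)"
proof -
  let ?M = "lebesgue_on {0<..<a}"
  interpret finite_measure ?M by (rule finite_measure_interval)
  let ?g = "weak_deriv a f"
  let ?f0 = "point_value a f 0"
  have cP: "continuous_on {0..a} P" using P has_vector_derivative_continuous
    by (metis continuous_on_eq_continuous_within)
  have cP\<gamma>: "continuous_on {0..a} (\<lambda>x. P x / \<gamma> x)"
    using \<gamma>(2) by (intro continuous_intros cP \<gamma>(1)) force
  note C1 = C1_in_H1[OF \<phi> cP\<gamma> a]
  have C1wd: "AE x in ?M. weak_deriv a \<phi> x = P x / \<gamma> x" by (rule C1(2))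
  note w = H1_weak_deriv[OF f]
  note w\<phi> = H1_weak_deriv[OF C1(1)]
  have [measurable]: "\<gamma> \<in> borel_measurable ?M" "P \<in> borel_measurable ?M" "R \<in> borel_measurable ?M"
    "?g \<in> borel_measurable ?M" "weak_deriv a \<phi> \<in> borel_measurable ?M" "f \<in> borel_measurable ?M"
    using measurable_continuous_Ioo \<gamma> cP R w w\<phi> by (auto simp: L2_def)
  note ig = L2_integrable[OF w(2)]
  have h1: "(LINT x|?M. \<gamma> x * ?g x * weak_deriv a \<phi> x) = (LINT x|?M. ?g x * P x)"
  proof (rule integral_cong_AE)
    show "AE x in ?M. \<gamma> x * ?g x * weak_deriv a \<phi> x = ?g x * P x"
      using C1wd AE_space
    proof eventually_elim
      case (elim x)
      then have "\<gamma> x \<noteq> 0" using \<gamma>(2)[of x] by auto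
      then show ?case unfolding elim(1) by simp
    qed
  qed measurable
  have h2: "(LINT x|?M. primitive a ?g x *\<^sub>R R x) = primitive a ?g a *\<^sub>R P a - (LINT x|?M. ?g x *\<^sub>R P x)"
    using a by (intro primitive_integration_by_parts[OF ig _ P R]) auto
  have h3: "(LINT x|?M. f x * R x) = (LINT x|?M. (?f0 + primitive a ?g x) * R x)"
  proof (rule integral_cong_AE)
    have "primitive a ?g \<in> borel_measurable ?M"
      by (rule measurable_continuous_Ioo[OF continuous_on_primitive[OF ig]])
    then show "(\<lambda>x. (?f0 + primitive a ?g x) * R x) \<in> borel_measurable ?M" by measurable
    show "AE x in ?M. f x * R x = (?f0 + primitive a ?g x) * R x"
      using H1_point_value(1)[OF f a] AE_space
    proof eventually_elim
      case (elim x)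
      then have x: "x \<in> {0..a}" by auto
      show ?case unfolding elim(1) H1_point_value(2)[OF f a x] by (rule refl)
    qed
  qed measurable
  have h4: "(LINT x|?M. (?f0 + primitive a ?g x) * R x) = ?f0 * (LINT x|?M. R x) + (LINT x|?M. primitive a ?g x * R x)"
    using integrable_continuous_Ioo[OF R]
      integrable_mult_continuous_Ioo[OF integrable_continuous_Ioo[OF continuous_on_primitive[OF ig]] R]
    by (simp add: distrib_right)
  have h5: "(LINT x|?M. R x) = P a - P 0"
  proof -
    have "(R has_integral (P a - P 0)) {0..a}"
      using a P by (intro fundamental_theorem_of_calculus) auto
    then show ?thesis using LINT_Ioo_eq_integral[OF integrable_continuous_Ioo[OF R]] by (simp add: integral_unique)
  qed
  have h6: "point_value a f a = ?f0 + primitive a ?g a"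
    using H1_point_value(2)[OF f a, of a] a by simp
  have h7: "(LINT x|?M. ?g x * P x) = primitive a ?g a * P a - (LINT x|?M. primitive a ?g x * R x)"
    using h2 by simp
  show ?thesis unfolding h1 h3 h4 h5 h6 h7 by (simp add: algebra_simps)
qed

text \<open>The variational problem with the time derivative \<open>F\<close> and the $L^2$-continuous representative \<open>U\<close>
  of \<open>u\<close> made explicit. The boundary condition at \<open>a\<close> is part of the equation.\<close>

locale heat_flow =
  fixes \<gamma> :: "real \<Rightarrow> real" and \<rho> a T :: real and u :: "real \<Rightarrow> real \<Rightarrow> real" and ux0 :: "real \<Rightarrow> real"
    and F :: "real \<Rightarrow> (real \<Rightarrow> real) \<Rightarrow> real" and U :: "real \<Rightarrow> real \<Rightarrow> real"
  assumes a: "0 < a" and T: "0 < T"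
    and cont_\<gamma>: "continuous_on {0..a} \<gamma>" and pos_\<gamma>: "\<And>x. x \<in> {0..a} \<Longrightarrow> 0 < \<gamma> x"
    and u_H1: "AE t in lebesgue_on {0<..<T}. u t \<in> H1 a"
    and ux0: "ux0 \<in> L2 {0<..<T}"
    and F: "bochner_L2 T (H1_dual a) (H1_dual_norm a) F" and F_deriv: "is_time_deriv a T u F"
    and equation: "\<And>\<phi>. \<phi> \<in> H1 a \<Longrightarrow> AE t in lebesgue_on {0<..<T}.
             F t \<phi>
             + (LINT x|lebesgue_on {0<..<a}. \<gamma> x * weak_deriv a (u t) x * weak_deriv a \<phi> x)
             + \<rho> * point_value a (u t) a * point_value a \<phi> a
             = - \<gamma> 0 * ux0 t * point_value a \<phi> 0"
    and U_L2: "\<And>t. t \<in> {0..T} \<Longrightarrow> U t \<in> L2 {0<..<a}"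
    and U_cont: "\<And>s. s \<in> {0..T} \<Longrightarrow> ((\<lambda>t. L2_norm {0<..<a} (U t - U s)) \<longlongrightarrow> 0) (at s within {0..T})"
    and U_u: "AE t in lebesgue_on {0<..<T}. AE x in lebesgue_on {0<..<a}. U t x = u t x"
    and U_0: "AE x in lebesgue_on {0<..<a}. U 0 x = 0"
begin

text \<open>The $L^2$ inner product of the continuous representative at time \<open>t\<close> with a test function.\<close>

definition pairing :: "(real \<Rightarrow> real) \<Rightarrow> real \<Rightarrow> real" where
  "pairing \<phi> t = (LINT x|lebesgue_on {0<..<a}. U t x * \<phi> x)"

lemma integrable_U: "t \<in> {0..T} \<Longrightarrow> integrable (lebesgue_on {0<..<a}) (U t)"
  using U_L2 L2_integrable by blast

lemma integrable_U_mult: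
  fixes \<phi> :: "real \<Rightarrow> real"
  shows "t \<in> {0..T} \<Longrightarrow> continuous_on {0..a} \<phi> \<Longrightarrow> integrable (lebesgue_on {0<..<a}) (\<lambda>x. U t x * \<phi> x)"
  using integrable_mult_continuous_Ioo[OF integrable_U, of t \<phi>] by simp

lemma continuous_on_pairing:
  assumes \<phi>: "continuous_on {0..a} \<phi>"
  shows "continuous_on {0..T} (pairing \<phi>)"
  unfolding continuous_on_def
proof
  let ?M = "lebesgue_on {0<..<a}"
  fix s assume s: "s \<in> {0..T}"
  have "bounded (\<phi> ` {0..a})"
    using \<phi> compact_continuous_image compact_imp_bounded by blast
  then obtain K where K: "\<And>x. x \<in> {0..a} \<Longrightarrow> \<bar>\<phi> x\<bar> \<le> K"
    unfolding bounded_iff by (metis imageI real_norm_def)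
  have bound: "\<bar>pairing \<phi> t - pairing \<phi> s\<bar> \<le> K * (sqrt a * L2_norm {0<..<a} (U t - U s))" if t: "t \<in> {0..T}" for t
  proof -
    have "pairing \<phi> t - pairing \<phi> s = (LINT x|?M. (U t x - U s x) * \<phi> x)"
      unfolding pairing_def using integrable_U_mult[OF t \<phi>] integrable_U_mult[OF s \<phi>]
      by (simp add: left_diff_distrib)
    also have "\<bar>\<dots>\<bar> \<le> (LINT x|?M. \<bar>(U t x - U s x) * \<phi> x\<bar>)" by (rule integral_abs_bound)
    also have "\<dots> \<le> (LINT x|?M. K * \<bar>U t x - U s x\<bar>)"
    proof (rule integral_mono)
      show "integrable ?M (\<lambda>x. \<bar>(U t x - U s x) * \<phi> x\<bar>)"
        using integrable_U_mult[OF t \<phi>] integrable_U_mult[OF s \<phi>] by (simp add: left_diff_distrib)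
      show "integrable ?M (\<lambda>x. K * \<bar>U t x - U s x\<bar>)" using integrable_U[OF t] integrable_U[OF s] by simp
      show "\<bar>(U t x - U s x) * \<phi> x\<bar> \<le> K * \<bar>U t x - U s x\<bar>" if "x \<in> space ?M" for x
      proof -
        have "\<bar>\<phi> x\<bar> \<le> K" using K[of x] that by auto
        then have "\<bar>\<phi> x\<bar> * \<bar>U t x - U s x\<bar> \<le> K * \<bar>U t x - U s x\<bar>" by (rule mult_right_mono) simp
        then show ?thesis by (simp add: abs_mult mult.commute)
      qed
    qed
    also have "\<dots> = K * (LINT x|?M. \<bar>(U t - U s) x\<bar>)" by simp
    also have "\<dots> \<le> K * (sqrt a * L2_norm {0<..<a} (U t - U s))"
      using L1_le_L2_norm[OF L2_diff[OF U_L2[OF t] U_L2[OF s]] a] K[of 0] a by (intro mult_left_mono) auto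
    finally show ?thesis .
  qed
  have "((\<lambda>t. pairing \<phi> t - pairing \<phi> s) \<longlongrightarrow> 0) (at s within {0..T})"
  proof (rule Lim_null_comparison)
    show "\<forall>\<^sub>F t in at s within {0..T}. norm (pairing \<phi> t - pairing \<phi> s) \<le> K * (sqrt a * L2_norm {0<..<a} (U t - U s))"
      using bound unfolding eventually_at_filter by (auto intro!: always_eventually)
    show "((\<lambda>t. K * (sqrt a * L2_norm {0<..<a} (U t - U s))) \<longlongrightarrow> 0) (at s within {0..T})"
      by (intro tendsto_mult_right_zero U_cont s)
  qed
  then show "(pairing \<phi> \<longlongrightarrow> pairing \<phi> s) (at s within {0..T})" by (simp add: LIM_zero_iff)
qed

lemma pairing_0:
  assumes \<phi>: "continuous_on {0..a} \<phi>"
  shows "pairing \<phi> 0 = 0"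
proof -
  have "pairing \<phi> 0 = (LINT x|lebesgue_on {0<..<a}. 0)" unfolding pairing_def
    using integrable_U_mult[of 0 \<phi>] \<phi> T U_0 by (intro integral_cong_AE) auto
  then show ?thesis by simp
qed

lemma AE_pairing_eq:
  assumes \<phi>: "continuous_on {0..a} \<phi>"
  shows "AE t in lebesgue_on {0<..<T}. pairing \<phi> t = (LINT x|lebesgue_on {0<..<a}. u t x * \<phi> x)"
  using U_u u_H1 AE_space
proof eventually_elim
  case (elim t)
  have "u t \<in> borel_measurable (lebesgue_on {0<..<a})" using elim(2) by (auto simp: H1_def L2_def)
  then show ?case
    unfolding pairing_def using elim integrable_U_mult[of t \<phi>] \<phi> measurable_continuous_Ioo[OF \<phi>]
    by (intro integral_cong_AE) (auto elim!: eventually_mono)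
qed

text \<open>The variational equation tested with a smooth function: for almost every \<open>t\<close>, it is a linear relation
  between the two boundary values of \<open>u t\<close>, the flux datum and inner products.\<close>

lemma time_equation:
  assumes \<phi>: "\<And>x. x \<in> {0..a} \<Longrightarrow> (\<phi> has_vector_derivative P x / \<gamma> x) (at x within {0..a})"
    and P: "\<And>x. x \<in> {0..a} \<Longrightarrow> (P has_vector_derivative R x) (at x within {0..a})"
    and R: "continuous_on {0..a} R"
  shows "\<phi> \<in> H1 a" and "AE t in lebesgue_on {0<..<T}. F t \<phi> = P 0 * point_value a (u t) 0
      - (P a + \<rho> * \<phi> a) * point_value a (u t) a - \<gamma> 0 * \<phi> 0 * ux0 t + pairing R t"
proof -
  have cP: "continuous_on {0..a} P" using P has_vector_derivative_continuous
    by (metis continuous_on_eq_continuous_within)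
  have cP\<gamma>: "continuous_on {0..a} (\<lambda>x. P x / \<gamma> x)"
    using pos_\<gamma> by (intro continuous_intros cP cont_\<gamma>) force
  note C1 = C1_in_H1[OF \<phi> cP\<gamma> a]
  show H: "\<phi> \<in> H1 a" by (rule C1(1))
  show "AE t in lebesgue_on {0<..<T}. F t \<phi> = P 0 * point_value a (u t) 0
      - (P a + \<rho> * \<phi> a) * point_value a (u t) a - \<gamma> 0 * \<phi> 0 * ux0 t + pairing R t"
    using equation[OF H] u_H1 AE_pairing_eq[OF R]
  proof eventually_elim
    case (elim t)
    have "point_value a \<phi> 0 = \<phi> 0" "point_value a \<phi> a = \<phi> a" using C1(3) a by auto
    then show ?case
      using elim H1_Green_formula[OF elim(2) a cont_\<gamma> pos_\<gamma> \<phi> P R] by (simp add: algebra_simps)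
  qed
qed

lemma integrable_F: "\<phi> \<in> H1 a \<Longrightarrow> integrable (lebesgue_on {0<..<T}) (\<lambda>t. F t \<phi>)"
  using bochner_L2_dual_integrable[OF F _ a] .

lemma integrable_ux0: "integrable (lebesgue_on {0<..<T}) ux0"
  using L2_integrable[OF ux0] .

lemma integrable_pairing:
  assumes "continuous_on {0..a} \<phi>" shows "integrable (lebesgue_on {0<..<T}) (pairing \<phi>)"
  by (rule integrable_continuous_Ioo[OF continuous_on_pairing[OF assms]])

lemma flux_primitive:
  assumes P: "continuous_on {0..a} P" and x: "x \<in> {0..a}"
  shows "((\<lambda>x. integral {0..x} (\<lambda>s. P s / \<gamma> s) - c) has_vector_derivative P x / \<gamma> x) (at x within {0..a})"
proof -
  have "continuous_on {0..a} (\<lambda>x. P x / \<gamma> x)"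
    using pos_\<gamma> by (intro continuous_intros P cont_\<gamma>) force
  from integral_has_vector_derivative[OF this x] show ?thesis
    by (auto intro!: derivative_eq_intros)
qed

text \<open>No measurability of the boundary values in time is known a priori. It follows from the equation
  itself: test functions with flux \<open>x\<close> and \<open>a - x\<close> that vanish at \<open>a\<close> express each of the two boundary
  values by integrable quantities.\<close>

lemma integrable_point_value:
  "integrable (lebesgue_on {0<..<T}) (\<lambda>t. point_value a (u t) 0)"
  "integrable (lebesgue_on {0<..<T}) (\<lambda>t. point_value a (u t) a)"
proof -
  let ?M = "lebesgue_on {0<..<T}"
  define \<phi> where "\<phi> x = integral {0..x} (\<lambda>s. s / \<gamma> s) - integral {0..a} (\<lambda>s. s / \<gamma> s)" for x
  have \<phi>: "(\<phi> has_vector_derivative x / \<gamma> x) (at x within {0..a})" if "x \<in> {0..a}" for x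
    unfolding \<phi>_def using that by (intro flux_primitive continuous_intros)
  have der1: "((\<lambda>x::real. x) has_vector_derivative 1) (at x within {0..a})" for x
    by (auto intro!: derivative_eq_intros)
  have e1: "\<phi> \<in> H1 a" by (rule time_equation(1)[OF \<phi> der1 continuous_on_const])
  have e2: "AE t in ?M. F t \<phi> = 0 * point_value a (u t) 0 - (a + \<rho> * \<phi> a) * point_value a (u t) a - \<gamma> 0 * \<phi> 0 * ux0 t + pairing (\<lambda>_. 1) t"
    by (rule time_equation(2)[OF \<phi> der1 continuous_on_const])
  note e = e1 e2
  have "integrable ?M (\<lambda>t. (- F t \<phi> - \<gamma> 0 * \<phi> 0 * ux0 t + pairing (\<lambda>_. 1) t) / a)"
    using integrable_F[OF e(1)] integrable_ux0 integrable_pairing[of "\<lambda>_. 1"] by auto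
  moreover have "AE t in ?M. (- F t \<phi> - \<gamma> 0 * \<phi> 0 * ux0 t + pairing (\<lambda>_. 1) t) / a = point_value a (u t) a"
    using e(2) by eventually_elim (use a in \<open>simp add: \<phi>_def field_simps\<close>)
  ultimately show "integrable ?M (\<lambda>t. point_value a (u t) a)" by (rule integrable_AE_eq_Ioo)
  define \<psi> where "\<psi> x = integral {0..x} (\<lambda>s. (a - s) / \<gamma> s) - integral {0..a} (\<lambda>s. (a - s) / \<gamma> s)" for x
  have \<psi>: "(\<psi> has_vector_derivative (a - x) / \<gamma> x) (at x within {0..a})" if "x \<in> {0..a}" for x
    unfolding \<psi>_def using that by (intro flux_primitive continuous_intros)
  have der1: "((\<lambda>x::real. a - x) has_vector_derivative -1) (at x within {0..a})" for x
    by (auto intro!: derivative_eq_intros)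
  have e1: "\<psi> \<in> H1 a" by (rule time_equation(1)[OF \<psi> der1 continuous_on_const])
  have e2: "AE t in ?M. F t \<psi> = (a - 0) * point_value a (u t) 0 - ((a - a) + \<rho> * \<psi> a) * point_value a (u t) a - \<gamma> 0 * \<psi> 0 * ux0 t + pairing (\<lambda>_. -1) t"
    by (rule time_equation(2)[OF \<psi> der1 continuous_on_const])
  note e = e1 e2
  have "integrable ?M (\<lambda>t. (F t \<psi> + \<gamma> 0 * \<psi> 0 * ux0 t - pairing (\<lambda>_. -1) t) / a)"
    using integrable_F[OF e(1)] integrable_ux0 integrable_pairing[of "\<lambda>_. -1"] by auto
  moreover have "AE t in ?M. (F t \<psi> + \<gamma> 0 * \<psi> 0 * ux0 t - pairing (\<lambda>_. -1) t) / a = point_value a (u t) 0"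
    using e(2) by eventually_elim (use a in \<open>simp add: \<psi>_def field_simps\<close>)
  ultimately show "integrable ?M (\<lambda>t. point_value a (u t) 0)" by (rule integrable_AE_eq_Ioo)
qed

text \<open>The Laplace transform over the finite time interval, at the complex frequency \<open>\<zeta>\<close>.\<close>

definition laplace :: "complex \<Rightarrow> (real \<Rightarrow> real) \<Rightarrow> complex" where
  "laplace \<zeta> f = (LINT t|lebesgue_on {0<..<T}. f t *\<^sub>R exp (- \<zeta> * of_real t))"

text \<open>The zero initial value leaves only the boundary term at the final time.\<close>

lemma laplace_F:
  fixes \<zeta> :: complex
  assumes \<phi>: "\<phi> \<in> H1 a" and c\<phi>: "continuous_on {0..a} \<phi>"
  shows "laplace \<zeta> (\<lambda>t. F t \<phi>)
     = exp (- \<zeta> * of_real T) * of_real (pairing \<phi> T) + \<zeta> * laplace \<zeta> (pairing \<phi>)"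
proof -
  let ?M = "lebesgue_on {0<..<T}"
  let ?k = "\<lambda>t::real. exp (- \<zeta> * complex_of_real t)"
  let ?G = "primitive T (\<lambda>t. F t \<phi>)"
  note iF = integrable_F[OF \<phi>]
  have ip: "integrable ?M (\<lambda>t. LINT x|lebesgue_on {0<..<a}. u t x * \<phi> x)"
    by (rule integrable_AE_eq_Ioo[OF integrable_pairing[OF c\<phi>] AE_pairing_eq[OF c\<phi>]])
  have "is_weak_deriv T (\<lambda>t. LINT x|lebesgue_on {0<..<a}. u t x * \<phi> x) (\<lambda>t. F t \<phi>)"
    using F_deriv \<phi> unfolding is_time_deriv_def by blast
  from weak_deriv_imp_primitive[OF ip iF this T] obtain c where
    c: "AE t in ?M. (LINT x|lebesgue_on {0<..<a}. u t x * \<phi> x) = c + ?G t" by blast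
  have AE: "AE t in ?M. pairing \<phi> t = c + ?G t"
    using c AE_pairing_eq[OF c\<phi>] by eventually_elim simp
  have "continuous_on {0..T} (\<lambda>t. c + ?G t)"
    by (intro continuous_intros continuous_on_primitive[OF iF])
  from AE_Ioo_continuous_eq[OF continuous_on_pairing[OF c\<phi>] this T AE]
  have eq: "pairing \<phi> t = c + ?G t" if "t \<in> {0..T}" for t using that .
  have "c = 0" using eq[of 0] T by (simp add: pairing_0[OF c\<phi>] primitive_ends)
  with eq have eq: "?G t = pairing \<phi> t" if "t \<in> {0..T}" for t using that by simp
  have dk: "(?k has_vector_derivative - \<zeta> * ?k t) (at t within {0..T})" for t
  proof -
    have "((\<lambda>s. exp (- \<zeta> * s)) has_field_derivative - \<zeta> * ?k t) (at (of_real t))"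
      by (auto intro!: derivative_eq_intros)
    from has_vector_derivative_real_field[OF this] show ?thesis by (rule has_vector_derivative_at_within)
  qed
  have "(LINT t|?M. ?G t *\<^sub>R (- \<zeta> * ?k t)) = ?G T *\<^sub>R ?k T - (LINT t|?M. F t \<phi> *\<^sub>R ?k t)"
    by (rule primitive_integration_by_parts[OF iF _ dk]) (use T in \<open>auto intro!: continuous_intros\<close>)
  moreover have "(LINT t|?M. ?G t *\<^sub>R (- \<zeta> * ?k t)) = (LINT t|?M. - \<zeta> * (pairing \<phi> t *\<^sub>R ?k t))"
    by (intro Bochner_Integration.integral_cong) (auto simp: eq)
  moreover have "(LINT t|?M. - \<zeta> * (pairing \<phi> t *\<^sub>R ?k t)) = - \<zeta> * (LINT t|?M. pairing \<phi> t *\<^sub>R ?k t)"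
    by (rule integral_mult_right_zero)
  moreover have "?G T = pairing \<phi> T" using eq T by simp
  ultimately show ?thesis unfolding laplace_def by (simp add: scaleR_conv_of_real algebra_simps)
qed

lemma integrable_laplace:
  assumes "integrable (lebesgue_on {0<..<T}) f"
  shows "integrable (lebesgue_on {0<..<T}) (\<lambda>t. f t *\<^sub>R exp (- \<zeta> * complex_of_real t))"
  using assms by (intro integrable_mult_continuous_Ioo continuous_intros)

lemma laplace_cong_AE:
  assumes "integrable (lebesgue_on {0<..<T}) f" "AE t in lebesgue_on {0<..<T}. f t = g t"
  shows "laplace \<zeta> f = laplace \<zeta> g"
  unfolding laplace_def
proof (rule integral_cong_AE)
  show "(\<lambda>t. f t *\<^sub>R exp (- \<zeta> * complex_of_real t)) \<in> borel_measurable (lebesgue_on {0<..<T})"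
    "(\<lambda>t. g t *\<^sub>R exp (- \<zeta> * complex_of_real t)) \<in> borel_measurable (lebesgue_on {0<..<T})"
    using integrable_laplace[OF assms(1), of \<zeta>] integrable_laplace[OF integrable_AE_eq_Ioo[OF assms], of \<zeta>]
    by auto
  show "AE t in lebesgue_on {0<..<T}. f t *\<^sub>R exp (- \<zeta> * complex_of_real t) = g t *\<^sub>R exp (- \<zeta> * complex_of_real t)"
    using assms(2) by eventually_elim simp
qed

lemma laplace_add:
  assumes "integrable (lebesgue_on {0<..<T}) f" "integrable (lebesgue_on {0<..<T}) g"
  shows "laplace \<zeta> (\<lambda>t. f t + g t) = laplace \<zeta> f + laplace \<zeta> g"
  unfolding laplace_def using integrable_laplace[OF assms(1), of \<zeta>] integrable_laplace[OF assms(2), of \<zeta>]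
  by (simp add: scaleR_add_left)

lemma laplace_scale: "laplace \<zeta> (\<lambda>t. c * f t) = of_real c * laplace \<zeta> f"
  unfolding laplace_def scaleR_scaleR[symmetric] integral_scaleR_right by (simp add: scaleR_conv_of_real)

lemma laplace_real_equation:
  assumes \<phi>: "\<And>x. x \<in> {0..a} \<Longrightarrow> (\<phi> has_vector_derivative P x / \<gamma> x) (at x within {0..a})"
    and P: "\<And>x. x \<in> {0..a} \<Longrightarrow> (P has_vector_derivative R x) (at x within {0..a})"
    and R: "continuous_on {0..a} R"
  shows "exp (- \<zeta> * of_real T) * of_real (pairing \<phi> T) + \<zeta> * laplace \<zeta> (pairing \<phi>)
    = of_real (P 0) * laplace \<zeta> (\<lambda>t. point_value a (u t) 0)
      - of_real (P a + \<rho> * \<phi> a) * laplace \<zeta> (\<lambda>t. point_value a (u t) a)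
      - of_real (\<gamma> 0 * \<phi> 0) * laplace \<zeta> ux0 + laplace \<zeta> (pairing R)"
proof -
  have c\<phi>: "continuous_on {0..a} \<phi>" using \<phi> has_vector_derivative_continuous
    by (metis continuous_on_eq_continuous_within)
  have e1: "\<phi> \<in> H1 a" by (rule time_equation(1)[OF \<phi> P R])
  have e2: "AE t in lebesgue_on {0<..<T}. F t \<phi> = P 0 * point_value a (u t) 0
      - (P a + \<rho> * \<phi> a) * point_value a (u t) a - \<gamma> 0 * \<phi> 0 * ux0 t + pairing R t"
    by (rule time_equation(2)[OF \<phi> P R])
  note e = e1 e2
  note i = integrable_point_value integrable_ux0 integrable_pairing[OF R]
  note i1 = integrable_mult_right[OF i(1), of "P 0"]
    and i2 = integrable_mult_right[OF i(2), of "- (P a + \<rho> * \<phi> a)"]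
    and i3 = integrable_mult_right[OF i(3), of "- (\<gamma> 0 * \<phi> 0)"]
  let ?r = "\<lambda>t. (P 0 * point_value a (u t) 0 + (- (P a + \<rho> * \<phi> a)) * point_value a (u t) a)
     + ((- (\<gamma> 0 * \<phi> 0)) * ux0 t + pairing R t)"
  have "laplace \<zeta> (\<lambda>t. F t \<phi>) = laplace \<zeta> ?r"
    by (rule laplace_cong_AE[OF integrable_F[OF e(1)]]) (use e(2) in eventually_elim, simp add: algebra_simps)
  also have "\<dots> = (of_real (P 0) * laplace \<zeta> (\<lambda>t. point_value a (u t) 0)
      + of_real (- (P a + \<rho> * \<phi> a)) * laplace \<zeta> (\<lambda>t. point_value a (u t) a))
      + (of_real (- (\<gamma> 0 * \<phi> 0)) * laplace \<zeta> ux0 + laplace \<zeta> (pairing R))"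
    unfolding laplace_add[OF Bochner_Integration.integrable_add[OF i1 i2] Bochner_Integration.integrable_add[OF i3 i(4)]]
      laplace_add[OF i1 i2] laplace_add[OF i3 i(4)] laplace_scale by (rule refl)
  finally have eq: "laplace \<zeta> (\<lambda>t. F t \<phi>) = \<dots>" .
  show ?thesis unfolding laplace_F[OF e(1) c\<phi>, symmetric] eq by (simp add: algebra_simps)
qed

text \<open>The complex linear extension of the inner product at the final time.\<close>

definition cpairing :: "(real \<Rightarrow> complex) \<Rightarrow> complex" where
  "cpairing \<phi> = of_real (pairing (\<lambda>x. Re (\<phi> x)) T) + \<i> * of_real (pairing (\<lambda>x. Im (\<phi> x)) T)"

text \<open>The fundamental identity. For a solution of $(\gamma\varphi')' = \zeta\varphi$ the inner products with \<open>u\<close> cancel,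
  and only the transforms of the boundary data and a term at the final time remain.\<close>

lemma laplace_equation:
  fixes \<phi> P :: "real \<Rightarrow> complex"
  assumes \<phi>: "\<And>x. x \<in> {0..a} \<Longrightarrow> (\<phi> has_vector_derivative P x / of_real (\<gamma> x)) (at x within {0..a})"
    and P: "\<And>x. x \<in> {0..a} \<Longrightarrow> (P has_vector_derivative \<zeta> * \<phi> x) (at x within {0..a})"
  shows "P 0 * laplace \<zeta> (\<lambda>t. point_value a (u t) 0)
      - (P a + of_real \<rho> * \<phi> a) * laplace \<zeta> (\<lambda>t. point_value a (u t) a)
      - of_real (\<gamma> 0) * \<phi> 0 * laplace \<zeta> ux0 = exp (- \<zeta> * of_real T) * cpairing \<phi>"
proof -
  have c\<phi>: "continuous_on {0..a} \<phi>" using \<phi> has_vector_derivative_continuous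
    by (metis continuous_on_eq_continuous_within)
  \<comment> \<open>The space of test functions is real, so the real and imaginary parts are inserted separately.
      Since \<open>\<zeta>\<close> is complex, the derivative of each flux involves both of them.\<close>
  let ?r = "\<lambda>x. Re (\<phi> x)" and ?i = "\<lambda>x. Im (\<phi> x)"
  have cr: "continuous_on {0..a} ?r" "continuous_on {0..a} ?i" by (intro continuous_intros c\<phi>)+
  have RI: "((\<lambda>x. Re (f x)) has_vector_derivative Re d) (at x within S)"
       "((\<lambda>x. Im (f x)) has_vector_derivative Im d) (at x within S)"
    if "(f has_vector_derivative d) (at x within S)" for f d x S
    using that bounded_linear.has_vector_derivative[OF bounded_linear_Re] bounded_linear.has_vector_derivative[OF bounded_linear_Im] by blast+
  have pair_lin: "pairing (\<lambda>x. c * ?r x + d * ?i x) t = c * pairing ?r t + d * pairing ?i t" if "t \<in> {0..T}" for c d t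
    unfolding pairing_def using integrable_U_mult[OF that cr(1)] integrable_U_mult[OF that cr(2)]
    by (simp add: distrib_left mult.left_commute)
  have lap_lin: "laplace \<zeta> (pairing (\<lambda>x. c * ?r x + d * ?i x)) = of_real c * laplace \<zeta> (pairing ?r) + of_real d * laplace \<zeta> (pairing ?i)" for c d
  proof -
    have "laplace \<zeta> (pairing (\<lambda>x. c * ?r x + d * ?i x)) = laplace \<zeta> (\<lambda>t. c * pairing ?r t + d * pairing ?i t)"
      unfolding laplace_def by (intro Bochner_Integration.integral_cong) (auto simp: pair_lin)
    then show ?thesis using integrable_pairing[OF cr(1)] integrable_pairing[OF cr(2)]
      by (simp add: laplace_add laplace_scale)
  qed
  have 1: "exp (- \<zeta> * of_real T) * of_real (pairing ?r T) + \<zeta> * laplace \<zeta> (pairing ?r)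
    = of_real (Re (P 0)) * laplace \<zeta> (\<lambda>t. point_value a (u t) 0)
      - of_real (Re (P a) + \<rho> * Re (\<phi> a)) * laplace \<zeta> (\<lambda>t. point_value a (u t) a)
      - of_real (\<gamma> 0 * Re (\<phi> 0)) * laplace \<zeta> ux0 + laplace \<zeta> (pairing (\<lambda>x. Re \<zeta> * ?r x + (- Im \<zeta>) * ?i x))"
  proof (rule laplace_real_equation)
    show "(?r has_vector_derivative Re (P x) / \<gamma> x) (at x within {0..a})" if "x \<in> {0..a}" for x
      using RI(1)[OF \<phi>[OF that]] by simp
    show "((\<lambda>x. Re (P x)) has_vector_derivative (Re \<zeta> * ?r x + (- Im \<zeta>) * ?i x)) (at x within {0..a})" if "x \<in> {0..a}" for x
      using RI(1)[OF P[OF that]] by simp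
    show "continuous_on {0..a} (\<lambda>x. Re \<zeta> * ?r x + (- Im \<zeta>) * ?i x)" by (intro continuous_intros c\<phi>)
  qed
  have 2: "exp (- \<zeta> * of_real T) * of_real (pairing ?i T) + \<zeta> * laplace \<zeta> (pairing ?i)
    = of_real (Im (P 0)) * laplace \<zeta> (\<lambda>t. point_value a (u t) 0)
      - of_real (Im (P a) + \<rho> * Im (\<phi> a)) * laplace \<zeta> (\<lambda>t. point_value a (u t) a)
      - of_real (\<gamma> 0 * Im (\<phi> 0)) * laplace \<zeta> ux0 + laplace \<zeta> (pairing (\<lambda>x. Im \<zeta> * ?r x + Re \<zeta> * ?i x))"
  proof (rule laplace_real_equation)
    show "(?i has_vector_derivative Im (P x) / \<gamma> x) (at x within {0..a})" if "x \<in> {0..a}" for x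
      using RI(2)[OF \<phi>[OF that]] by simp
    show "((\<lambda>x. Im (P x)) has_vector_derivative (Im \<zeta> * ?r x + Re \<zeta> * ?i x)) (at x within {0..a})" if "x \<in> {0..a}" for x
      using RI(2)[OF P[OF that]] by (simp add: algebra_simps)
    show "continuous_on {0..a} (\<lambda>x. Im \<zeta> * ?r x + Re \<zeta> * ?i x)" by (intro continuous_intros c\<phi>)
  qed
  define X Y G E pr pm where "X = laplace \<zeta> (\<lambda>t. point_value a (u t) 0)"
    and "Y = laplace \<zeta> (\<lambda>t. point_value a (u t) a)" and "G = laplace \<zeta> ux0"
    and "E = exp (- \<zeta> * of_real T)" and "pr = laplace \<zeta> (pairing ?r)" and "pm = laplace \<zeta> (pairing ?i)"
  note defs = this
  have dec: "w = of_real (Re w) + \<i> * of_real (Im w)" for w by (rule complex_eq)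
  have 3: "of_real (Re \<zeta>) * pr + of_real (- Im \<zeta>) * pm + \<i> * (of_real (Im \<zeta>) * pr + of_real (Re \<zeta>) * pm)
     = \<zeta> * (pr + \<i> * pm)"
    by (simp add: complex_eq_iff algebra_simps)
  have "E * of_real (pairing ?r T) + \<zeta> * pr + \<i> * (E * of_real (pairing ?i T) + \<zeta> * pm)
    = (of_real (Re (P 0)) + \<i> * of_real (Im (P 0))) * X
      - ((of_real (Re (P a)) + \<i> * of_real (Im (P a))) + of_real \<rho> * (of_real (Re (\<phi> a)) + \<i> * of_real (Im (\<phi> a)))) * Y
      - of_real (\<gamma> 0) * (of_real (Re (\<phi> 0)) + \<i> * of_real (Im (\<phi> 0))) * G
      + (of_real (Re \<zeta>) * pr + of_real (- Im \<zeta>) * pm + \<i> * (of_real (Im \<zeta>) * pr + of_real (Re \<zeta>) * pm))"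
    unfolding 1[unfolded lap_lin, folded defs] 2[unfolded lap_lin, folded defs]
    by (simp add: distrib_left distrib_right left_diff_distrib right_diff_distrib mult_ac)
  then have "E * cpairing \<phi> = P 0 * X - (P a + of_real \<rho> * \<phi> a) * Y - of_real (\<gamma> 0) * \<phi> 0 * G"
    unfolding 3 dec[symmetric] cpairing_def by (simp add: distrib_left distrib_right mult_ac)
  then show ?thesis unfolding defs by simp
qed

lemma cpairing_bound:
  "\<exists>C\<ge>0. \<forall>\<phi> K. continuous_on {0..a} \<phi> \<longrightarrow> (\<forall>x\<in>{0..a}. norm (\<phi> x) \<le> K) \<longrightarrow> norm (cpairing \<phi>) \<le> C * K"
proof -
  let ?M = "lebesgue_on {0<..<a}"
  define I where "I = (LINT x|?M. \<bar>U T x\<bar>)"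
  have T': "T \<in> {0..T}" using T by auto
  have one: "\<bar>pairing \<phi> T\<bar> \<le> K * I" if c: "continuous_on {0..a} \<phi>" and K: "\<And>x. x \<in> {0..a} \<Longrightarrow> \<bar>\<phi> x\<bar> \<le> K" for \<phi> K
  proof -
    have "\<bar>pairing \<phi> T\<bar> \<le> (LINT x|?M. \<bar>U T x * \<phi> x\<bar>)" unfolding pairing_def by (rule integral_abs_bound)
    also have "\<dots> \<le> (LINT x|?M. K * \<bar>U T x\<bar>)"
    proof (rule integral_mono)
      show "integrable ?M (\<lambda>x. \<bar>U T x * \<phi> x\<bar>)" using integrable_U_mult[OF T' c] by simp
      show "integrable ?M (\<lambda>x. K * \<bar>U T x\<bar>)" using integrable_U[OF T'] by simp
      show "\<bar>U T x * \<phi> x\<bar> \<le> K * \<bar>U T x\<bar>" if "x \<in> space ?M" for x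
      proof -
        have "\<bar>\<phi> x\<bar> \<le> K" using K[of x] that by auto
        then have "\<bar>\<phi> x\<bar> * \<bar>U T x\<bar> \<le> K * \<bar>U T x\<bar>" by (rule mult_right_mono) simp
        then show ?thesis by (simp add: abs_mult mult.commute)
      qed
    qed
    finally show ?thesis unfolding I_def by simp
  qed
  have "norm (cpairing \<phi>) \<le> (2 * I) * K" if c: "continuous_on {0..a} \<phi>" and K: "\<forall>x\<in>{0..a}. norm (\<phi> x) \<le> K" for \<phi> K
  proof -
    have "\<bar>pairing (\<lambda>x. Re (\<phi> x)) T\<bar> \<le> K * I"
      using K abs_Re_le_cmod order_trans by (intro one continuous_intros c) blast
    moreover have "\<bar>pairing (\<lambda>x. Im (\<phi> x)) T\<bar> \<le> K * I"
      using K abs_Im_le_cmod order_trans by (intro one continuous_intros c) blast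
    ultimately show ?thesis
      using norm_triangle_ineq[of "complex_of_real (pairing (\<lambda>x. Re (\<phi> x)) T)" "\<i> * of_real (pairing (\<lambda>x. Im (\<phi> x)) T)"]
      unfolding cpairing_def by (simp add: norm_mult algebra_simps)
  qed
  moreover have "0 \<le> 2 * I" unfolding I_def by simp
  ultimately show ?thesis by blast
qed

end

section \<open>Asymptotics of special solutions in a sector\<close>

text \<open>The filter of large $z$ in a closed sector around the negative real axis, on which
  $|z|$ and $-\mathrm{Re}\,z$ are comparable. The factor two makes it contain the negative real
  axis as well as the curves \<open>ray c\<close>.\<close>

definition sector :: "complex filter" where
  "sector = inf at_infinity (principal {z. norm z \<le> - 2 * Re z})"

lemma eventually_sectorI:
  assumes "\<And>z. norm z \<ge> R \<Longrightarrow> norm z \<le> - 2 * Re z \<Longrightarrow> Q z"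
  shows "\<forall>\<^sub>F z in sector. Q z"
  unfolding sector_def eventually_inf_principal eventually_at_infinity using assms by auto

lemma eventually_sector:
  "\<forall>\<^sub>F z in sector. norm z \<ge> R \<and> norm z \<le> - 2 * Re z"
  by (rule eventually_sectorI[of R]) auto

lemma sector_Re_neg: "\<forall>\<^sub>F z in sector. norm z \<le> - 2 * Re z \<and> Re z < 0 \<and> z \<noteq> 0"
  by (rule eventually_mono[OF eventually_sector[of 1]]) auto

lemma tendsto_exp_sector:
  assumes "0 < s"
  shows "((\<lambda>z. exp (z * of_real s)) \<longlongrightarrow> 0) sector"
proof (rule Lim_null_comparison)
  show "\<forall>\<^sub>F z in sector. norm (exp (z * of_real s)) \<le> exp (- (s / 2) * norm z)"
  proof (rule eventually_sectorI[of 0])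
    fix z :: complex assume "norm z \<le> - 2 * Re z"
    then have "s * norm z \<le> s * (- 2 * Re z)" using assms by (intro mult_left_mono) auto
    then show "norm (exp (z * of_real s)) \<le> exp (- (s / 2) * norm z)" by (simp add: mult_ac)
  qed
  have "((\<lambda>x::real. exp (- (s / 2) * x)) \<longlongrightarrow> 0) at_top" using assms by real_asymp
  then have "((\<lambda>z::complex. exp (- (s / 2) * norm z)) \<longlongrightarrow> 0) at_infinity"
    by (rule filterlim_compose[OF _ filterlim_norm_at_top])
  then show "((\<lambda>z::complex. exp (- (s / 2) * norm z)) \<longlongrightarrow> 0) sector"
    unfolding sector_def by (rule tendsto_mono[rotated]) simp
qed

lemma norm_inverse_square_minus_one:
  fixes e :: complex
  assumes "norm e \<le> 1/2"
  shows "norm (1 / (1 + e)\<^sup>2 - 1) \<le> 10 * norm e" "norm (1 / (1+e)\<^sup>2) \<le> 4" "1 + e \<noteq> 0"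
proof -
  have n: "1/2 \<le> norm (1 + e)" using norm_triangle_ineq[of "1+e" "-e"] assms by simp
  then have n2: "1/4 \<le> norm (1 + e)^2" using power_mono[of "1/2" "norm (1+e)" 2] by (simp add: power2_eq_square)
  show nz: "1 + e \<noteq> 0" using n by auto
  show "norm (1 / (1+e)\<^sup>2) \<le> 4"
    using frac_le[of 1 1 "1/4" "norm (1 + e)^2"] n2 by (simp add: norm_divide norm_power)
  have "1 / (1 + e)\<^sup>2 - 1 = (1 - (1 + e)\<^sup>2) / (1 + e)\<^sup>2" using nz by (simp add: diff_divide_distrib)
  also have "1 - (1 + e)\<^sup>2 = - (e * (2 + e))" by (simp add: algebra_simps power2_eq_square)
  finally have "1 / (1 + e)\<^sup>2 - 1 = - (e * (2 + e)) / (1 + e)\<^sup>2" .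
  also have "norm \<dots> = norm e * norm (2 + e) / norm (1 + e)^2" by (simp add: norm_divide norm_power norm_mult)
  also have "\<dots> \<le> norm e * (5/2) / (1/4)"
    using n2 norm_triangle_ineq[of 2 e] assms by (intro frac_le mult_left_mono) auto
  finally show "norm (1 / (1 + e)\<^sup>2 - 1) \<le> 10 * norm e" by simp
qed

text \<open>The coefficient with the given family of decaying solutions.\<close>

locale medium =
  fixes \<gamma> :: "real \<Rightarrow> real" and a M :: real and \<Psi> :: "complex \<Rightarrow> real \<Rightarrow> complex"
  assumes a: "0 < a" and aM: "a \<le> M"
    and cont_\<gamma>M: "continuous_on {0..M} \<gamma>" and pos_\<gamma>M: "\<And>x. x \<in> {0..M} \<Longrightarrow> 0 < \<gamma> x"
    and family: "special_family \<gamma> M \<Psi>"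
begin

abbreviation "\<theta> \<equiv> travel_time \<gamma>"

text \<open>The flux $\gamma\Psi'$.\<close>

definition flux :: "complex \<Rightarrow> real \<Rightarrow> complex" where
  "flux z x = of_real (\<gamma> x) * deriv_on M (\<Psi> z) x"

text \<open>The differential equation is given in the open interval only. By integration, the flux agrees
  there with a continuously differentiable function; the fundamental theorem of calculus then shows that
  the one-sided derivatives at the end points are the limits of the interior ones.\<close>

lemma flux_derivs_M:
  assumes z: "Re z \<le> 0" and x: "x \<in> {0..M}"
  shows "(\<Psi> z has_vector_derivative flux z x / of_real (\<gamma> x)) (at x within {0..M})"
    and "(flux z has_vector_derivative z\<^sup>2 * \<Psi> z x) (at x within {0..M})"
proof -
  have M: "0 < M" using a aM by simp
  let ?y = "\<Psi> z"
  have dy: "(?y has_vector_derivative deriv_on M ?y x) (at x within {0..M})" if "x \<in> {0..M}" for x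
    using family z that unfolding special_family_def by (simp add: vector_derivative_works)
  have cy: "continuous_on {0..M} ?y" using dy has_vector_derivative_continuous
    by (metis continuous_on_eq_continuous_within)
  have dP: "(flux z has_vector_derivative z\<^sup>2 * ?y x) (at x)" if "x \<in> {0<..<M}" for x
    using family z that unfolding special_family_def flux_def[abs_def] by simp
  define W where "W x = integral {0..x} (\<lambda>s. z\<^sup>2 * ?y s)" for x
  have dW: "(W has_vector_derivative z\<^sup>2 * ?y x) (at x within {0..M})" if "x \<in> {0..M}" for x
    unfolding W_def[abs_def] using that by (intro integral_has_vector_derivative continuous_intros cy)
  obtain c where c0: "\<And>x. x \<in> {0<..<M} \<Longrightarrow> flux z x - W x = c"
  proof (rule has_vector_derivative_zero_constant[of "{0<..<M}" "\<lambda>x. flux z x - W x"])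
    fix x assume x: "x \<in> {0<..<M}"
    have "(W has_vector_derivative z\<^sup>2 * ?y x) (at x within {0<..<M})"
      by (rule has_vector_derivative_within_subset[OF dW]) (use x in auto)
    moreover have "(flux z has_vector_derivative z\<^sup>2 * ?y x) (at x within {0<..<M})"
      by (rule has_vector_derivative_at_within[OF dP[OF x]])
    ultimately show "((\<lambda>x. flux z x - W x) has_vector_derivative 0) (at x within {0<..<M})"
      using has_vector_derivative_diff by fastforce
  qed (auto intro: that)
  have c: "flux z x = c + W x" if "x \<in> {0<..<M}" for x using c0[OF that] by (simp add: algebra_simps)
  have cW: "continuous_on {0..M} W" using dW has_vector_derivative_continuous
    by (metis continuous_on_eq_continuous_within)
  have cq: "continuous_on {0..M} (\<lambda>x. (c + W x) / of_real (\<gamma> x))"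
    using pos_\<gamma>M by (intro continuous_intros cW cont_\<gamma>M) force
  define Y where "Y x = ?y 0 + integral {0..x} (\<lambda>s. (c + W s) / of_real (\<gamma> s))" for x
  have dY: "(Y has_vector_derivative (c + W x) / of_real (\<gamma> x)) (at x within {0..M})" if "x \<in> {0..M}" for x
    unfolding Y_def[abs_def] using integral_has_vector_derivative[OF cq that] by (auto intro!: derivative_eq_intros)
  have Yy: "Y x = ?y x" if x: "x \<in> {0..M}" for x
  proof -
    have "((\<lambda>s. (c + W s) / of_real (\<gamma> s)) has_integral (?y x - ?y 0)) {0..x}"
    proof (rule fundamental_theorem_of_calculus_interior)
      show "continuous_on {0..x} ?y" by (rule continuous_on_subset[OF cy]) (use x in auto)
      fix s assume s: "s \<in> {0<..<x}"
      then have sM: "s \<in> {0<..<M}" using x by auto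
      have "\<gamma> s \<noteq> 0" using pos_\<gamma>M[of s] sM by auto
      then have e: "deriv_on M ?y s = (c + W s) / of_real (\<gamma> s)"
        using c[OF sM] by (simp add: flux_def field_simps)
      have "(?y has_vector_derivative deriv_on M ?y s) (at s within {0<..<M})"
        by (rule has_vector_derivative_within_subset[OF dy]) (use sM in auto)
      then show "(?y has_vector_derivative (c + W s) / of_real (\<gamma> s)) (at s)"
        using sM e by (simp add: at_within_open[OF sM])
    qed (use x in auto)
    then show ?thesis by (simp add: Y_def integral_unique)
  qed
  have dy2: "(?y has_vector_derivative (c + W x) / of_real (\<gamma> x)) (at x within {0..M})" if x: "x \<in> {0..M}" for x
    by (rule has_vector_derivative_transform[OF x _ dY[OF x]]) (use Yy in auto)
  have eq: "flux z x = c + W x" if x: "x \<in> {0..M}" for x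
  proof -
    have "deriv_on M ?y x = (c + W x) / of_real (\<gamma> x)"
      by (rule vector_derivative_within_closed_interval[OF M x dy2[OF x]])
    moreover have "\<gamma> x \<noteq> 0" using pos_\<gamma>M[of x] x by auto
    ultimately show ?thesis by (simp add: flux_def)
  qed
  show "(?y has_vector_derivative flux z x / of_real (\<gamma> x)) (at x within {0..M})"
    using dy2[OF x] eq[OF x] by simp
  have "((\<lambda>x. c + W x) has_vector_derivative z\<^sup>2 * ?y x) (at x within {0..M})"
    using dW[OF x] by (auto intro!: derivative_eq_intros)
  then show "(flux z has_vector_derivative z\<^sup>2 * ?y x) (at x within {0..M})"
    by (rule has_vector_derivative_transform[OF x, rotated]) (use eq in auto)
qed

lemma flux_derivs:
  assumes z: "Re z \<le> 0" and x: "x \<in> {0..a}"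
  shows "(\<Psi> z has_vector_derivative flux z x / of_real (\<gamma> x)) (at x within {0..a})"
    and "(flux z has_vector_derivative z\<^sup>2 * \<Psi> z x) (at x within {0..a})"
  using flux_derivs_M[OF z, of x] x aM by (auto intro: has_vector_derivative_within_subset)

lemma continuous_on_\<gamma>: "continuous_on {0..a} \<gamma>"
  using continuous_on_subset[OF cont_\<gamma>M] aM by auto

lemma pos_\<gamma>: "x \<in> {0..a} \<Longrightarrow> 0 < \<gamma> x"
  using pos_\<gamma>M aM by auto

lemma continuous_on_\<Psi>: "Re z \<le> 0 \<Longrightarrow> continuous_on {0..a} (\<Psi> z)"
  using flux_derivs(1) has_vector_derivative_continuous by (metis continuous_on_eq_continuous_within)

lemma continuous_on_slowness: "continuous_on {0..a} (\<lambda>s. 1 / sqrt (\<gamma> s))"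
  using pos_\<gamma> by (intro continuous_intros continuous_on_\<gamma>) force

lemma \<theta>_deriv:
  "x \<in> {0..a} \<Longrightarrow> (\<theta> has_real_derivative 1 / sqrt (\<gamma> x)) (at x within {0..a})"
  using integral_has_real_derivative[OF continuous_on_slowness] .

lemma \<theta>_mono:
  assumes "0 \<le> x" "x \<le> y" "y \<le> a" shows "\<theta> x \<le> \<theta> y"
proof (rule integral_subset_le)
  show "(\<lambda>s. 1 / sqrt (\<gamma> s)) integrable_on {0..x}" "(\<lambda>s. 1 / sqrt (\<gamma> s)) integrable_on {0..y}"
    using assms by (auto intro!: integrable_continuous_real continuous_on_subset[OF continuous_on_slowness])
  show "\<forall>s\<in>{0..y}. 0 \<le> 1 / sqrt (\<gamma> s)" using pos_\<gamma> assms by (auto simp: less_imp_le)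
qed (use assms in auto)

lemma \<theta>_nonneg: "x \<in> {0..a} \<Longrightarrow> 0 \<le> \<theta> x"
  using \<theta>_mono[of 0 x] by simp

lemma \<theta>_a_pos: "0 < \<theta> a"
proof -
  have "\<theta> a \<noteq> 0"
  proof
    assume "\<theta> a = 0"
    then have "\<forall>x\<in>{0..a}. 1 / sqrt (\<gamma> x) = 0"
      using integral_eq_0_iff[OF continuous_on_slowness a] pos_\<gamma> by (auto simp: less_imp_le)
    then show False using pos_\<gamma>[of 0] a by auto
  qed
  then show ?thesis using \<theta>_nonneg[of a] a by simp
qed

text \<open>The fourth root of the coefficient.\<close>

definition g :: "real \<Rightarrow> real" where "g x = \<gamma> x powr (1/4)"

lemma g_pos: "x \<in> {0..a} \<Longrightarrow> 0 < g x" using pos_\<gamma> by (force simp: g_def)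

lemma g_powers:
  assumes "x \<in> {0..a}"
  shows "\<gamma> x powr (- 1/4) = 1 / g x" "\<gamma> x * \<gamma> x powr (- 3/4) = g x" "g x ^ 2 = sqrt (\<gamma> x)" "\<gamma> x = g x ^ 4"
proof -
  note p = pos_\<gamma>[OF assms]
  show "\<gamma> x powr (-1/4) = 1 / g x" using p by (simp add: g_def powr_minus_divide)
  have "\<gamma> x * \<gamma> x powr (-3/4) = \<gamma> x powr 1 * \<gamma> x powr (-3/4)" using p by simp
  also have "\<dots> = \<gamma> x powr (1 + (-3/4))" by (rule powr_add[symmetric])
  finally show "\<gamma> x * \<gamma> x powr (-3/4) = g x" by (simp add: g_def)
  have "g x ^ 2 = \<gamma> x powr (1/2)" using p by (simp add: g_def powr_powr flip: powr_realpow)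
  then show "g x ^ 2 = sqrt (\<gamma> x)" using p by (simp add: powr_half_sqrt)
  show "\<gamma> x = g x ^ 4" using p by (simp add: g_def powr_powr flip: powr_realpow)
qed

lemma continuous_on_g: "continuous_on {0..a} g"
  unfolding g_def[abs_def] using pos_\<gamma> by (intro continuous_intros continuous_on_\<gamma>) force

text \<open>The relative errors of the leading terms of $\Psi$ and of its flux.\<close>

definition rem :: "complex \<Rightarrow> real \<Rightarrow> complex" where
  "rem z x = \<Psi> z x * of_real (g x) / exp (z * of_real (\<theta> x)) - 1"

definition flux_rem :: "complex \<Rightarrow> real \<Rightarrow> complex" where
  "flux_rem z x = flux z x / (z * exp (z * of_real (\<theta> x)) * of_real (g x)) - 1"

lemma \<Psi>_eq: "x \<in> {0..a} \<Longrightarrow> \<Psi> z x = exp (z * of_real (\<theta> x)) * (1 + rem z x) / of_real (g x)"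
  using g_pos[of x] by (simp add: rem_def)

lemma flux_eq: "x \<in> {0..a} \<Longrightarrow> z \<noteq> 0 \<Longrightarrow> flux z x = z * exp (z * of_real (\<theta> x)) * of_real (g x) * (1 + flux_rem z x)"
  using g_pos[of x] by (simp add: flux_rem_def)

lemma asymptotics:
  assumes "0 < \<epsilon>"
  shows "\<forall>\<^sub>F z in sector. \<forall>x\<in>{0..a}. norm (rem z x) \<le> \<epsilon> \<and> norm (flux_rem z x) \<le> \<epsilon>"
proof -
  obtain K R where R: "R > 0" and KR: "\<forall>z. Re z \<le> 0 \<and> norm z \<ge> R \<longrightarrow> (\<forall>x\<in>{0..M}.
     \<exists>e e'. norm e \<le> K / norm z \<and> norm e' \<le> K / norm z \<and>
           \<Psi> z x = complex_of_real (\<gamma> x powr (- 1 / 4))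
             * exp (z * complex_of_real (\<theta> x)) * (1 + e) \<and>
           deriv_on M (\<Psi> z) x = z * complex_of_real (\<gamma> x powr (- 3 / 4))
             * exp (z * complex_of_real (\<theta> x)) * (1 + e'))"
    using conjunct2[OF family[unfolded special_family_def]] by (elim exE conjE) (rule that)
  show ?thesis
  proof (rule eventually_mono[OF eventually_sector[of "max R (\<bar>K\<bar> / \<epsilon>)"]], intro ballI)
    fix z x assume z: "norm z \<ge> max R (\<bar>K\<bar> / \<epsilon>) \<and> norm z \<le> - 2 * Re z" and x: "x \<in> {0..a}"
    have nz: "norm z > 0" using R z by linarith
    have "\<bar>K\<bar> \<le> \<epsilon> * norm z" using z assms by (simp add: field_simps)
    then have Ke: "K / norm z \<le> \<epsilon>" using nz by (simp add: field_simps)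
    have z': "Re z \<le> 0 \<and> norm z \<ge> R" using z norm_ge_zero[of z] by linarith
    have x': "x \<in> {0..M}" using x aM by auto
    obtain e e' where e: "norm e \<le> K / norm z" "norm e' \<le> K / norm z"
           "\<Psi> z x = complex_of_real (\<gamma> x powr (- 1 / 4)) * exp (z * complex_of_real (\<theta> x)) * (1 + e)"
           "deriv_on M (\<Psi> z) x = z * complex_of_real (\<gamma> x powr (- 3 / 4)) * exp (z * complex_of_real (\<theta> x)) * (1 + e')"
      using KR[THEN spec, THEN mp, OF z', THEN bspec, OF x'] by (elim exE conjE) (rule that)
    have 1: "\<Psi> z x = exp (z * of_real (\<theta> x)) * (1 + e) / of_real (g x)"
      unfolding e(3) g_powers(1)[OF x] by (simp add: field_simps)
    have "flux z x = z * exp (z * of_real (\<theta> x)) * of_real (\<gamma> x * \<gamma> x powr (-3/4)) * (1 + e')"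
      unfolding flux_def e(4) by simp
    then have 2: "flux z x = z * exp (z * of_real (\<theta> x)) * of_real (g x) * (1 + e')"
      unfolding g_powers(2)[OF x] .
    have "rem z x = e" "flux_rem z x = e'"
      using 1 2 nz g_pos[OF x] by (auto simp: rem_def flux_rem_def)
    then show "norm (rem z x) \<le> \<epsilon> \<and> norm (flux_rem z x) \<le> \<epsilon>"
      using e(1,2) Ke by auto
  qed
qed

lemma tendsto_\<Psi>:
  assumes x: "x \<in> {0..a}"
  shows "((\<lambda>z. \<Psi> z x / exp (z * of_real (\<theta> x))) \<longlongrightarrow> 1 / of_real (g x)) sector"
    and "((\<lambda>z. flux z x / (z * exp (z * of_real (\<theta> x)))) \<longlongrightarrow> of_real (g x)) sector"
proof -
  have gp: "g x > 0" using g_pos[OF x] .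
  have 0: "((\<lambda>z. rem z x) \<longlongrightarrow> 0) sector" "((\<lambda>z. flux_rem z x) \<longlongrightarrow> 0) sector"
  proof -
    have "\<forall>\<^sub>F z in sector. norm (rem z x) < \<epsilon> \<and> norm (flux_rem z x) < \<epsilon>" if "0 < \<epsilon>" for \<epsilon>
    proof -
      have "0 < \<epsilon> / 2" using that by simp
      from asymptotics[OF this] show ?thesis
      proof eventually_elim
        case (elim z)
        from bspec[OF elim x] show ?case using that by auto
      qed
    qed
    then show "((\<lambda>z. rem z x) \<longlongrightarrow> 0) sector" "((\<lambda>z. flux_rem z x) \<longlongrightarrow> 0) sector"
      unfolding tendsto_iff dist_norm by (auto simp: eventually_conj_iff)
  qed
  have "((\<lambda>z. (1 + rem z x) / of_real (g x)) \<longlongrightarrow> (1 + 0) / of_real (g x)) sector"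
    using gp by (intro tendsto_intros 0) auto
  then show "((\<lambda>z. \<Psi> z x / exp (z * of_real (\<theta> x))) \<longlongrightarrow> 1 / of_real (g x)) sector"
    by (simp add: \<Psi>_eq[OF x])
  have "((\<lambda>z. of_real (g x) * (1 + flux_rem z x)) \<longlongrightarrow> of_real (g x) * (1 + 0)) sector"
    by (intro tendsto_intros 0)
  moreover have "\<forall>\<^sub>F z in sector. of_real (g x) * (1 + flux_rem z x) = flux z x / (z * exp (z * of_real (\<theta> x)))"
    using sector_Re_neg by eventually_elim (simp add: flux_eq[OF x])
  ultimately have "((\<lambda>z. flux z x / (z * exp (z * of_real (\<theta> x)))) \<longlongrightarrow> of_real (g x) * (1 + 0)) sector"
    by (rule Lim_transform_eventually)
  then show "((\<lambda>z. flux z x / (z * exp (z * of_real (\<theta> x)))) \<longlongrightarrow> of_real (g x)) sector" by simp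
qed

lemma integral_slowness_exp:
  fixes w :: complex
  assumes w: "w \<noteq> 0" and x: "x \<in> {0..a}"
  shows "((\<lambda>s. exp (w * of_real (\<theta> s)) / of_real (sqrt (\<gamma> s))) has_integral (exp (w * of_real (\<theta> x)) - 1) / w) {0..x}"
proof -
  have "((\<lambda>s. exp (w * of_real (\<theta> s)) / of_real (sqrt (\<gamma> s))) has_integral
      (exp (w * of_real (\<theta> x)) / w - exp (w * of_real (\<theta> 0)) / w)) {0..x}"
  proof (rule fundamental_theorem_of_calculus)
    fix s assume s: "s \<in> {0..x}"
    have "(\<theta> has_real_derivative 1 / sqrt (\<gamma> s)) (at s within {0..x})"
      by (rule DERIV_subset[OF \<theta>_deriv]) (use s x in auto)
    then have 1: "(\<theta> has_vector_derivative 1 / sqrt (\<gamma> s)) (at s within {0..x})"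
      by (simp add: has_real_derivative_iff_has_vector_derivative)
    have 2: "((\<lambda>y. exp (w * y) / w) has_field_derivative exp (w * of_real (\<theta> s))) (at (of_real (\<theta> s)))"
      using w by (auto intro!: derivative_eq_intros)
    have 3: "((\<lambda>y. exp (w * of_real y) / w) has_vector_derivative exp (w * of_real (\<theta> s))) (at (\<theta> s) within \<theta> ` {0..x})"
      using has_vector_derivative_real_field[OF 2] by (rule has_vector_derivative_at_within)
    from vector_diff_chain_within[OF 1 3]
    show "((\<lambda>s. exp (w * of_real (\<theta> s)) / w) has_vector_derivative exp (w * of_real (\<theta> s)) / of_real (sqrt (\<gamma> s))) (at s within {0..x})"
      by (simp add: o_def scaleR_conv_of_real)
  qed (use x in auto)
  then show ?thesis by (simp add: diff_divide_distrib)
qed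

lemma integral_slowness_exp_real:
  assumes w: "w \<noteq> 0" and x: "x \<in> {0..a}"
  shows "((\<lambda>s. exp (w * \<theta> s) / sqrt (\<gamma> s)) has_integral (exp (w * \<theta> x) - 1) / w) {0..x}"
proof -
  have "complex_of_real w \<noteq> 0" using w by simp
  from has_integral_linear[OF integral_slowness_exp[OF this x] bounded_linear_Re]
  have "((\<lambda>s. Re (exp (of_real w * of_real (\<theta> s)) / of_real (sqrt (\<gamma> s)))) has_integral
     Re ((exp (of_real w * of_real (\<theta> x)) - 1) / of_real w)) {0..x}"
    unfolding o_def .
  moreover have e: "exp (complex_of_real w * of_real t) = of_real (exp (w * t))" for t
    by (simp add: exp_of_real flip: of_real_mult)
  moreover have "Re ((complex_of_real p - 1) / of_real w) = (p - 1) / w" for p by simp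
  moreover have "Re (complex_of_real p / of_real q) = p / q" for p q by simp
  ultimately show ?thesis by (simp only:)
qed

text \<open>Reduction of order: a second solution has the form $\Psi w$ with $w' = 1/(\gamma\Psi^2)$. The constant of
  integration makes the flux of $\Psi w$ vanish at $0$.\<close>

definition wronskian_factor :: "complex \<Rightarrow> real \<Rightarrow> complex" where
  "wronskian_factor z x = - 1 / (flux z 0 * \<Psi> z 0) + integral {0..x} (\<lambda>s. 1 / (of_real (\<gamma> s) * (\<Psi> z s)\<^sup>2))"

text \<open>The solution with zero flux at $0$; it grows like $e^{-z\theta(x)}/z$.\<close>

definition \<Phi> :: "complex \<Rightarrow> real \<Rightarrow> complex" where
  "\<Phi> z x = \<Psi> z x * wronskian_factor z x"

text \<open>The flux $\gamma\Phi'$.\<close>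

definition \<Phi>_flux :: "complex \<Rightarrow> real \<Rightarrow> complex" where
  "\<Phi>_flux z x = flux z x * wronskian_factor z x + 1 / \<Psi> z x"

text \<open>Parameters in the sector for which the second solution is defined without division by zero.\<close>

definition admissible :: "complex \<Rightarrow> bool" where
  "admissible z \<longleftrightarrow> Re z < 0 \<and> norm z \<le> - 2 * Re z \<and> (\<forall>x\<in>{0..a}. \<Psi> z x \<noteq> 0 \<and> flux z x \<noteq> 0)"

lemma eventually_admissible: "\<forall>\<^sub>F z in sector. admissible z"
  using asymptotics[of "1/2", simplified] sector_Re_neg
proof eventually_elim
  case (elim z)
  show ?case unfolding admissible_def
  proof (intro conjI ballI)
    fix x assume x: "x \<in> {0..a}"
    have "norm (rem z x) \<le> 1/2" "norm (flux_rem z x) \<le> 1/2" using elim(1) x by auto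
    then have "g x \<noteq> 0" "1 + rem z x \<noteq> 0" "1 + flux_rem z x \<noteq> 0"
      using g_pos[OF x] norm_inverse_square_minus_one(3) by auto
    then show "\<Psi> z x \<noteq> 0" "flux z x \<noteq> 0" using elim(2) by (simp_all add: \<Psi>_eq[OF x] flux_eq[OF x])
  qed (use elim in auto)
qed

lemma continuous_on_wronskian_integrand:
  "admissible z \<Longrightarrow> continuous_on {0..a} (\<lambda>s. 1 / (of_real (\<gamma> s) * (\<Psi> z s)\<^sup>2))"
  unfolding admissible_def using pos_\<gamma>
  by (intro continuous_intros continuous_on_\<gamma> continuous_on_\<Psi>) force+

lemma \<Phi>_derivs:
  assumes z: "admissible z" and x: "x \<in> {0..a}"
  shows "(\<Phi> z has_vector_derivative \<Phi>_flux z x / of_real (\<gamma> x)) (at x within {0..a})"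
    and "(\<Phi>_flux z has_vector_derivative z\<^sup>2 * \<Phi> z x) (at x within {0..a})"
proof -
  have nz: "\<Psi> z x \<noteq> 0" "\<gamma> x \<noteq> 0" using z x pos_\<gamma>[OF x] unfolding admissible_def by auto
  have z0: "Re z \<le> 0" using z unfolding admissible_def by auto
  note d = flux_derivs[OF z0 x]
  have dJ: "(wronskian_factor z has_vector_derivative 1 / (of_real (\<gamma> x) * (\<Psi> z x)\<^sup>2)) (at x within {0..a})"
    unfolding wronskian_factor_def[abs_def]
    using integral_has_vector_derivative[OF continuous_on_wronskian_integrand[OF z] x]
    by (auto intro!: derivative_eq_intros)
  have "(\<Phi> z has_vector_derivative \<Psi> z x * (1 / (of_real (\<gamma> x) * (\<Psi> z x)\<^sup>2)) + flux z x / of_real (\<gamma> x) * wronskian_factor z x) (at x within {0..a})"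
    unfolding \<Phi>_def[abs_def] by (rule has_vector_derivative_mult[OF d(1) dJ])
  then show "(\<Phi> z has_vector_derivative \<Phi>_flux z x / of_real (\<gamma> x)) (at x within {0..a})"
    using nz by (simp add: \<Phi>_flux_def field_simps power2_eq_square)
  have di: "((\<lambda>x. 1 / \<Psi> z x) has_vector_derivative - (flux z x / of_real (\<gamma> x)) / (\<Psi> z x)\<^sup>2) (at x within {0..a})"
  proof -
    have 2: "((\<lambda>y. 1 / y) has_field_derivative - 1 / (\<Psi> z x)\<^sup>2) (at (\<Psi> z x) within \<Psi> z ` {0..a})"
      using nz by (auto intro!: derivative_eq_intros simp: power2_eq_square)
    from field_vector_diff_chain_within[OF d(1) 2] show ?thesis by (simp add: o_def)
  qed
  have "(\<Phi>_flux z has_vector_derivative (flux z x * (1 / (of_real (\<gamma> x) * (\<Psi> z x)\<^sup>2)) + z\<^sup>2 * \<Psi> z x * wronskian_factor z x)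
      + - (flux z x / of_real (\<gamma> x)) / (\<Psi> z x)\<^sup>2) (at x within {0..a})"
    unfolding \<Phi>_flux_def[abs_def]
    by (intro has_vector_derivative_add has_vector_derivative_mult[OF d(2) dJ] di)
  then show "(\<Phi>_flux z has_vector_derivative z\<^sup>2 * \<Phi> z x) (at x within {0..a})"
    by (simp add: \<Phi>_def mult.assoc)
qed

lemma \<Phi>_flux_0: "admissible z \<Longrightarrow> \<Phi>_flux z 0 = 0"
  using a by (simp add: \<Phi>_flux_def wronskian_factor_def admissible_def)

lemma \<Phi>_0: "admissible z \<Longrightarrow> \<Phi> z 0 = - 1 / flux z 0"
  using a by (simp add: \<Phi>_def wronskian_factor_def admissible_def)

lemma wronskian_integrand_eq:
  assumes x: "x \<in> {0..a}"
  shows "1 / (of_real (\<gamma> x) * (\<Psi> z x)\<^sup>2) = exp (- 2 * z * of_real (\<theta> x)) / of_real (sqrt (\<gamma> x)) * (1 / (1 + rem z x)\<^sup>2)"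
proof -
  have "(exp (z * of_real (\<theta> x)))\<^sup>2 = exp (2 * z * of_real (\<theta> x))"
    by (simp add: exp_double[symmetric] mult.assoc)
  then have sq: "(\<Psi> z x)\<^sup>2 = exp (2 * z * of_real (\<theta> x)) * (1 + rem z x)\<^sup>2 / of_real (g x ^ 2)"
    unfolding \<Psi>_eq[OF x] by (simp add: power_mult_distrib power_divide)
  have "of_real (\<gamma> x) * (\<Psi> z x)\<^sup>2 = of_real (\<gamma> x / sqrt (\<gamma> x)) * exp (2 * z * of_real (\<theta> x)) * (1 + rem z x)\<^sup>2"
    unfolding sq g_powers(3)[OF x] by simp
  also have "\<gamma> x / sqrt (\<gamma> x) = sqrt (\<gamma> x)" by (simp add: real_div_sqrt pos_\<gamma>[OF x] less_imp_le)
  finally show ?thesis by (simp add: exp_minus field_simps)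
qed

text \<open>Since $\theta' = \gamma^{-1/2}$, the weight $e^{-2\mathrm{Re}(z)\theta}\gamma^{-1/2}$ is integrated exactly, and one
  power of \<open>norm z\<close> is gained.\<close>

lemma norm_integral_wronskian_le:
  fixes f :: "real \<Rightarrow> complex"
  assumes z: "admissible z" and x: "x \<in> {0..a}"
    and f: "f integrable_on {0..x}"
    and b: "\<And>s. s \<in> {0..x} \<Longrightarrow> norm (f s) \<le> B * norm (exp (- 2 * z * of_real (\<theta> s)) / of_real (sqrt (\<gamma> s)))"
    and B: "0 \<le> B"
  shows "norm (integral {0..x} f) \<le> 2 * B * exp (- 2 * Re z * \<theta> x) / norm z"
proof -
  have s: "Re z < 0" "norm z \<le> - 2 * Re z" using z unfolding admissible_def by auto
  have nz: "norm z > 0" using s by auto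
  let ?w = "- 2 * Re z"
  have i: "((\<lambda>s. B * (exp (?w * \<theta> s) / sqrt (\<gamma> s))) has_integral B * ((exp (?w * \<theta> x) - 1) / ?w)) {0..x}"
    using integral_slowness_exp_real[of ?w x] s x by (intro has_integral_mult_right) auto
  have "norm (integral {0..x} f) \<le> integral {0..x} (\<lambda>s. B * (exp (?w * \<theta> s) / sqrt (\<gamma> s)))"
  proof (rule integral_norm_bound_integral[OF f])
    show "(\<lambda>s. B * (exp (?w * \<theta> s) / sqrt (\<gamma> s))) integrable_on {0..x}" using i by blast
    fix t assume t: "t \<in> {0..x}"
    have "norm (exp (- 2 * z * of_real (\<theta> t)) / of_real (sqrt (\<gamma> t))) = exp (?w * \<theta> t) / sqrt (\<gamma> t)"
      using pos_\<gamma>[of t] t x by (simp add: norm_divide less_imp_le)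
    then show "norm (f t) \<le> B * (exp (?w * \<theta> t) / sqrt (\<gamma> t))" using b[OF t] by simp
  qed
  also have "\<dots> = B * ((exp (?w * \<theta> x) - 1) / ?w)" using i by (rule integral_unique)
  also have "\<dots> \<le> B * (exp (?w * \<theta> x) / (norm z / 2))"
  proof (intro mult_left_mono frac_le B)
    show "norm z / 2 \<le> ?w" using s nz by linarith
  qed (use nz in auto)
  finally show ?thesis by (simp add: mult_ac)
qed

lemma tendsto_wronskian_factor_a:
  "((\<lambda>z. z * exp (2 * z * of_real (\<theta> a)) * wronskian_factor z a) \<longlongrightarrow> - 1 / 2) sector"
proof -
  let ?E = "\<lambda>z. exp (2 * z * of_real (\<theta> a))"
  have a0: "0 \<in> {0..a}" "a \<in> {0..a}" using a by auto
  have E0: "(?E \<longlongrightarrow> 0) sector"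
    using tendsto_exp_sector[of "2 * \<theta> a"] \<theta>_a_pos by (simp add: mult.assoc mult.left_commute)
  have g0: "g 0 > 0" using g_pos[OF a0(1)] .
  have "((\<lambda>z. - (?E z * (1 / ((flux z 0 / (z * exp (z * of_real (\<theta> 0)))) * (\<Psi> z 0 / exp (z * of_real (\<theta> 0)))))))
       \<longlongrightarrow> - (0 * (1 / (of_real (g 0) * (1 / of_real (g 0)))))) sector"
    using g0 by (intro tendsto_intros E0 tendsto_\<Psi> a0) auto
  then have "((\<lambda>z. z * ?E z * (- 1 / (flux z 0 * \<Psi> z 0))) \<longlongrightarrow> - (0 * (1 / (of_real (g 0) * (1 / of_real (g 0)))))) sector"
  proof (rule Lim_transform_eventually)
    show "\<forall>\<^sub>F z in sector. - (?E z * (1 / ((flux z 0 / (z * exp (z * of_real (\<theta> 0)))) * (\<Psi> z 0 / exp (z * of_real (\<theta> 0))))))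
       = z * ?E z * (- 1 / (flux z 0 * \<Psi> z 0))"
      by (intro always_eventually allI) simp
  qed
  then have 1: "((\<lambda>z. z * ?E z * (- 1 / (flux z 0 * \<Psi> z 0))) \<longlongrightarrow> 0) sector" by simp
  have 2: "((\<lambda>z. z * ?E z * integral {0..a} (\<lambda>s. 1 / (of_real (\<gamma> s) * (\<Psi> z s)\<^sup>2)) - (?E z - 1) / 2) \<longlongrightarrow> 0) sector"
  proof (rule tendstoI)
    fix \<epsilon> :: real assume "0 < \<epsilon>"
    \<comment> \<open>A relative error \<open>\<delta>\<close> of $\Psi$ changes the normalized integral by at most \<open>20 * \<delta>\<close>.\<close>
    define \<delta> where "\<delta> = min (1/2) (\<epsilon> / 40)"
    have \<delta>: "0 < \<delta>" "\<delta> \<le> 1/2" "40 * \<delta> \<le> \<epsilon>" using \<open>0 < \<epsilon>\<close> by (auto simp: \<delta>_def)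
    show "\<forall>\<^sub>F z in sector. dist (z * ?E z * integral {0..a} (\<lambda>s. 1 / (of_real (\<gamma> s) * (\<Psi> z s)\<^sup>2)) - (?E z - 1) / 2) 0 < \<epsilon>"
      using asymptotics[OF \<delta>(1)] eventually_admissible
    proof eventually_elim
      case (elim z)
      let ?f = "\<lambda>s. 1 / (of_real (\<gamma> s) * (\<Psi> z s)\<^sup>2)"
      let ?h = "\<lambda>s. exp (- 2 * z * of_real (\<theta> s)) / complex_of_real (sqrt (\<gamma> s))"
      have nz: "z \<noteq> 0" "Re z < 0" using elim(2) unfolding admissible_def by auto
      have if': "?f integrable_on {0..a}"
        by (rule integrable_continuous_real[OF continuous_on_wronskian_integrand[OF elim(2)]])
      have ih: "(?h has_integral (exp (- 2 * z * of_real (\<theta> a)) - 1) / (- 2 * z)) {0..a}"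
        using integral_slowness_exp[of "- 2 * z" a] nz a by simp
      then have ih': "?h integrable_on {0..a}" by blast
      have b: "norm (?f s - ?h s) \<le> 10 * \<delta> * norm (?h s)" if s: "s \<in> {0..a}" for s
      proof -
        have e: "norm (rem z s) \<le> \<delta>" using elim(1) s by auto
        have "?f s - ?h s = ?h s * (1 / (1 + rem z s)\<^sup>2 - 1)"
          unfolding wronskian_integrand_eq[OF s] by (simp only: right_diff_distrib mult_1_right)
        then have "norm (?f s - ?h s) = norm (?h s) * norm (1 / (1 + rem z s)\<^sup>2 - 1)"
          by (simp only: norm_mult)
        also have "\<dots> \<le> norm (?h s) * (10 * \<delta>)"
          using norm_inverse_square_minus_one(1)[of "rem z s"] e \<delta>(2) by (intro mult_left_mono) auto
        finally show ?thesis by (simp only: mult.commute)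
      qed
      have "norm (integral {0..a} (\<lambda>s. ?f s - ?h s)) \<le> 2 * (10 * \<delta>) * exp (- 2 * Re z * \<theta> a) / norm z"
      proof (rule norm_integral_wronskian_le[OF elim(2) a0(2)])
        show "(\<lambda>s. ?f s - ?h s) integrable_on {0..a}"
          by (rule Henstock_Kurzweil_Integration.integrable_diff[OF if' ih'])
        show "norm (?f s - ?h s) \<le> 10 * \<delta> * norm (?h s)" if "s \<in> {0..a}" for s
          by (rule b[OF that])
      qed (use \<delta> in simp)
      then have err: "norm (integral {0..a} ?f - integral {0..a} ?h) \<le> 20 * \<delta> * exp (- 2 * Re z * \<theta> a) / norm z"
        unfolding Henstock_Kurzweil_Integration.integral_diff[OF if' ih'] by simp
      have "z * ?E z * integral {0..a} ?h = (?E z - 1) / 2"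
      proof -
        have "?E z * exp (- 2 * z * of_real (\<theta> a)) = 1" by (simp add: exp_add[symmetric])
        then have "- (?E z * (exp (- 2 * z * of_real (\<theta> a)) - 1)) / 2 = (?E z - 1) / 2"
          by (simp only: right_diff_distrib) simp
        moreover have "z * q * ((p - 1) / (- 2 * z)) = - (q * (p - 1)) / 2" for p q
          using nz(1) by simp
        ultimately show ?thesis unfolding integral_unique[OF ih] by (simp only:)
      qed
      then have eq: "z * ?E z * integral {0..a} ?f - (?E z - 1) / 2 = z * ?E z * (integral {0..a} ?f - integral {0..a} ?h)"
        by (simp only: right_diff_distrib)
      have "norm (z * ?E z * integral {0..a} ?f - (?E z - 1) / 2)
          = norm z * exp (2 * Re z * \<theta> a) * norm (integral {0..a} ?f - integral {0..a} ?h)"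
      proof -
        have "norm (?E z) = exp (2 * Re z * \<theta> a)" by simp
        then show ?thesis unfolding eq by (simp only: norm_mult)
      qed
      also have "\<dots> \<le> norm z * exp (2 * Re z * \<theta> a) * (20 * \<delta> * exp (- 2 * Re z * \<theta> a) / norm z)"
        by (intro mult_left_mono err) auto
      also have "\<dots> = 20 * \<delta> * (exp (2 * Re z * \<theta> a) * exp (- 2 * Re z * \<theta> a))"
      proof -
        have "norm z * p * (20 * \<delta> * q / norm z) = 20 * \<delta> * (p * q)" for p q using nz(1) by simp
        then show ?thesis .
      qed
      also have "exp (2 * Re z * \<theta> a) * exp (- 2 * Re z * \<theta> a) = 1" by (simp add: exp_add[symmetric])
      also have "20 * \<delta> * 1 < \<epsilon>" using \<delta> by simp
      finally show ?case by (simp only: dist_0_norm dist_norm diff_zero)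
    qed
  qed
  have "((\<lambda>z. z * ?E z * (- 1 / (flux z 0 * \<Psi> z 0)) +
     ((z * ?E z * integral {0..a} (\<lambda>s. 1 / (of_real (\<gamma> s) * (\<Psi> z s)\<^sup>2)) - (?E z - 1) / 2) + (?E z - 1) / 2)) \<longlongrightarrow> 0 + (0 + (0 - 1) / 2)) sector"
    by (intro tendsto_intros 1 2 E0) auto
  then show ?thesis unfolding wronskian_factor_def distrib_left by simp
qed

lemma bounded_\<Psi>_\<Phi>:
  "\<exists>C>0. \<forall>\<^sub>F z in sector. \<forall>x\<in>{0..a}. norm (\<Psi> z x) \<le> C \<and> norm (z * exp (2 * z * of_real (\<theta> a)) * \<Phi> z x) \<le> C"
proof -
  have "continuous_on {0..a} (\<lambda>x. 1 / g x)"
    using g_pos by (intro continuous_intros continuous_on_g) force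
  then have "bounded ((\<lambda>x. 1 / g x) ` {0..a})"
    using compact_continuous_image compact_imp_bounded by blast
  then obtain C where C: "C > 0" "\<And>x. x \<in> {0..a} \<Longrightarrow> norm (1 / g x) \<le> C"
    unfolding bounded_pos by (metis imageI)
  have a0: "0 \<in> {0..a}" "a \<in> {0..a}" using a by auto
  have g0: "g 0 > 0" using g_pos[OF a0(1)] .
  have "((\<lambda>z. 1 / ((flux z 0 / (z * exp (z * of_real (\<theta> 0)))) * (\<Psi> z 0 / exp (z * of_real (\<theta> 0)))))
       \<longlongrightarrow> 1 / (of_real (g 0) * (1 / of_real (g 0)))) sector"
    using g0 by (intro tendsto_intros tendsto_\<Psi> a0) auto
  then have "((\<lambda>z. norm (1 / ((flux z 0 / (z * exp (z * of_real (\<theta> 0)))) * (\<Psi> z 0 / exp (z * of_real (\<theta> 0))))))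
       \<longlongrightarrow> norm (1 / (of_real (g 0) * (1 / of_real (g 0))) :: complex)) sector" by (rule tendsto_norm)
  then have "\<forall>\<^sub>F z in sector. norm (1 / ((flux z 0 / (z * exp (z * of_real (\<theta> 0)))) * (\<Psi> z 0 / exp (z * of_real (\<theta> 0))))) < 2"
    using g0 by (intro order_tendstoD(2)) auto
  then have alpha: "\<forall>\<^sub>F z in sector. norm z * norm (1 / (flux z 0 * \<Psi> z 0)) < 2"
    by eventually_elim (simp add: norm_mult norm_divide)
  have "\<forall>\<^sub>F z in sector. \<forall>x\<in>{0..a}. norm (\<Psi> z x) \<le> 20 * C \<and> norm (z * exp (2 * z * of_real (\<theta> a)) * \<Phi> z x) \<le> 20 * C"
    using asymptotics[of "1/2", simplified] eventually_admissible alpha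
  proof eventually_elim
    case (elim z)
    have nz: "z \<noteq> 0" "Re z < 0" using elim(2) unfolding admissible_def by auto
    show ?case
    proof
      fix x assume x: "x \<in> {0..a}"
      let ?r = "- Re z"
      have \<Psi>x: "norm (\<Psi> z x) \<le> 2 * C * exp (- ?r * \<theta> x)"
      proof -
        have e: "norm (rem z x) \<le> 1/2" using elim(1) x by auto
        have "norm (\<Psi> z x) = exp (- ?r * \<theta> x) * norm (1 + rem z x) * norm (1 / g x)"
          unfolding \<Psi>_eq[OF x] by (simp add: norm_mult norm_divide)
        also have "\<dots> \<le> exp (- ?r * \<theta> x) * 2 * C"
          using norm_triangle_ineq[of 1 "rem z x"] e C(1) by (intro mult_mono C(2)[OF x]) auto
        finally show ?thesis by (simp add: mult_ac)
      qed
      let ?f = "\<lambda>s. 1 / (of_real (\<gamma> s) * (\<Psi> z s)\<^sup>2)"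
      have "norm (integral {0..x} ?f) \<le> 2 * 4 * exp (- 2 * Re z * \<theta> x) / norm z"
      proof (rule norm_integral_wronskian_le[OF elim(2) x])
        show "?f integrable_on {0..x}"
          by (rule integrable_continuous_real, rule continuous_on_subset[OF continuous_on_wronskian_integrand[OF elim(2)]])
             (use x in auto)
        fix s assume "s \<in> {0..x}"
        then have s: "s \<in> {0..a}" using x by auto
        have e: "norm (rem z s) \<le> 1/2" using elim(1) s by auto
        have "norm (?f s) = norm (exp (- 2 * z * of_real (\<theta> s)) / complex_of_real (sqrt (\<gamma> s))) * norm (1 / (1 + rem z s)\<^sup>2)"
          unfolding wronskian_integrand_eq[OF s] by (simp only: norm_mult)
        also have "\<dots> \<le> norm (exp (- 2 * z * of_real (\<theta> s)) / complex_of_real (sqrt (\<gamma> s))) * 4"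
          by (intro mult_left_mono norm_inverse_square_minus_one(2) e) auto
        finally show "norm (?f s) \<le> 4 * norm (exp (- 2 * z * of_real (\<theta> s)) / of_real (sqrt (\<gamma> s)))"
          by (simp only: mult.commute)
      qed simp
      then have "norm z * norm (integral {0..x} ?f) \<le> 8 * exp (2 * ?r * \<theta> x)"
        using nz by (simp add: field_simps)
      moreover have "norm z * norm (- 1 / (flux z 0 * \<Psi> z 0)) \<le> 2 * exp (2 * ?r * \<theta> x)"
      proof -
        have "1 \<le> exp (2 * ?r * \<theta> x)" using nz \<theta>_nonneg[OF x] by (auto simp: mult_nonpos_nonneg)
        then have l: "2 * 1 \<le> 2 * exp (2 * ?r * \<theta> x)" by (intro mult_left_mono) auto
        have m: "norm (- 1 / (flux z 0 * \<Psi> z 0)) = norm (1 / (flux z 0 * \<Psi> z 0))" by (simp only: norm_divide norm_minus_cancel)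
        show ?thesis unfolding m using elim(3) l by linarith
      qed
      moreover have "norm z * norm (wronskian_factor z x) \<le> norm z * (norm (- 1 / (flux z 0 * \<Psi> z 0)) + norm (integral {0..x} ?f))"
        unfolding wronskian_factor_def by (intro mult_left_mono norm_triangle_ineq) auto
      ultimately have J: "norm z * norm (wronskian_factor z x) \<le> 10 * exp (2 * ?r * \<theta> x)"
        by (simp add: distrib_left)
      have "norm (z * exp (2 * z * of_real (\<theta> a)) * \<Phi> z x) = exp (- 2 * ?r * \<theta> a) * (norm (\<Psi> z x) * (norm z * norm (wronskian_factor z x)))"
        by (simp add: \<Phi>_def norm_mult mult_ac)
      also have "\<dots> \<le> exp (- 2 * ?r * \<theta> a) * ((2 * C * exp (- ?r * \<theta> x)) * (10 * exp (2 * ?r * \<theta> x)))"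
        using C(1) by (intro mult_left_mono mult_mono \<Psi>x J) auto
      also have "\<dots> = 20 * C * exp (- 2 * ?r * \<theta> a + - ?r * \<theta> x + 2 * ?r * \<theta> x)"
      proof -
        have "p * ((2 * C * q) * (10 * r)) = 20 * C * (p * q * r)" for p q r by simp
        then show ?thesis unfolding exp_add .
      qed
      also have "\<dots> \<le> 20 * C * 1"
      proof (intro mult_left_mono)
        have "?r * \<theta> x \<le> ?r * \<theta> a" "0 \<le> ?r * \<theta> a" using nz \<theta>_mono[of x a] \<theta>_a_pos x
          by (auto intro: mult_left_mono_neg simp: mult_nonpos_nonneg)
        then show "exp (- 2 * ?r * \<theta> a + - ?r * \<theta> x + 2 * ?r * \<theta> x) \<le> 1" by simp
      qed (use C in auto)
      finally have 2: "norm (z * exp (2 * z * of_real (\<theta> a)) * \<Phi> z x) \<le> 20 * C" by simp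
      have "exp (- ?r * \<theta> x) \<le> 1" using nz \<theta>_nonneg[OF x] by (auto simp: mult_nonpos_nonneg)
      then have "2 * C * exp (- ?r * \<theta> x) \<le> 20 * C * 1" using C(1) by (intro mult_mono) auto
      then show "norm (\<Psi> z x) \<le> 20 * C \<and> norm (z * exp (2 * z * of_real (\<theta> a)) * \<Phi> z x) \<le> 20 * C"
        using 2 \<Psi>x by simp
    qed
  qed
  then show ?thesis using C(1) by (intro exI[of _ "20 * C"]) simp
qed

text \<open>The Robin boundary operator at \<open>a\<close>, applied to both solutions. In the operator on $\Phi$ the two
  contributions have the leading coefficients $-1/2$ and $1$ of the same exponential, so it does not degenerate.\<close>

lemma tendsto_boundary_ratio:
  fixes \<rho> :: real
  defines "B \<equiv> \<lambda>z. flux z a + of_real \<rho> * \<Psi> z a" and "B\<Phi> \<equiv> \<lambda>z. \<Phi>_flux z a + of_real \<rho> * \<Phi> z a"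
  shows "((\<lambda>z. B z / B\<Phi> z / (z * exp (2 * z * of_real (\<theta> a)))) \<longlongrightarrow> 2) sector"
    and "\<forall>\<^sub>F z in sector. B\<Phi> z \<noteq> 0"
    and "((\<lambda>z. of_real (\<gamma> 0) * \<Phi> z 0 * (B z / B\<Phi> z) / exp (2 * z * of_real (\<theta> a))) \<longlongrightarrow> of_real (- 2 * g 0 ^ 3)) sector"
proof -
  have a0: "0 \<in> {0..a}" "a \<in> {0..a}" using a by auto
  let ?e = "\<lambda>z. exp (z * of_real (\<theta> a))"
  have e2: "exp (2 * z * of_real (\<theta> a)) = ?e z * ?e z" for z :: complex
    by (simp add: exp_double mult.assoc power2_eq_square)
  have ga: "g a > 0" "g 0 > 0" using g_pos a0 by auto
  have invz: "((\<lambda>z::complex. 1 / z) \<longlongrightarrow> 0) sector"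
    unfolding sector_def inverse_eq_divide[symmetric]
    by (rule tendsto_mono[OF _ tendsto_inverse_0]) simp
  have "((\<lambda>z. flux z a / (z * ?e z) + of_real \<rho> * (\<Psi> z a / ?e z) * (1 / z)) \<longlongrightarrow> of_real (g a) + of_real \<rho> * (1 / of_real (g a)) * 0) sector"
    by (intro tendsto_intros tendsto_\<Psi> a0 invz)
  then have B: "((\<lambda>z. B z / (z * ?e z)) \<longlongrightarrow> of_real (g a)) sector"
    by (simp add: B_def add_divide_distrib mult.commute)
  have B\<Phi>_eq: "B\<Phi> z = B z * wronskian_factor z a + 1 / \<Psi> z a" for z
    by (simp add: B_def B\<Phi>_def \<Phi>_def \<Phi>_flux_def algebra_simps)
  have "((\<lambda>z. (B z / (z * ?e z)) * (z * exp (2 * z * of_real (\<theta> a)) * wronskian_factor z a) + 1 / (\<Psi> z a / ?e z))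
     \<longlongrightarrow> of_real (g a) * (- 1 / 2) + 1 / (1 / of_real (g a))) sector"
    using ga by (intro tendsto_intros B tendsto_wronskian_factor_a tendsto_\<Psi> a0) auto
  then have "((\<lambda>z. ?e z * B\<Phi> z) \<longlongrightarrow> of_real (g a) * (- 1 / 2) + 1 / (1 / of_real (g a))) sector"
  proof (rule Lim_transform_eventually)
    show "\<forall>\<^sub>F z in sector. (B z / (z * ?e z)) * (z * exp (2 * z * of_real (\<theta> a)) * wronskian_factor z a) + 1 / (\<Psi> z a / ?e z) = ?e z * B\<Phi> z"
      using sector_Re_neg
    proof eventually_elim
      case (elim z)
      have "(b / (z * q)) * (z * (q * q) * w) + 1 / (y / q) = q * (b * w + 1 / y)" if "q \<noteq> 0" for b q w y
        using elim that by (simp add: distrib_left)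
      then show ?case unfolding B\<Phi>_eq e2 by simp
    qed
  qed
  then have B\<Phi>: "((\<lambda>z. ?e z * B\<Phi> z) \<longlongrightarrow> of_real (g a) / 2) sector" by simp
  have "\<forall>\<^sub>F z in sector. ?e z * B\<Phi> z \<noteq> 0"
    using ga by (intro tendsto_imp_eventually_ne[OF B\<Phi>]) auto
  then show "\<forall>\<^sub>F z in sector. B\<Phi> z \<noteq> 0" by eventually_elim auto
  have lim: "((\<lambda>z. (B z / (z * ?e z)) / (?e z * B\<Phi> z)) \<longlongrightarrow> of_real (g a) / (of_real (g a) / 2)) sector"
    using ga by (intro tendsto_intros B B\<Phi>) auto
  show ratio: "((\<lambda>z. B z / B\<Phi> z / (z * exp (2 * z * of_real (\<theta> a)))) \<longlongrightarrow> 2) sector"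
  proof -
    have "b / c / (z * (q * q)) = (b / (z * q)) / (q * c)" for b c z q :: complex by simp
    moreover have "of_real (g a) / (of_real (g a) / 2) = (2::complex)" using ga by simp
    ultimately show ?thesis using lim unfolding e2 by (simp only:)
  qed
  have "((\<lambda>z. of_real (\<gamma> 0) * (- 1 / (flux z 0 / (z * exp (z * of_real (\<theta> 0))))) * (B z / B\<Phi> z / (z * exp (2 * z * of_real (\<theta> a)))))
     \<longlongrightarrow> of_real (\<gamma> 0) * (- 1 / of_real (g 0)) * 2) sector"
    using ga by (intro tendsto_intros tendsto_\<Psi> a0 ratio) auto
  moreover have "\<forall>\<^sub>F z in sector. of_real (\<gamma> 0) * (- 1 / (flux z 0 / (z * exp (z * of_real (\<theta> 0))))) * (B z / B\<Phi> z / (z * exp (2 * z * of_real (\<theta> a))))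
     = of_real (\<gamma> 0) * \<Phi> z 0 * (B z / B\<Phi> z) / exp (2 * z * of_real (\<theta> a))"
    using eventually_admissible sector_Re_neg by eventually_elim (simp add: \<Phi>_0)
  ultimately have "((\<lambda>z. of_real (\<gamma> 0) * \<Phi> z 0 * (B z / B\<Phi> z) / exp (2 * z * of_real (\<theta> a)))
    \<longlongrightarrow> of_real (\<gamma> 0) * (- 1 / of_real (g 0)) * 2) sector"
    by (rule Lim_transform_eventually)
  moreover have "of_real (\<gamma> 0) * (- 1 / of_real (g 0)) * 2 = complex_of_real (- 2 * g 0 ^ 3)"
    using g_powers(4)[OF a0(1)] ga by (simp add: eval_nat_numeral)
  ultimately show "((\<lambda>z. of_real (\<gamma> 0) * \<Phi> z 0 * (B z / B\<Phi> z) / exp (2 * z * of_real (\<theta> a))) \<longlongrightarrow> of_real (- 2 * g 0 ^ 3)) sector"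
    by simp
qed

end

section \<open>Asymptotics of the indicator function\<close>

text \<open>The identity for $\Psi$ expresses the indicator function by the transform of the boundary value at \<open>a\<close>,
  and the identity for $\Phi$, in which the boundary value at \<open>0\<close> is absent, expresses the latter by the
  transform of the flux datum. The factor \<open>D\<close> of that transform is of exact order
  $e^{2z\theta(a)}$; the remainder carries the small factor $e^{-z^2T}$.\<close>

lemma indicator_representation:
  assumes hf: "heat_flow \<gamma> \<rho> a T u ux0 F U" and md: "medium \<gamma> a M \<Psi>"
  shows "\<exists>D X d C. d \<noteq> 0 \<and> 0 < C \<and>
     ((\<lambda>z. D z / exp (2 * z * of_real (travel_time \<gamma> a))) \<longlongrightarrow> d) sector \<and>
     (\<forall>\<^sub>F z in sector. norm (X z) \<le> C \<and>
        heat_indicator \<gamma> M a T \<Psi> u ux0 z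
        = D z * (LINT t|lebesgue_on {0<..<T}. exp (- z\<^sup>2 * of_real t) * of_real (ux0 t)) + X z * exp (- z\<^sup>2 * of_real T))"
proof -
  interpret heat_flow \<gamma> \<rho> a T u ux0 F U by (rule hf)
  interpret medium \<gamma> a M \<Psi> by (rule md)
  let ?E = "\<lambda>z. exp (2 * z * of_real (travel_time \<gamma> a))"
  define B where "B z = flux z a + of_real \<rho> * \<Psi> z a" for z
  define B\<Phi> where "B\<Phi> z = \<Phi>_flux z a + of_real \<rho> * \<Phi> z a" for z
  define D where "D z = of_real (\<gamma> 0) * \<Phi> z 0 * (B z / B\<Phi> z)" for z
  define X where "X z = B z / B\<Phi> z * cpairing (\<Phi> z) - cpairing (\<Psi> z)" for z
  note br = tendsto_boundary_ratio[of \<rho>, folded B_def B\<Phi>_def]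
  have limD: "((\<lambda>z. D z / ?E z) \<longlongrightarrow> of_real (- 2 * g 0 ^ 3)) sector"
    unfolding D_def by (rule br(3))
  have d: "complex_of_real (- 2 * g 0 ^ 3) \<noteq> 0" using g_pos[of 0] a by auto
  have rep: "\<forall>\<^sub>F z in sector. heat_indicator \<gamma> M a T \<Psi> u ux0 z
        = D z * (LINT t|lebesgue_on {0<..<T}. exp (- z\<^sup>2 * of_real t) * of_real (ux0 t)) + X z * exp (- z\<^sup>2 * of_real T)"
    using eventually_admissible br(2)
  proof eventually_elim
    case (elim z)
    have z0: "Re z \<le> 0" using elim(1) unfolding admissible_def by auto
    let ?A = "laplace (z\<^sup>2) (\<lambda>t. point_value a (u t) a)"
    let ?P = "laplace (z\<^sup>2) (\<lambda>t. point_value a (u t) 0)"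
    let ?G = "laplace (z\<^sup>2) ux0"
    let ?e = "exp (- z\<^sup>2 * complex_of_real T)"
    have 1: "flux z 0 * ?P - B z * ?A - of_real (\<gamma> 0) * \<Psi> z 0 * ?G = ?e * cpairing (\<Psi> z)"
      unfolding B_def by (rule laplace_equation[OF flux_derivs[OF z0]])
    have 2: "0 - B\<Phi> z * ?A - of_real (\<gamma> 0) * \<Phi> z 0 * ?G = ?e * cpairing (\<Phi> z)"
      using laplace_equation[OF \<Phi>_derivs[OF elim(1)]] unfolding B\<Phi>_def \<Phi>_flux_0[OF elim(1)] by simp
    have G: "?G = (LINT t|lebesgue_on {0<..<T}. exp (- z\<^sup>2 * of_real t) * of_real (ux0 t))"
      unfolding laplace_def by (intro Bochner_Integration.integral_cong) (auto simp: scaleR_conv_of_real mult.commute)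
    have M0: "0 < M" "0 \<in> {0..M}" using a aM by auto
    have dv: "deriv_on M (\<lambda>x. exp (- z\<^sup>2 * complex_of_real t) * \<Psi> z x) 0 = exp (- z\<^sup>2 * complex_of_real t) * deriv_on M (\<Psi> z) 0" for t
    proof (rule vector_derivative_within_closed_interval[OF M0])
      have "(\<Psi> z has_vector_derivative deriv_on M (\<Psi> z) 0) (at 0 within {0..M})"
        using family z0 M0 unfolding special_family_def by (simp add: vector_derivative_works)
      then show "((\<lambda>x. exp (- z\<^sup>2 * complex_of_real t) * \<Psi> z x) has_vector_derivative
          exp (- z\<^sup>2 * complex_of_real t) * deriv_on M (\<Psi> z) 0) (at 0 within {0..M})"
        by (rule has_vector_derivative_mult_right)
    qed
    have "heat_indicator \<gamma> M a T \<Psi> u ux0 z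
      = (LINT t|lebesgue_on {0<..<T}. (- flux z 0) * (point_value a (u t) 0 *\<^sub>R exp (- z\<^sup>2 * of_real t))
          + (of_real (\<gamma> 0) * \<Psi> z 0) * (ux0 t *\<^sub>R exp (- z\<^sup>2 * of_real t)))"
      unfolding heat_indicator_def Let_def dv
      by (intro Bochner_Integration.integral_cong) (auto simp: scaleR_conv_of_real flux_def mult_ac)
    also have "\<dots> = (- flux z 0) * ?P + (of_real (\<gamma> 0) * \<Psi> z 0) * ?G"
      unfolding laplace_def
        Bochner_Integration.integral_add[OF integrable_mult_right[OF integrable_laplace[OF integrable_point_value(1)]]
          integrable_mult_right[OF integrable_laplace[OF integrable_ux0]]]
        integral_mult_right_zero by (rule refl)
    finally have I: "heat_indicator \<gamma> M a T \<Psi> u ux0 z = (- flux z 0) * ?P + (of_real (\<gamma> 0) * \<Psi> z 0) * ?G" .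
    have A: "?A = - (of_real (\<gamma> 0) * \<Phi> z 0 * ?G + ?e * cpairing (\<Phi> z)) / B\<Phi> z"
    proof -
      have "x = - (y + w)" if "0 - x - y = w" for x y w :: complex
        unfolding that[symmetric] by simp
      from this[OF 2] show ?thesis using elim(2) by (simp add: nonzero_eq_divide_eq mult.commute)
    qed
    have "heat_indicator \<gamma> M a T \<Psi> u ux0 z = - B z * ?A - ?e * cpairing (\<Psi> z)"
      unfolding I 1[symmetric] by (simp add: algebra_simps)
    also have "\<dots> = D z * ?G + X z * ?e"
      unfolding A D_def X_def by (simp add: algebra_simps add_divide_distrib diff_divide_distrib)
    finally show ?case unfolding G .
  qed
  obtain C where C: "C > 0" and bC: "\<forall>\<^sub>F z in sector. \<forall>x\<in>{0..a}. norm (\<Psi> z x) \<le> C \<and> norm (z * ?E z * \<Phi> z x) \<le> C"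
    using bounded_\<Psi>_\<Phi> by blast
  obtain CU where CU: "CU \<ge> 0" "\<And>\<phi> K. continuous_on {0..a} \<phi> \<Longrightarrow> (\<forall>x\<in>{0..a}. norm (\<phi> x) \<le> K) \<Longrightarrow> norm (cpairing \<phi>) \<le> CU * K"
    using cpairing_bound by blast
  have "\<forall>\<^sub>F z in sector. norm (B z / B\<Phi> z / (z * ?E z)) < 3"
    using tendsto_norm[OF br(1)] by (rule order_tendstoD(2)) simp
  with eventually_admissible bC sector_Re_neg have bX: "\<forall>\<^sub>F z in sector. norm (X z) \<le> 4 * CU * C"
  proof eventually_elim
    case (elim z)
    have z0: "Re z \<le> 0" "z \<noteq> 0" using elim by auto
    have c: "continuous_on {0..a} (\<Psi> z)" by (rule continuous_on_\<Psi>[OF z0(1)])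
    have c2: "continuous_on {0..a} (\<Phi> z)"
      using \<Phi>_derivs(1)[OF elim(1)] has_vector_derivative_continuous by (metis continuous_on_eq_continuous_within)
    have nE: "norm (z * ?E z) > 0" using z0 by simp
    have "norm (cpairing (\<Psi> z)) \<le> CU * C" using elim(2) by (intro CU(2) c) auto
    moreover have "norm (cpairing (\<Phi> z)) \<le> CU * (C / norm (z * ?E z))"
    proof (intro CU(2) c2 ballI)
      fix x assume "x \<in> {0..a}"
      then have "norm (z * ?E z) * norm (\<Phi> z x) \<le> C" using elim(2) by (simp add: norm_mult)
      then show "norm (\<Phi> z x) \<le> C / norm (z * ?E z)" using nE by (simp only: pos_le_divide_eq mult.commute)
    qed
    moreover have "norm (B z / B\<Phi> z) \<le> 3 * norm (z * ?E z)"
    proof -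
      have "norm (B z / B\<Phi> z) / norm (z * ?E z) \<le> 3" using elim(4) by (simp only: norm_divide less_imp_le)
      then show ?thesis using nE by (simp only: pos_divide_le_eq)
    qed
    ultimately have "norm (B z / B\<Phi> z) * norm (cpairing (\<Phi> z)) \<le> 3 * norm (z * ?E z) * (CU * (C / norm (z * ?E z)))"
      by (intro mult_mono) auto
    also have "\<dots> = 3 * CU * C" using nE by simp
    finally have "norm (B z / B\<Phi> z * cpairing (\<Phi> z)) \<le> 3 * CU * C" by (simp only: norm_mult)
    with \<open>norm (cpairing (\<Psi> z)) \<le> CU * C\<close> show ?case
      using norm_triangle_ineq4[of "B z / B\<Phi> z * cpairing (\<Phi> z)" "cpairing (\<Psi> z)"] unfolding X_def by linarith
  qed
  have "\<forall>\<^sub>F z in sector. norm (X z) \<le> 4 * CU * C + 1 \<and> heat_indicator \<gamma> M a T \<Psi> u ux0 z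
        = D z * (LINT t|lebesgue_on {0<..<T}. exp (- z\<^sup>2 * of_real t) * of_real (ux0 t)) + X z * exp (- z\<^sup>2 * of_real T)"
    using bX rep by eventually_elim simp
  moreover have "0 < 4 * CU * C + 1" using CU(1) C by (simp add: add_nonneg_pos)
  ultimately show ?thesis using limD d by blast
qed

lemma tendsto_log_over_parameter:
  fixes N :: "real \<Rightarrow> real"
  assumes c: "0 < c" and lower: "\<forall>\<^sub>F \<tau> in at_top. c * \<tau> powr \<mu> \<le> N \<tau> * exp (b * \<tau>)"
    and upper: "\<forall>\<^sub>F \<tau> in at_top. N \<tau> * exp (b * \<tau>) \<le> K"
  shows "((\<lambda>\<tau>. ln (N \<tau>) / \<tau>) \<longlongrightarrow> - b) at_top"
proof -
  have l: "((\<lambda>\<tau>::real. (ln c + \<mu> * ln \<tau>) / \<tau> - b) \<longlongrightarrow> 0 - b) at_top"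
    by (intro tendsto_diff tendsto_const) real_asymp
  have u: "((\<lambda>\<tau>::real. ln K / \<tau> - b) \<longlongrightarrow> 0 - b) at_top"
    by (intro tendsto_diff tendsto_const) real_asymp
  have both: "\<forall>\<^sub>F \<tau> in at_top. (ln c + \<mu> * ln \<tau>) / \<tau> - b \<le> ln (N \<tau>) / \<tau> \<and> ln (N \<tau>) / \<tau> \<le> ln K / \<tau> - b"
    using lower upper eventually_gt_at_top[of 0]
  proof eventually_elim
    case (elim \<tau>)
    have pos: "0 < c * \<tau> powr \<mu>" using c elim by simp
    then have NP: "0 < N \<tau> * exp (b * \<tau>)" using elim by linarith
    then have N: "0 < N \<tau>" by (simp add: zero_less_mult_iff)
    have e: "ln (N \<tau> * exp (b * \<tau>)) = ln (N \<tau>) + b * \<tau>" using N by (simp add: ln_mult)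
    have "ln c + \<mu> * ln \<tau> = ln (c * \<tau> powr \<mu>)" using c elim by (simp add: ln_mult ln_powr)
    also have "\<dots> \<le> ln (N \<tau>) + b * \<tau>" unfolding e[symmetric] using elim pos NP by (intro ln_mono) auto
    finally have 1: "ln c + \<mu> * ln \<tau> - b * \<tau> \<le> ln (N \<tau>)" by simp
    have "ln (N \<tau>) + b * \<tau> \<le> ln K" unfolding e[symmetric] using elim NP by (intro ln_mono) auto
    then have 2: "ln (N \<tau>) \<le> ln K - b * \<tau>" by simp
    have "(ln c + \<mu> * ln \<tau> - b * \<tau>) / \<tau> \<le> ln (N \<tau>) / \<tau>" "ln (N \<tau>) / \<tau> \<le> (ln K - b * \<tau>) / \<tau>"
      using elim 1 2 by (intro divide_right_mono; simp)+
    then show ?case using elim by (simp add: diff_divide_distrib)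
  qed
  have "((\<lambda>\<tau>. ln (N \<tau>) / \<tau>) \<longlongrightarrow> 0 - b) at_top"
    by (rule tendsto_sandwich[OF _ _ l u]) (use both in \<open>auto elim: eventually_mono\<close>)
  then show ?thesis by simp
qed

text \<open>The limit along an arbitrary curve in the sector whose real part is linear in the parameter. The
  condition \<open>fast\<close> says that the final-time term is exponentially smaller than the main term.\<close>

lemma log_indicator_limit:
  assumes hf: "heat_flow \<gamma> \<rho> a T u ux0 F U" and md: "medium \<gamma> a M \<Psi>"
    and p: "filterlim p sector at_top" and s: "\<And>\<tau>. Re (p \<tau>) = - s * \<tau>"
    and \<delta>: "0 < \<delta>" "0 \<le> s"
    and fast: "\<forall>\<^sub>F \<tau> in at_top. \<delta> * \<tau> \<le> Re ((p \<tau>)\<^sup>2) * T - 2 * s * travel_time \<gamma> a * \<tau>"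
    and C: "0 < C"
    and lower: "\<forall>\<^sub>F \<tau> in at_top. C * \<tau> powr \<mu> \<le> norm (LINT t|lebesgue_on {0<..<T}. exp (- (p \<tau>)\<^sup>2 * of_real t) * of_real (ux0 t))"
  shows "((\<lambda>\<tau>. ln (norm (heat_indicator \<gamma> M a T \<Psi> u ux0 (p \<tau>))) / \<tau>) \<longlongrightarrow> - (2 * s * travel_time \<gamma> a)) at_top"
proof -
  interpret heat_flow \<gamma> \<rho> a T u ux0 F U by (rule hf)
  interpret medium \<gamma> a M \<Psi> by (rule md)
  let ?L = "travel_time \<gamma> a"
  let ?E = "\<lambda>z. exp (2 * z * of_real ?L)"
  let ?G = "\<lambda>\<tau>. (LINT t|lebesgue_on {0<..<T}. exp (- (p \<tau>)\<^sup>2 * of_real t) * of_real (ux0 t))"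
  obtain D X d K where d: "d \<noteq> 0" and K: "0 < K"
    and limD: "((\<lambda>z. D z / ?E z) \<longlongrightarrow> d) sector"
    and rep: "\<forall>\<^sub>F z in sector. norm (X z) \<le> K \<and> heat_indicator \<gamma> M a T \<Psi> u ux0 z
        = D z * (LINT t|lebesgue_on {0<..<T}. exp (- z\<^sup>2 * of_real t) * of_real (ux0 t)) + X z * exp (- z\<^sup>2 * of_real T)"
    using indicator_representation[OF hf md] by (elim exE conjE) (rule that)
  define CG where "CG = (LINT t|lebesgue_on {0<..<T}. \<bar>ux0 t\<bar>)"
  have CG0: "0 \<le> CG" unfolding CG_def by simp
  have G_le: "norm (?G \<tau>) \<le> CG" if "0 \<le> Re ((p \<tau>)\<^sup>2)" for \<tau>
  proof -
    have "norm (?G \<tau>) \<le> (LINT t|lebesgue_on {0<..<T}. norm (exp (- (p \<tau>)\<^sup>2 * of_real t) * of_real (ux0 t)))"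
      by (rule integral_norm_bound)
    also have "\<dots> \<le> CG" unfolding CG_def
    proof (rule integral_mono)
      have "integrable (lebesgue_on {0<..<T}) (\<lambda>t. exp (- (p \<tau>)\<^sup>2 * of_real t) * of_real (ux0 t))"
        using integrable_laplace[OF integrable_ux0, of "(p \<tau>)\<^sup>2"] by (simp add: scaleR_conv_of_real mult.commute)
      then show "integrable (lebesgue_on {0<..<T}) (\<lambda>t. norm (exp (- (p \<tau>)\<^sup>2 * of_real t) * of_real (ux0 t)))"
        by (rule integrable_norm)
      show "integrable (lebesgue_on {0<..<T}) (\<lambda>t. \<bar>ux0 t\<bar>)" using integrable_ux0 by simp
      fix t assume "t \<in> space (lebesgue_on {0<..<T})"
      then have "exp (- (Re ((p \<tau>)\<^sup>2) * t)) \<le> 1" using that by simp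
      moreover have "norm (exp (- (p \<tau>)\<^sup>2 * complex_of_real t)) = exp (- (Re ((p \<tau>)\<^sup>2) * t))"
        unfolding norm_exp_eq_Re by (simp del: power2_eq_square)
      ultimately show "norm (exp (- (p \<tau>)\<^sup>2 * of_real t) * of_real (ux0 t)) \<le> \<bar>ux0 t\<bar>"
        unfolding norm_mult norm_of_real by (simp add: mult_left_le_one_le)
    qed
    finally show ?thesis .
  qed
  have limDp: "((\<lambda>\<tau>. norm (D (p \<tau>) / ?E (p \<tau>))) \<longlongrightarrow> norm d) at_top"
    by (intro tendsto_norm filterlim_compose[OF limD p])
  have nd: "norm d > 0" using d by simp
  have D1: "\<forall>\<^sub>F \<tau> in at_top. norm (D (p \<tau>) / ?E (p \<tau>)) < norm d + 1"
    using order_tendstoD(2)[OF limDp, of "norm d + 1"] by simp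
  have D2: "\<forall>\<^sub>F \<tau> in at_top. norm d / 2 < norm (D (p \<tau>) / ?E (p \<tau>))"
    using order_tendstoD(1)[OF limDp, of "norm d / 2"] nd by simp
  have repp: "\<forall>\<^sub>F \<tau> in at_top. norm (X (p \<tau>)) \<le> K \<and> heat_indicator \<gamma> M a T \<Psi> u ux0 (p \<tau>)
        = D (p \<tau>) * ?G \<tau> + X (p \<tau>) * exp (- (p \<tau>)\<^sup>2 * of_real T)"
    using rep p by (auto simp: filterlim_iff)
  let ?J = "\<lambda>\<tau>. norm (heat_indicator \<gamma> M a T \<Psi> u ux0 (p \<tau>)) * exp (2 * s * ?L * \<tau>)"
  let ?R = "\<lambda>\<tau>. X (p \<tau>) * exp (- (p \<tau>)\<^sup>2 * of_real T) / ?E (p \<tau>)"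
  have J: "\<forall>\<^sub>F \<tau> in at_top. ?J \<tau> = norm (D (p \<tau>) / ?E (p \<tau>) * ?G \<tau> + ?R \<tau>)"
    using repp
  proof eventually_elim
    case (elim \<tau>)
    have "norm (?E (p \<tau>)) = exp (- (2 * s * ?L * \<tau>))" by (simp add: s mult_ac)
    then have "exp (2 * s * ?L * \<tau>) = 1 / norm (?E (p \<tau>))" by (simp add: exp_minus field_simps)
    then have "?J \<tau> = norm (heat_indicator \<gamma> M a T \<Psi> u ux0 (p \<tau>) / ?E (p \<tau>))"
      by (simp only: norm_divide times_divide_eq_right mult_1_right)
    then show ?case using elim by (simp only: add_divide_distrib times_divide_eq_left)
  qed
  have R: "\<forall>\<^sub>F \<tau> in at_top. norm (?R \<tau>) \<le> K * exp (- \<delta> * \<tau>)"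
    using repp fast
  proof eventually_elim
    case (elim \<tau>)
    have e1: "norm (?E (p \<tau>)) = exp (- (2 * s * ?L * \<tau>))" by (simp add: s mult_ac)
    have e2: "norm (exp (- (p \<tau>)\<^sup>2 * complex_of_real T)) = exp (- (Re ((p \<tau>)\<^sup>2) * T))"
      unfolding norm_exp_eq_Re by simp
    have "norm (?R \<tau>) = norm (X (p \<tau>)) * exp (- (Re ((p \<tau>)\<^sup>2) * T) - - (2 * s * ?L * \<tau>))"
      unfolding norm_divide norm_mult[of "X (p \<tau>)"] e1 e2 exp_diff by simp
    also have "\<dots> \<le> K * exp (- \<delta> * \<tau>)" using elim K by (intro mult_mono) auto
    finally show ?case .
  qed
  have small: "\<forall>\<^sub>F \<tau> in at_top. K * exp (- \<delta> * \<tau>) \<le> norm d / 4 * (C * \<tau> powr \<mu>)"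
  proof -
    have "((\<lambda>\<tau>. exp (- \<delta> * \<tau>) / \<tau> powr \<mu>) \<longlongrightarrow> 0) at_top" using \<delta>(1) by real_asymp
    then have "\<forall>\<^sub>F \<tau> in at_top. exp (- \<delta> * \<tau>) / \<tau> powr \<mu> < norm d / 4 * C / K"
      using nd C K by (intro order_tendstoD(2)) auto
    then show ?thesis using eventually_gt_at_top[of 0]
    proof eventually_elim
      case (elim \<tau>)
      then have "exp (- \<delta> * \<tau>) < norm d / 4 * C / K * \<tau> powr \<mu>" by (simp only: pos_divide_less_eq powr_gt_zero)
      then have "K * exp (- \<delta> * \<tau>) \<le> K * (norm d / 4 * C / K * \<tau> powr \<mu>)" using K by (intro mult_left_mono) auto
      then show ?case using K by simp
    qed
  qed
  have pos: "\<forall>\<^sub>F \<tau> in at_top. 0 \<le> Re ((p \<tau>)\<^sup>2)"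
    using fast eventually_gt_at_top[of 0]
  proof eventually_elim
    case (elim \<tau>)
    have "0 \<le> \<delta> * \<tau>" "0 \<le> 2 * s * ?L * \<tau>" using elim \<delta> \<theta>_a_pos by auto
    then have "0 \<le> Re ((p \<tau>)\<^sup>2) * T" using elim by linarith
    then show ?case using T by (simp only: zero_le_mult_iff) auto
  qed
  show ?thesis
  proof (rule tendsto_log_over_parameter)
    show "0 < norm d / 4 * C" using nd C by simp
    show "\<forall>\<^sub>F \<tau> in at_top. norm d / 4 * C * \<tau> powr \<mu> \<le> ?J \<tau>"
      using J R small D2 lower
    proof eventually_elim
      case (elim \<tau>)
      have "norm d / 2 * (C * \<tau> powr \<mu>) \<le> norm (D (p \<tau>) / ?E (p \<tau>)) * norm (?G \<tau>)"
        using elim C by (intro mult_mono) auto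
      also have "\<dots> = norm (D (p \<tau>) / ?E (p \<tau>) * ?G \<tau>)" by (simp only: norm_mult)
      also have "\<dots> \<le> ?J \<tau> + norm (?R \<tau>)"
        unfolding elim(1) using norm_triangle_ineq4[of "D (p \<tau>) / ?E (p \<tau>) * ?G \<tau> + ?R \<tau>" "?R \<tau>"] by simp
      finally have "norm d / 2 * (C * \<tau> powr \<mu>) \<le> ?J \<tau> + norm d / 4 * (C * \<tau> powr \<mu>)"
        using elim(2,3) by linarith
      then show ?case by (simp add: algebra_simps)
    qed
    show "\<forall>\<^sub>F \<tau> in at_top. ?J \<tau> \<le> (norm d + 1) * CG + K"
      using J R D1 pos eventually_gt_at_top[of 0]
    proof eventually_elim
      case (elim \<tau>)
      have "?J \<tau> \<le> norm (D (p \<tau>) / ?E (p \<tau>)) * norm (?G \<tau>) + norm (?R \<tau>)"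
        unfolding elim(1) norm_mult[of "D (p \<tau>) / ?E (p \<tau>)", symmetric] by (rule norm_triangle_ineq)
      moreover have "norm (D (p \<tau>) / ?E (p \<tau>)) * norm (?G \<tau>) \<le> (norm d + 1) * CG"
        using elim G_le[OF elim(4)] CG0 by (intro mult_mono) auto
      moreover have "norm (?R \<tau>) \<le> K"
      proof -
        have "exp (- \<delta> * \<tau>) \<le> 1" using \<delta>(1) elim by simp
        then have "K * exp (- \<delta> * \<tau>) \<le> K * 1" using K by (intro mult_left_mono) auto
        then show ?thesis using elim(2) by linarith
      qed
      ultimately show ?case by linarith
    qed
  qed
qed

lemma filterlim_sector:
  assumes s: "0 < s" and Re: "\<And>\<tau>. Re (p \<tau>) = - s * \<tau>"
    and cone: "\<forall>\<^sub>F \<tau> in at_top. norm (p \<tau>) \<le> 2 * s * \<tau>"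
  shows "filterlim p sector at_top"
  unfolding sector_def filterlim_inf filterlim_principal
proof
  have "filterlim (\<lambda>\<tau>. norm (p \<tau>)) at_top at_top"
  proof (rule filterlim_at_top_mono)
    show "filterlim (\<lambda>\<tau>::real. s * \<tau>) at_top at_top" using s by real_asymp
    show "\<forall>\<^sub>F \<tau> in at_top. s * \<tau> \<le> norm (p \<tau>)"
    proof (intro always_eventually allI)
      fix \<tau> show "s * \<tau> \<le> norm (p \<tau>)" using abs_Re_le_cmod[of "p \<tau>"] Re[of \<tau>] by simp
    qed
  qed
  then show "filterlim p at_infinity at_top" by (rule filterlim_norm_at_top_imp_at_infinity)
  show "\<forall>\<^sub>F \<tau> in at_top. p \<tau> \<in> {z. norm z \<le> - 2 * Re z}"
    using cone by eventually_elim (simp add: Re)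
qed

lemma ray_facts:
  assumes c: "0 < c"
  shows "Re (ray c \<tau>) = - c * \<tau>"
    and "\<tau> > 1 / c\<^sup>2 \<Longrightarrow> norm (ray c \<tau>) \<le> 2 * c * \<tau>"
    and "\<tau> > 1 / c\<^sup>2 \<Longrightarrow> Re ((ray c \<tau>)\<^sup>2) = \<tau>"
proof -
  define r where "r = sqrt (1 - 1 / (c\<^sup>2 * \<tau>))"
  have ray: "ray c \<tau> = Complex (- c * \<tau>) (- c * \<tau> * r)"
    by (simp add: ray_def r_def complex_eq_iff)
  show "Re (ray c \<tau>) = - c * \<tau>" by (simp add: ray)
  assume \<tau>: "\<tau> > 1 / c\<^sup>2"
  have t0: "\<tau> > 0" using \<tau> c by (meson less_trans zero_less_divide_1_iff zero_less_power)
  have "1 < c\<^sup>2 * \<tau>" using \<tau> c by (simp add: field_simps)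
  then have q: "0 \<le> 1 - 1 / (c\<^sup>2 * \<tau>)" "1 - 1 / (c\<^sup>2 * \<tau>) \<le> 1" by simp_all
  have r: "0 \<le> r" "r \<le> 1" "r\<^sup>2 = 1 - 1 / (c\<^sup>2 * \<tau>)" using q unfolding r_def by simp_all
  have "norm (ray c \<tau>) \<le> \<bar>Re (ray c \<tau>)\<bar> + \<bar>Im (ray c \<tau>)\<bar>" by (rule cmod_le)
  also have "\<dots> = c * \<tau> + c * \<tau> * r" using c t0 r by (simp add: ray abs_mult)
  also have "\<dots> \<le> 2 * c * \<tau>" using mult_left_mono[OF r(2), of "c * \<tau>"] c t0 by simp
  finally show "norm (ray c \<tau>) \<le> 2 * c * \<tau>" .
  have "Re ((ray c \<tau>)\<^sup>2) = (c * \<tau>)\<^sup>2 * (1 - r\<^sup>2)" by (simp add: ray power2_eq_square algebra_simps)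
  also have "\<dots> = \<tau>" unfolding r(3) using c t0 by (simp add: power2_eq_square)
  finally show "Re ((ray c \<tau>)\<^sup>2) = \<tau>" .
qed

theorem theorem2p5:
  fixes M a T \<rho> :: real and \<gamma> :: "real \<Rightarrow> real"
    and u :: "real \<Rightarrow> real \<Rightarrow> real" and ux0 uxa :: "real \<Rightarrow> real"
    and \<Psi> :: "complex \<Rightarrow> real \<Rightarrow> complex"
  assumes "0 < a" and "a \<le> M" and "0 < T" and "0 \<le> \<rho>"
    and "C2_on {0..M} \<gamma>" and "\<forall>x\<in>{0..M}. 0 < \<gamma> x"
    and "special_family \<gamma> M \<Psi>"
    and "heat_solution \<gamma> \<rho> a T u ux0 uxa"
  shows
    "(\<forall>c>0. T > 2 * c * integral {0..M} (\<lambda>x. 1 / sqrt (\<gamma> x)) \<longrightarrow>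
        (\<exists>C>0. \<exists>\<tau>0>1 / c\<^sup>2. \<exists>\<mu>::real. \<forall>\<tau>>\<tau>0.
           C * \<tau> powr \<mu> \<le> norm (LINT t|lebesgue_on {0<..<T}.
             exp (- (ray c \<tau>)\<^sup>2 * complex_of_real t) * complex_of_real (ux0 t))) \<longrightarrow>
        ((\<lambda>\<tau>. ln (norm (heat_indicator \<gamma> M a T \<Psi> u ux0 (ray c \<tau>))) / \<tau>)
           \<longlongrightarrow> - 2 * c * integral {0..a} (\<lambda>x. 1 / sqrt (\<gamma> x))) at_top)
     \<and>
     ((\<exists>C>0. \<exists>\<tau>0>0. \<exists>\<mu>::real. \<forall>\<tau>>\<tau>0.
         C * \<tau> powr \<mu> \<le> \<bar>LINT t|lebesgue_on {0<..<T}. exp (- \<tau>\<^sup>2 * t) * ux0 t\<bar>) \<longrightarrow>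
      ((\<lambda>\<tau>. ln (norm (heat_indicator \<gamma> M a T \<Psi> u ux0 (- complex_of_real \<tau>))) / \<tau>)
         \<longlongrightarrow> - 2 * integral {0..a} (\<lambda>x. 1 / sqrt (\<gamma> x))) at_top)"
proof -
  obtain \<gamma>1 where \<gamma>1: "\<And>x. x \<in> {0..M} \<Longrightarrow> (\<gamma> has_real_derivative \<gamma>1 x) (at x within {0..M})"
    using assms(5) unfolding C2_on_def by blast
  have c\<gamma>: "continuous_on {0..M} \<gamma>" using \<gamma>1 by (rule DERIV_continuous_on)
  have md: "medium \<gamma> a M \<Psi>" by unfold_locales (use assms c\<gamma> in auto)
  have u_H1: "AE t in lebesgue_on {0<..<T}. u t \<in> H1 a" and ux0: "ux0 \<in> L2 {0<..<T}"
    using assms(8) unfolding heat_solution_def bochner_L2_def by blast+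
  obtain F where F: "bochner_L2 T (H1_dual a) (H1_dual_norm a) F" "is_time_deriv a T u F"
    "\<forall>\<phi>\<in>H1 a. AE t in lebesgue_on {0<..<T}.
             F t \<phi>
             + (LINT x|lebesgue_on {0<..<a}. \<gamma> x * weak_deriv a (u t) x * weak_deriv a \<phi> x)
             + \<rho> * point_value a (u t) a * point_value a \<phi> a
             = - \<gamma> 0 * ux0 t * point_value a \<phi> 0"
    using assms(8) unfolding heat_solution_def by blast
  obtain U where U: "\<forall>t\<in>{0..T}. U t \<in> L2 {0<..<a}"
          "\<forall>s\<in>{0..T}. ((\<lambda>t. L2_norm {0<..<a} (U t - U s)) \<longlongrightarrow> 0) (at s within {0..T})"
          "AE t in lebesgue_on {0<..<T}. AE x in lebesgue_on {0<..<a}. U t x = u t x"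
          "AE x in lebesgue_on {0<..<a}. U 0 x = 0"
    using assms(8) unfolding heat_solution_def zero_initial_value_def by blast
  have hf: "heat_flow \<gamma> \<rho> a T u ux0 F U"
  proof
    show "continuous_on {0..a} \<gamma>" using continuous_on_subset[OF c\<gamma>] assms(2) by auto
  qed (use assms(1-3,6) u_H1 ux0 F U in auto)
  interpret medium \<gamma> a M \<Psi> by (rule md)
  note limit = log_indicator_limit[OF hf md]
  show ?thesis
  proof (intro conjI allI impI)
    fix c :: real assume c: "c > 0" and Tc: "T > 2 * c * integral {0..M} (\<lambda>x. 1 / sqrt (\<gamma> x))"
    assume "\<exists>C>0. \<exists>\<tau>0>1 / c\<^sup>2. \<exists>\<mu>::real. \<forall>\<tau>>\<tau>0.
           C * \<tau> powr \<mu> \<le> norm (LINT t|lebesgue_on {0<..<T}.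
             exp (- (ray c \<tau>)\<^sup>2 * complex_of_real t) * complex_of_real (ux0 t))"
    then obtain C \<tau>0 \<mu> where C: "C > 0" and lower: "\<forall>\<tau>>\<tau>0. C * \<tau> powr \<mu> \<le> norm (LINT t|lebesgue_on {0<..<T}.
             exp (- (ray c \<tau>)\<^sup>2 * complex_of_real t) * complex_of_real (ux0 t))" by blast
    have cs: "continuous_on {0..M} (\<lambda>x. 1 / sqrt (\<gamma> x))"
      using pos_\<gamma>M by (intro continuous_intros c\<gamma>) force
    have "travel_time \<gamma> a \<le> integral {0..M} (\<lambda>x. 1 / sqrt (\<gamma> x))"
    proof (rule integral_subset_le)
      show "(\<lambda>x. 1 / sqrt (\<gamma> x)) integrable_on {0..a}" "(\<lambda>x. 1 / sqrt (\<gamma> x)) integrable_on {0..M}"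
        using assms(2) by (auto intro!: integrable_continuous_real continuous_on_subset[OF cs])
      show "\<forall>x\<in>{0..M}. 0 \<le> 1 / sqrt (\<gamma> x)" using pos_\<gamma>M by (auto simp: less_imp_le)
    qed (use assms(2) in auto)
    then have "2 * c * travel_time \<gamma> a \<le> 2 * c * integral {0..M} (\<lambda>x. 1 / sqrt (\<gamma> x))"
      using c by (intro mult_left_mono) auto
    then have \<delta>: "0 < T - 2 * c * travel_time \<gamma> a" using Tc by linarith
    have ev: "\<forall>\<^sub>F \<tau> in at_top. \<tau> > 1 / c\<^sup>2" by (rule eventually_gt_at_top)
    have "((\<lambda>\<tau>. ln (norm (heat_indicator \<gamma> M a T \<Psi> u ux0 (ray c \<tau>))) / \<tau>) \<longlongrightarrow> - (2 * c * travel_time \<gamma> a)) at_top"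
    proof (rule limit[OF _ _ \<delta> _ _ C])
      show "filterlim (ray c) sector at_top"
      proof (rule filterlim_sector[OF c ray_facts(1)[OF c]])
        show "\<forall>\<^sub>F \<tau> in at_top. norm (ray c \<tau>) \<le> 2 * c * \<tau>"
          using ev by eventually_elim (rule ray_facts(2)[OF c])
      qed
      show "\<forall>\<^sub>F \<tau> in at_top. (T - 2 * c * travel_time \<gamma> a) * \<tau> \<le> Re ((ray c \<tau>)\<^sup>2) * T - 2 * c * travel_time \<gamma> a * \<tau>"
        using ev
      proof eventually_elim
        case (elim \<tau>)
        show ?case unfolding ray_facts(3)[OF c elim] by (simp add: algebra_simps)
      qed
      show "\<forall>\<^sub>F \<tau> in at_top. C * \<tau> powr \<mu> \<le> norm (LINT t|lebesgue_on {0<..<T}.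
             exp (- (ray c \<tau>)\<^sup>2 * complex_of_real t) * complex_of_real (ux0 t))"
        using eventually_gt_at_top[of \<tau>0] by eventually_elim (use lower in blast)
    qed (use c ray_facts(1)[OF c] in auto)
    then show "((\<lambda>\<tau>. ln (norm (heat_indicator \<gamma> M a T \<Psi> u ux0 (ray c \<tau>))) / \<tau>)
           \<longlongrightarrow> - 2 * c * integral {0..a} (\<lambda>x. 1 / sqrt (\<gamma> x))) at_top" by simp
  next
    assume "\<exists>C>0. \<exists>\<tau>0>0. \<exists>\<mu>::real. \<forall>\<tau>>\<tau>0.
         C * \<tau> powr \<mu> \<le> \<bar>LINT t|lebesgue_on {0<..<T}. exp (- \<tau>\<^sup>2 * t) * ux0 t\<bar>"
    then obtain C \<tau>0 \<mu> where C: "C > 0" and lower: "\<forall>\<tau>>\<tau>0.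
         C * \<tau> powr \<mu> \<le> \<bar>LINT t|lebesgue_on {0<..<T}. exp (- \<tau>\<^sup>2 * t) * ux0 t\<bar>" by blast
    have "((\<lambda>\<tau>. ln (norm (heat_indicator \<gamma> M a T \<Psi> u ux0 (- complex_of_real \<tau>))) / \<tau>) \<longlongrightarrow> - (2 * 1 * travel_time \<gamma> a)) at_top"
    proof (rule limit[of _ 1 1, OF _ _ _ _ _ C])
      show "filterlim (\<lambda>\<tau>. - complex_of_real \<tau>) sector at_top"
      proof (rule filterlim_sector[of 1])
        show "\<forall>\<^sub>F \<tau> in at_top. norm (- complex_of_real \<tau>) \<le> 2 * 1 * \<tau>"
          using eventually_gt_at_top[of 0] by eventually_elim simp
      qed auto
      have "\<forall>\<^sub>F \<tau> in at_top. 1 * \<tau> \<le> \<tau>\<^sup>2 * T - 2 * 1 * travel_time \<gamma> a * \<tau>"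
        using eventually_ge_at_top[of "(1 + 2 * travel_time \<gamma> a) / T"] eventually_gt_at_top[of 0]
      proof eventually_elim
        case (elim \<tau>)
        have "1 + 2 * travel_time \<gamma> a \<le> \<tau> * T" using elim(1) assms(3) by (simp only: pos_divide_le_eq)
        then have "\<tau> * (1 + 2 * travel_time \<gamma> a) \<le> \<tau> * (\<tau> * T)" using elim(2) by (intro mult_left_mono) auto
        then show ?case by (simp add: power2_eq_square algebra_simps)
      qed
      then show "\<forall>\<^sub>F \<tau> in at_top. 1 * \<tau> \<le> Re ((- complex_of_real \<tau>)\<^sup>2) * T - 2 * 1 * travel_time \<gamma> a * \<tau>"
        by (simp flip: of_real_power)
      show "\<forall>\<^sub>F \<tau> in at_top. C * \<tau> powr \<mu> \<le> norm (LINT t|lebesgue_on {0<..<T}.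
             exp (- (- complex_of_real \<tau>)\<^sup>2 * complex_of_real t) * complex_of_real (ux0 t))"
        using eventually_gt_at_top[of \<tau>0]
      proof eventually_elim
        case (elim \<tau>)
        have "exp (- (- complex_of_real \<tau>)\<^sup>2 * complex_of_real t) * complex_of_real (ux0 t) = of_real (exp (- \<tau>\<^sup>2 * t) * ux0 t)" for t
          by (simp add: exp_of_real[symmetric])
        then have "(LINT t|lebesgue_on {0<..<T}. exp (- (- complex_of_real \<tau>)\<^sup>2 * complex_of_real t) * complex_of_real (ux0 t))
          = of_real (LINT t|lebesgue_on {0<..<T}. exp (- \<tau>\<^sup>2 * t) * ux0 t)"
          by (simp only: integral_complex_of_real)
        then show ?case using lower elim by (simp only: norm_of_real)
      qed
    qed auto
    then show "((\<lambda>\<tau>. ln (norm (heat_indicator \<gamma> M a T \<Psi> u ux0 (- complex_of_real \<tau>))) / \<tau>)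
         \<longlongrightarrow> - 2 * integral {0..a} (\<lambda>x. 1 / sqrt (\<gamma> x))) at_top" by simp
  qed
qed

end
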